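(* Let $u\in\mathrm{BMOA}_{\mathrm{simp}}(\mathbb T)$. Then the linear Hankel operator $\Gamma_u$ is self-adjoint if and only if both $\Psi_u$ and $\widetilde\Psi_u$ are functions with values $\pm1$ (as elements of $L^\infty(\rho)$ and $L^\infty(\widetilde\rho_0)$ respectively).
   Context: $H^2=H^2(\mathbb T)$ is the Hardy space on the unit circle, $P:L^2(\mathbb T)\to H^2$ is the orthogonal projection, $S$ is the shift $Sf(z)=zf(z)$ on $H^2$. For $u\in\mathrm{BMOA}(\mathbb T)$, $\Gamma_u$ is the bounded linear Hankel operator on $H^2$ whose matrix in the basis $\{z^k\}_{k\ge0}$ is $\{\widehat u_{j+k}\}_{j,k\ge0}$, where $\widehat u_k$ are the Fourier coefficients of $u$. The anti-linear Hankel operator is $H_uf=P(u\overline f)=\Gamma_u\mathbf C f$, where $\mathbf Cf(z)=\overline{f(\overline z)}$; and $\widetilde H_u:=S^*H_u=H_uS=H_{S^*u}$. The operators $H_u^2,\widetilde H_u^2$ are linear and positive semi-definite; $|H_u|:=(H_u^2)^{1/2}$, $|\widetilde H_u|:=(\widetilde H_u^2)^{1/2}$. The subspace $\overline{\mathrm{Ran}}\,H_u$ (closure of the range) is invariant under $H_u$ and $\widetilde H_u$; $H_u^{\mathrm e}$, $\widetilde H_u^{\mathrm e}$ are the restrictions of $H_u$, $\widetilde H_u$ to $\overline{\mathrm{Ran}}\,H_u$. $\mathrm{BMOA}_{\mathrm{simp}}(\mathbb T)$ is the set of $u\in\mathrm{BMOA}(\mathbb T)$ such that both $(H_u^{\mathrm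 e})^2$ and $(\widetilde H_u^{\mathrm e})^2$ have simple spectra (i.e. possess a cyclic vector). For $u\in\mathrm{BMOA}_{\mathrm{simp}}(\mathbb T)$ the vector $u$ lies in $\overline{\mathrm{Ran}}\,H_u$ and is cyclic for both $|H_u^{\mathrm e}|$ and $|\widetilde H_u^{\mathrm e}|$. Let $\rho$, $\widetilde\rho$ be the spectral measures: $\int f\,d\rho=\langle f(|H_u|)u,u\rangle$, $\int f\,d\widetilde\rho=\langle f(|\widetilde H_u|)u,u\rangle$ for continuous $f$; $\rho$ is carried by $(0,\infty)$, $\widetilde\rho$ by $[0,\infty)$, and $\widetilde\rho_0=\widetilde\rho|_{(0,\infty)}$. There exist unimodular functions $\Psi_u$, unique in $L^\infty(\rho)$, and $\widetilde\Psi_u$, unique in $L^\infty(\widetilde\rho_0)$, such that $$H_u^{\mathrm e}f(|H_u^{\mathrm e}|)u=|H_u^{\mathrm e}|\,\overline{\Psi_u}(|H_u^{\mathrm e}|)\,\overline f(|H_u^{\mathrm e}|)u,\quad f\in L^2(\rho),$$ $$\widetilde H_u^{\mathrm e}f(|\widetilde H_u^{\mathrm e}|)u=|\widetilde H_u^{\mathrm e}|\,\widetilde\Psi_u(|\widetilde H_u^{\mathrm e}|)\,\overline f(|\widetilde H_u^{\mathrm e}|)u,\quad f\in L^2(\widetilde\rho).$$ *)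

theory Defs
  imports "HOL-Analysis.Analysis" "HOL-Computational_Algebra.Polynomial"
begin

section \<open>The unit circle\<close>

text \<open>Normalised arc length on the unit circle, as a Borel measure on the complex plane. Functions
  on the circle are Borel functions on the plane; their values off the circle are irrelevant.\<close>

definition circ :: "complex measure" where
  "circ = distr (uniform_measure lborel {-pi..pi}) borel cis"

lemma sets_circ [simp, measurable_cong]: "sets circ = sets borel"
  and space_circ [simp]: "space circ = UNIV"
  by (simp_all add: circ_def)

lemma cis_borel [measurable]: "cis \<in> borel_measurable borel"
  by (intro borel_measurable_continuous_onI continuous_intros)

lemma cnj_borel [measurable]: "cnj \<in> borel_measurable borel"
  by (intro borel_measurable_continuous_onI continuous_intros)

lemma emeasure_circ_interval:
  "emeasure lborel {-pi..pi} = ennreal (2 * pi)" 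
  "emeasure lborel {-pi..pi} \<noteq> 0" "emeasure lborel {-pi..pi} \<noteq> \<infinity>"
  using pi_gt_zero by (auto simp: ennreal_eq_0_iff simp del: pi_gt_zero)

lemma emeasure_circ_UNIV: "emeasure circ UNIV = 1"
  using emeasure_uniform_measure_1[OF emeasure_circ_interval(2,3)]
  unfolding circ_def
  by (subst emeasure_distr)
    (auto simp: emeasure_circ_interval intro!: ennreal_divide_self)

lemma finite_measure_circ: "finite_measure circ"
  by (rule finite_measureI) (simp add: emeasure_circ_UNIV)

lemma AE_circ_norm: "AE z in circ. cmod z = 1"
  unfolding circ_def by (subst AE_distr_iff) auto

lemma circ_distr_cnj: "distr circ borel cnj = circ"
proof -
  let ?U = "uniform_measure lborel {-pi..pi::real}"
  have U: "distr ?U borel uminus = ?U"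
  proof (rule measure_eqI)
    fix A :: "real set" assume "A \<in> sets (distr ?U borel uminus)"
    then have A [measurable]: "A \<in> sets borel" by simp
    have "emeasure lborel ({-pi..pi} \<inter> A) = emeasure (distr lborel borel uminus) ({-pi..pi} \<inter> A)"
      by (simp add: lborel_distr_uminus)
    also have "\<dots> = emeasure lborel (uminus -` ({-pi..pi} \<inter> A))"
      by (subst emeasure_distr) auto
    also have "uminus -` ({-pi..pi} \<inter> A) = {-pi..pi} \<inter> uminus -` A"
      by auto
    finally have eq: "emeasure lborel ({-pi..pi} \<inter> A) = emeasure lborel ({-pi..pi} \<inter> uminus -` A)" .
    have m: "uminus -` A \<in> sets borel"
      using measurable_sets[of "uminus :: real \<Rightarrow> real" borel borel A] by simp
    show "emeasure (distr ?U borel uminus) A = emeasure ?U A"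
      using m by (subst emeasure_distr) (auto simp: eq)
  qed simp
  have "distr circ borel cnj = distr ?U borel (cnj \<circ> cis)"
    unfolding circ_def by (rule distr_distr) auto
  also have "cnj \<circ> cis = cis \<circ> uminus"
    by (auto simp: cis_cnj)
  also have "distr ?U borel (cis \<circ> uminus) = distr (distr ?U borel uminus) borel cis"
    by (rule distr_distr[symmetric]) auto
  finally show ?thesis by (simp add: U circ_def)
qed

lemma integral_circ_cnj:
  fixes g :: "complex \<Rightarrow> 'b::{banach, second_countable_topology}"
  assumes "g \<in> borel_measurable borel"
  shows "(\<integral>z. g (cnj z) \<partial>circ) = (\<integral>z. g z \<partial>circ)"
    and "integrable circ (\<lambda>z. g (cnj z)) \<longleftrightarrow> integrable circ g"
    using integral_distr[of cnj circ borel g] integrable_distr_eq[of cnj circ borel g] assms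
    by (simp_all add: circ_distr_cnj)

lemma integral_circ_power:
  assumes "n \<ge> (1::nat)" shows "(\<integral>z. z ^ n \<partial>circ) = 0"
proof -
  let ?F = "\<lambda>t. cis (real n * t) / (\<i> * of_nat n)"
  have "(\<integral>z. z ^ n \<partial>circ) = (\<integral>t. cis t ^ n \<partial>uniform_measure lborel {-pi..pi})"
    unfolding circ_def by (rule integral_distr) auto
  also have "\<dots> = (\<integral>t. (indicator {-pi..pi} t / (2 * pi)) *\<^sub>R cis (real n * t) \<partial>lborel)"
  proof -
    have u: "uniform_measure lborel {-pi..pi} = density lborel (\<lambda>t. ennreal (indicator {-pi..pi} t / (2 * pi)))"
      unfolding uniform_measure_def
      by (intro density_cong) (auto simp: emeasure_circ_interval(1) divide_ennreal[symmetric] split: split_indicator)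
    show ?thesis
      unfolding u Complex.DeMoivre by (subst integral_density) auto
  qed
  also have "\<dots> = (1 / (2 * pi)) *\<^sub>R (\<integral>t. indicator {-pi..pi} t *\<^sub>R cis (real n * t) \<partial>lborel)"
    by (subst integral_scaleR_right[symmetric]) (auto intro!: Bochner_Integration.integral_cong split: split_indicator)
  also have "(\<integral>t. indicator {-pi..pi} t *\<^sub>R cis (real n * t) \<partial>lborel) = ?F pi - ?F (-pi)"
  proof (rule integral_FTC_Icc)
    fix t :: real
    have F: "?F = (\<lambda>t. exp (\<i> * of_nat n * of_real t) / (\<i> * of_nat n))"
      and c: "cis (real n * t) = exp (\<i> * of_nat n * of_real t)"
      by (simp_all add: cis_conv_exp mult.assoc)
    have "((\<lambda>z. exp (\<i> * of_nat n * z) / (\<i> * of_nat n)) has_field_derivative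
        exp (\<i> * of_nat n * of_real t)) (at (of_real t))"
      using assms by (auto intro!: derivative_eq_intros)
    then show "(?F has_vector_derivative cis (real n * t)) (at t within {-pi..pi})"
      unfolding F c by (rule has_vector_derivative_real_field)
  qed (auto intro!: continuous_intros)
  also have "?F pi - ?F (-pi) = 0"
  proof -
    have "cis (real n * pi) = cis (real n * - pi)"
      by (simp add: complex_eq_iff)
    then show ?thesis by simp
  qed
  finally show ?thesis by simp
qed

section \<open>The Hardy space\<close>

definition hardy_fun :: "(complex \<Rightarrow> complex) \<Rightarrow> bool" where
  "hardy_fun f \<longleftrightarrow> f \<in> borel_measurable borel \<and> integrable circ (\<lambda>z. (cmod (f z))\<^sup>2)
     \<and> (\<forall>n\<ge>1::nat. (\<integral>z. f z * z ^ n \<partial>circ) = 0)"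

text \<open>On the circle \<^term>\<open>z ^ n\<close> is the conjugate of \<open>z\<^sup>-\<^sup>n\<close>, so the last condition says
  that the Fourier coefficients of negative index vanish. Elements of the Hardy space are classes
  of such functions modulo equality almost everywhere.\<close>

definition hardy_rel :: "(complex \<Rightarrow> complex) \<Rightarrow> (complex \<Rightarrow> complex) \<Rightarrow> bool" where
  "hardy_rel f g \<longleftrightarrow> hardy_fun f \<and> hardy_fun g \<and> (AE z in circ. f z = g z)"

lemma integrable_circ_prod:
  fixes f g :: "complex \<Rightarrow> complex"
  assumes [measurable]: "f \<in> borel_measurable borel" "g \<in> borel_measurable borel"
    and i: "integrable circ (\<lambda>z. (cmod (f z))\<^sup>2)" "integrable circ (\<lambda>z. (cmod (g z))\<^sup>2)"
  shows "integrable circ (\<lambda>z. f z * g z)"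
proof (rule Bochner_Integration.integrable_bound)
  show "integrable circ (\<lambda>z. (cmod (f z))\<^sup>2 + (cmod (g z))\<^sup>2)"
    using i by simp
  show "AE z in circ. norm (f z * g z) \<le> norm ((cmod (f z))\<^sup>2 + (cmod (g z))\<^sup>2)"
  proof (rule AE_I2)
    fix z
    have "0 \<le> (cmod (f z) - cmod (g z))\<^sup>2" "0 \<le> cmod (f z) * cmod (g z)" by simp_all
    then show "norm (f z * g z) \<le> norm ((cmod (f z))\<^sup>2 + (cmod (g z))\<^sup>2)"
      unfolding norm_mult real_norm_def power2_diff by linarith
  qed
qed simp

lemma integrable_circ_norm_power: "integrable circ (\<lambda>z. (cmod (z ^ n))\<^sup>2)"
proof -
  interpret finite_measure circ by (rule finite_measure_circ)
  show ?thesis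
    by (rule integrable_const_bound[where B=1]) (use AE_circ_norm in \<open>auto simp: norm_power\<close>)
qed

lemma hardy_funD:
  assumes "hardy_fun f"
  shows "f \<in> borel_measurable borel" "integrable circ (\<lambda>z. (cmod (f z))\<^sup>2)"
    "\<And>n. n \<ge> 1 \<Longrightarrow> (\<integral>z. f z * z ^ n \<partial>circ) = 0"
    "\<And>n. integrable circ (\<lambda>z. f z * z ^ n)"
proof -
  show f: "f \<in> borel_measurable borel" "integrable circ (\<lambda>z. (cmod (f z))\<^sup>2)"
    "\<And>n. n \<ge> 1 \<Longrightarrow> (\<integral>z. f z * z ^ n \<partial>circ) = 0"
    using assms by (auto simp: hardy_fun_def)
  show "integrable circ (\<lambda>z. f z * z ^ n)" for n
    by (rule integrable_circ_prod) (use f integrable_circ_norm_power in auto)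
qed

lemma integrable_circ_prod_cnj:
  assumes "hardy_fun f" "hardy_fun g"
  shows "integrable circ (\<lambda>z. f z * cnj (g z))"
  using integrable_circ_prod[of f "\<lambda>z. cnj (g z)"] hardy_funD[OF assms(1)] hardy_funD[OF assms(2)]
  by simp

lemma hardy_fun_zero: "hardy_fun (\<lambda>z. 0)"
  by (simp add: hardy_fun_def)

lemma hardy_fun_add:
  assumes "hardy_fun f" "hardy_fun g" shows "hardy_fun (\<lambda>z. f z + g z)"
proof -
  note f = hardy_funD[OF assms(1)] and g = hardy_funD[OF assms(2)]
  note [measurable] = f(1) g(1)
  have "integrable circ (\<lambda>z. (cmod (f z + g z))\<^sup>2)"
  proof (rule Bochner_Integration.integrable_bound)
    show "integrable circ (\<lambda>z. 2 * (cmod (f z))\<^sup>2 + 2 * (cmod (g z))\<^sup>2)"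
      using f g by simp
    show "AE z in circ. norm ((cmod (f z + g z))\<^sup>2) \<le> norm (2 * (cmod (f z))\<^sup>2 + 2 * (cmod (g z))\<^sup>2)"
    proof (rule AE_I2)
      fix z
      have "(cmod (f z + g z))\<^sup>2 \<le> (cmod (f z) + cmod (g z))\<^sup>2"
        by (intro power_mono norm_triangle_ineq) simp
      also have "\<dots> \<le> 2 * (cmod (f z))\<^sup>2 + 2 * (cmod (g z))\<^sup>2"
        using zero_le_power2[of "cmod (f z) - cmod (g z)"] by (simp add: power2_diff power2_sum)
      finally show "norm ((cmod (f z + g z))\<^sup>2) \<le> norm (2 * (cmod (f z))\<^sup>2 + 2 * (cmod (g z))\<^sup>2)"
        by simp
    qed
  qed simp
  then show ?thesis
    using f g by (simp add: hardy_fun_def distrib_right)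
qed

lemma hardy_fun_cmult:
  assumes "hardy_fun f" shows "hardy_fun (\<lambda>z. c * f z)"
  using hardy_funD[OF assms]
  by (simp add: hardy_fun_def norm_mult power_mult_distrib mult.assoc)

lemma hardy_fun_uminus: "hardy_fun f \<Longrightarrow> hardy_fun (\<lambda>z. - f z)"
  using hardy_fun_cmult[of f "-1"] by simp

lemma hardy_fun_diff: "hardy_fun f \<Longrightarrow> hardy_fun g \<Longrightarrow> hardy_fun (\<lambda>z. f z - g z)"
  using hardy_fun_add[of f "\<lambda>z. - g z"] hardy_fun_uminus[of g] by simp

lemma hardy_fun_monomial: "hardy_fun (\<lambda>z. z ^ k)"
  using integral_circ_power[of "k + _"] integrable_circ_norm_power
  by (simp add: hardy_fun_def power_add[symmetric])

lemma hardy_fun_shift: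
  assumes "hardy_fun f" shows "hardy_fun (\<lambda>z. z * f z)"
proof -
  note f = hardy_funD[OF assms]
  note [measurable] = f(1)
  have "integrable circ (\<lambda>z. (cmod (z * f z))\<^sup>2) \<longleftrightarrow> integrable circ (\<lambda>z. (cmod (f z))\<^sup>2)"
    by (rule integrable_cong_AE) (use AE_circ_norm in \<open>auto simp: norm_mult\<close>)
  moreover have "(\<integral>z. z * f z * z ^ n \<partial>circ) = 0" for n
    using f(3)[of "Suc n"] by (simp add: mult_ac)
  ultimately show ?thesis
    using f by (simp add: hardy_fun_def)
qed

lemma hardy_fun_cconj:
  assumes "hardy_fun f" shows "hardy_fun (\<lambda>z. cnj (f (cnj z)))"
proof -
  note f = hardy_funD[OF assms]
  note [measurable] = f(1)
  have "(\<integral>z. cnj (f (cnj z)) * z ^ n \<partial>circ) = 0" if "n \<ge> 1" for n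
  proof -
    have "(\<integral>z. cnj (f (cnj z)) * z ^ n \<partial>circ) = (\<integral>z. cnj (f (cnj z) * cnj z ^ n) \<partial>circ)"
      by simp
    also have "\<dots> = cnj (\<integral>z. f (cnj z) * cnj z ^ n \<partial>circ)"
      by (rule Bochner_Integration.integral_cnj)
    also have "\<dots> = 0"
      using integral_circ_cnj(1)[of "\<lambda>z. f z * z ^ n"] f(3)[OF that] by simp
    finally show ?thesis .
  qed
  then show ?thesis
    using f integral_circ_cnj(2)[of "\<lambda>z. (cmod (f z))\<^sup>2"] by (simp add: hardy_fun_def)
qed

quotient_type hardy = "complex \<Rightarrow> complex" / partial: hardy_rel
proof (rule part_equivpI)
  show "\<exists>f. hardy_rel f f"
    using hardy_fun_zero by (auto simp: hardy_rel_def)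
  show "symp hardy_rel"
    by (auto simp: symp_def hardy_rel_def)
  show "transp hardy_rel"
    by (auto simp: transp_def hardy_rel_def)
qed

lift_definition scaleC :: "complex \<Rightarrow> hardy \<Rightarrow> hardy" (infixr \<open>*\<^sub>C\<close> 75) is "\<lambda>c f z. c * f z"
  by (auto simp: hardy_rel_def intro: hardy_fun_cmult)

lift_definition cinner :: "hardy \<Rightarrow> hardy \<Rightarrow> complex" is "\<lambda>f g. \<integral>z. f z * cnj (g z) \<partial>circ"
  by (auto simp: hardy_rel_def dest!: hardy_funD(1) intro!: integral_cong_AE)

instantiation hardy :: real_vector
begin
lift_definition zero_hardy :: hardy is "\<lambda>z. 0"
  by (simp add: hardy_rel_def hardy_fun_zero)
lift_definition plus_hardy :: "hardy \<Rightarrow> hardy \<Rightarrow> hardy" is "\<lambda>f g z. f z + g z"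
  by (auto simp: hardy_rel_def intro: hardy_fun_add)
lift_definition minus_hardy :: "hardy \<Rightarrow> hardy \<Rightarrow> hardy" is "\<lambda>f g z. f z - g z"
  by (auto simp: hardy_rel_def intro: hardy_fun_diff)
lift_definition uminus_hardy :: "hardy \<Rightarrow> hardy" is "\<lambda>f z. - f z"
  by (auto simp: hardy_rel_def intro: hardy_fun_uminus)
definition scaleR_hardy :: "real \<Rightarrow> hardy \<Rightarrow> hardy" where
  "scaleR_hardy r x = complex_of_real r *\<^sub>C x"
instance
proof
  fix a b :: real and x y z :: hardy
  show "x + y + z = x + (y + z)"
    by transfer (auto simp: hardy_rel_def intro!: hardy_fun_add)
  show "x + y = y + x"
    by transfer (auto simp: hardy_rel_def intro!: hardy_fun_add)
  show "0 + x = x"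
    by transfer (auto simp: hardy_rel_def)
  show "- x + x = 0"
    by transfer (auto simp: hardy_rel_def intro!: hardy_fun_zero)
  show "x - y = x + - y"
    by transfer (auto simp: hardy_rel_def intro!: hardy_fun_diff)
  show "a *\<^sub>R (x + y) = a *\<^sub>R x + a *\<^sub>R y"
    unfolding scaleR_hardy_def
    by transfer (auto simp: hardy_rel_def distrib_left intro!: hardy_fun_add hardy_fun_cmult)
  show "(a + b) *\<^sub>R x = a *\<^sub>R x + b *\<^sub>R x"
    unfolding scaleR_hardy_def
    by transfer (auto simp: hardy_rel_def distrib_right intro!: hardy_fun_add hardy_fun_cmult)
  show "a *\<^sub>R b *\<^sub>R x = (a * b) *\<^sub>R x"
    unfolding scaleR_hardy_def
    by transfer (auto simp: hardy_rel_def mult.assoc intro!: hardy_fun_cmult)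
  show "1 *\<^sub>R x = x"
    unfolding scaleR_hardy_def by transfer (auto simp: hardy_rel_def)
qed
end

lemma vector_space_scaleC: "vector_space scaleC"
proof
  fix a b :: complex and x y :: hardy
  show "a *\<^sub>C (x + y) = a *\<^sub>C x + a *\<^sub>C y"
    by transfer (auto simp: hardy_rel_def distrib_left intro!: hardy_fun_add hardy_fun_cmult)
  show "(a + b) *\<^sub>C x = a *\<^sub>C x + b *\<^sub>C x"
    by transfer (auto simp: hardy_rel_def distrib_right intro!: hardy_fun_add hardy_fun_cmult)
  show "a *\<^sub>C b *\<^sub>C x = (a * b) *\<^sub>C x"
    by transfer (auto simp: hardy_rel_def mult.assoc intro!: hardy_fun_cmult)
  show "1 *\<^sub>C x = x"
    by transfer (auto simp: hardy_rel_def)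
qed

lemma cinner_commute: "cinner x y = cnj (cinner y x)"
proof transfer
  fix f g
  show "(\<integral>z. f z * cnj (g z) \<partial>circ) = cnj (\<integral>z. g z * cnj (f z) \<partial>circ)"
    by (subst Bochner_Integration.integral_cnj[symmetric]) (simp add: mult.commute)
qed

lemma cinner_add_left: "cinner (x + y) z = cinner x z + cinner y z"
  by transfer (simp add: hardy_rel_def distrib_right integrable_circ_prod_cnj)

lemma cinner_scaleC_left: "cinner (c *\<^sub>C x) y = c * cinner x y"
  by transfer (simp add: mult.assoc)

lemma cinner_self: "cinner x x = of_real (Re (cinner x x))" "0 \<le> Re (cinner x x)"
  "Re (cinner x x) = 0 \<longleftrightarrow> x = 0"
proof -
  have *: "(\<integral>z. f z * cnj (f z) \<partial>circ) = of_real (\<integral>z. (cmod (f z))\<^sup>2 \<partial>circ)" for f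
    by (simp only: complex_mult_cnj cmod_power2[symmetric] integral_complex_of_real)
  show "cinner x x = of_real (Re (cinner x x))" "0 \<le> Re (cinner x x)"
    by (transfer; simp add: *)+
  show "Re (cinner x x) = 0 \<longleftrightarrow> x = 0"
  proof (transfer, unfold * hardy_rel_def Re_complex_of_real)
    fix f assume f: "hardy_fun f \<and> hardy_fun f \<and> (AE z in circ. f z = f z)"
    have "(\<integral>z. (cmod (f z))\<^sup>2 \<partial>circ) = 0 \<longleftrightarrow> (AE z in circ. (cmod (f z))\<^sup>2 = 0)"
      using f hardy_funD(2)[of f] by (intro integral_nonneg_eq_0_iff_AE) auto
    then show "((\<integral>z. (cmod (f z))\<^sup>2 \<partial>circ) = 0) =
      (hardy_fun f \<and> hardy_fun (\<lambda>z. 0) \<and> (AE z in circ. f z = 0))"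
      using f hardy_fun_zero by simp
  qed
qed

instantiation hardy :: real_inner
begin
definition inner_hardy :: "hardy \<Rightarrow> hardy \<Rightarrow> real" where
  "inner_hardy x y = Re (cinner x y)"
definition norm_hardy :: "hardy \<Rightarrow> real" where
  "norm_hardy x = sqrt (inner x x)"
definition dist_hardy :: "hardy \<Rightarrow> hardy \<Rightarrow> real" where
  "dist_hardy x y = norm (x - y)"
definition sgn_hardy :: "hardy \<Rightarrow> hardy" where
  "sgn_hardy x = inverse (norm x) *\<^sub>R x"
definition uniformity_hardy :: "(hardy \<times> hardy) filter" where
  "uniformity_hardy = (INF e\<in>{0<..}. principal {(x, y). dist x y < e})"
definition open_hardy :: "hardy set \<Rightarrow> bool" where
  "open_hardy U \<longleftrightarrow> (\<forall>x\<in>U. \<forall>\<^sub>F (x', y) in uniformity. x' = x \<longrightarrow> y \<in> U)"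
instance
proof
  fix r :: real and x y z :: hardy and U :: "hardy set"
  show "inner x y = inner y x"
    unfolding inner_hardy_def by (subst cinner_commute) simp
  show "inner (x + y) z = inner x z + inner y z"
    by (simp add: inner_hardy_def cinner_add_left)
  show "inner (r *\<^sub>R x) y = r * inner x y"
    by (simp add: inner_hardy_def scaleR_hardy_def cinner_scaleC_left)
  show "0 \<le> inner x x" "inner x x = 0 \<longleftrightarrow> x = 0"
    by (simp_all add: inner_hardy_def cinner_self(2,3))
qed (fact norm_hardy_def dist_hardy_def sgn_hardy_def uniformity_hardy_def open_hardy_def)+
end

lift_definition fourier :: "hardy \<Rightarrow> nat \<Rightarrow> complex" is "\<lambda>f k. \<integral>z. f z * cnj (z ^ k) \<partial>circ"
  by (rule ext) (auto simp: hardy_rel_def dest!: hardy_funD(1) intro!: integral_cong_AE)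

lift_definition monomial :: "nat \<Rightarrow> hardy" is "\<lambda>k z. z ^ k"
  by (simp add: hardy_rel_def hardy_fun_monomial)

lift_definition shift :: "hardy \<Rightarrow> hardy" is "\<lambda>f z. z * f z"
  by (auto simp: hardy_rel_def intro: hardy_fun_shift)

lift_definition cconj :: "hardy \<Rightarrow> hardy" is "\<lambda>f z. cnj (f (cnj z))"
proof -
  fix f g assume h: "hardy_rel f g"
  have "AE z in distr circ borel cnj. f z = g z"
    using h unfolding circ_distr_cnj by (simp add: hardy_rel_def)
  then have "AE z in circ. f (cnj z) = g (cnj z)"
    by (rule AE_distrD[rotated]) simp
  then show "hardy_rel (\<lambda>z. cnj (f (cnj z))) (\<lambda>z. cnj (g (cnj z)))"
    using h by (auto simp: hardy_rel_def intro: hardy_fun_cconj)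
qed

section \<open>BMOA\<close>

text \<open>Closed arcs; \<open>b - a = 2 * pi\<close> is the whole circle.\<close>

definition arcs :: "complex set set" where
  "arcs = {cis ` {a..b} | a b. a < b \<and> b \<le> a + 2 * pi}"

definition mean_on :: "complex set \<Rightarrow> (complex \<Rightarrow> 'a::{banach, second_countable_topology}) \<Rightarrow> 'a" where
  "mean_on I f = (LINT z:I|circ. f z) /\<^sub>R measure circ I"

definition bmo_fun :: "(complex \<Rightarrow> complex) \<Rightarrow> bool" where
  "bmo_fun f \<longleftrightarrow> (\<exists>C. \<forall>I\<in>arcs. mean_on I (\<lambda>z. cmod (f z - mean_on I f)) \<le> C)"

lemma sets_arcs: "I \<in> arcs \<Longrightarrow> I \<in> sets borel"
  by (auto simp: arcs_def intro!: borel_compact compact_continuous_image continuous_intros)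

lemma mean_on_cong_AE:
  assumes "f \<in> borel_measurable borel" "g \<in> borel_measurable borel" "AE z in circ. f z = g z"
    and "I \<in> arcs"
  shows "mean_on I f = mean_on I g"
proof -
  note [measurable] = assms(1,2) sets_arcs[OF assms(4)]
  have "(LINT z:I|circ. f z) = (LINT z:I|circ. g z)"
    unfolding set_lebesgue_integral_def by (rule integral_cong_AE) (use assms(3) in auto)
  then show ?thesis by (simp add: mean_on_def)
qed

lift_definition bmo :: "hardy \<Rightarrow> bool" is bmo_fun
proof -
  fix f g assume "hardy_rel f g"
  then have [measurable]: "f \<in> borel_measurable borel" "g \<in> borel_measurable borel"
    and ae: "AE z in circ. f z = g z"
    by (auto simp: hardy_rel_def dest: hardy_funD(1))
  have "mean_on I (\<lambda>z. cmod (f z - mean_on I f)) = mean_on I (\<lambda>z. cmod (g z - mean_on I g))"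
    if "I \<in> arcs" for I
  proof -
    have "mean_on I f = mean_on I g"
      by (rule mean_on_cong_AE) (use ae that in auto)
    moreover have "AE z in circ. cmod (f z - c) = cmod (g z - c)" for c
      using ae by eventually_elim simp
    ultimately show ?thesis
      using that by (simp add: mean_on_cong_AE[of "\<lambda>z. cmod (f z - c)" "\<lambda>z. cmod (g z - c)" I for c])
  qed
  then show "bmo_fun f = bmo_fun g"
    by (simp add: bmo_fun_def cong: ball_cong)
qed

definition BMOA :: "hardy set" where
  "BMOA = {u. bmo u}"

section \<open>Operators and functional calculus\<close>

definition bounded_clinear :: "(hardy \<Rightarrow> hardy) \<Rightarrow> bool" where
  "bounded_clinear A \<longleftrightarrow> bounded_linear A \<and> (\<forall>c x. A (c *\<^sub>C x) = c *\<^sub>C A x)"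

definition selfadjoint :: "(hardy \<Rightarrow> hardy) \<Rightarrow> bool" where
  "selfadjoint A \<longleftrightarrow> (\<forall>x y. cinner (A x) y = cinner x (A y))"

definition positive_op :: "(hardy \<Rightarrow> hardy) \<Rightarrow> bool" where
  "positive_op A \<longleftrightarrow> bounded_clinear A \<and> selfadjoint A \<and> (\<forall>x. 0 \<le> Re (cinner (A x) x))"

text \<open>The modulus \<open>(T\<^sup>2)\<^sup>1\<^sup>/\<^sup>2\<close> of an anti-linear operator \<open>T\<close> whose square is positive.\<close>

definition abs_op :: "(hardy \<Rightarrow> hardy) \<Rightarrow> hardy \<Rightarrow> hardy" where
  "abs_op T = (THE B. positive_op B \<and> B \<circ> B = T \<circ> T)"

text \<open>\<open>A\<close> leaves the closed subspace \<open>M\<close> invariant in all uses below, so that the powers of the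
  restriction of \<open>A\<close> to \<open>M\<close> are the restrictions of the powers of \<open>A\<close>.\<close>

definition simple_spectrum_on :: "hardy set \<Rightarrow> (hardy \<Rightarrow> hardy) \<Rightarrow> bool" where
  "simple_spectrum_on M A \<longleftrightarrow>
     (\<exists>v\<in>M. closure (module.span scaleC (range (\<lambda>n. (A ^^ n) v))) = M)"

definition poly_op :: "complex poly \<Rightarrow> (hardy \<Rightarrow> hardy) \<Rightarrow> hardy \<Rightarrow> hardy" where
  "poly_op p A v = (\<Sum>i\<le>degree p. coeff p i *\<^sub>C (A ^^ i) v)"

text \<open>Functional calculus of a bounded self-adjoint \<open>A\<close>, whose spectrum is contained in
  \<open>[-\<parallel>A\<parallel>, \<parallel>A\<parallel>]\<close>: continuous functions are uniform limits of polynomials; \<open>spectral_measure A v\<close>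
  represents \<open>f \<mapsto> \<langle>f(A)v, v\<rangle>\<close> on continuous \<open>f\<close>; and a Borel function \<open>f\<close> is applied to those
  vectors \<open>v\<close> for which \<open>f\<close> is square integrable with respect to that measure, by extending
  \<open>p \<mapsto> p(A)v\<close> isometrically from polynomials.\<close>

definition cont_calc :: "(real \<Rightarrow> complex) \<Rightarrow> (hardy \<Rightarrow> hardy) \<Rightarrow> hardy \<Rightarrow> hardy" where
  "cont_calc f A v = (THE w. \<exists>p :: nat \<Rightarrow> complex poly.
     uniform_limit {- onorm A..onorm A} (\<lambda>n t. poly (p n) (of_real t)) f sequentially \<and>
     (\<lambda>n. poly_op (p n) A v) \<longlonglongrightarrow> w)"

definition spectral_measure :: "(hardy \<Rightarrow> hardy) \<Rightarrow> hardy \<Rightarrow> real measure" where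
  "spectral_measure A v = (THE \<mu>. sets \<mu> = sets borel \<and> finite_measure \<mu> \<and>
     (\<forall>f :: real \<Rightarrow> complex. continuous_on UNIV f \<longrightarrow>
        integrable \<mu> f \<and> (\<integral>t. f t \<partial>\<mu>) = cinner (cont_calc f A v) v))"

definition borel_calc :: "(real \<Rightarrow> complex) \<Rightarrow> (hardy \<Rightarrow> hardy) \<Rightarrow> hardy \<Rightarrow> hardy" where
  "borel_calc f A v = (THE w. \<exists>p :: nat \<Rightarrow> complex poly.
     (\<lambda>n. \<integral>\<^sup>+t. ennreal ((cmod (poly (p n) (of_real t) - f t))\<^sup>2) \<partial>spectral_measure A v)
       \<longlonglongrightarrow> 0 \<and>
     (\<lambda>n. poly_op (p n) A v) \<longlonglongrightarrow> w)"

definition L2_fun :: "real measure \<Rightarrow> (real \<Rightarrow> complex) \<Rightarrow> bool" where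
  "L2_fun \<mu> f \<longleftrightarrow> f \<in> borel_measurable borel \<and> integrable \<mu> (\<lambda>t. (cmod (f t))\<^sup>2)"

section \<open>Hankel operators\<close>

text \<open>There is at most one such bounded operator, and for \<open>u\<close> in BMOA there is one (Nehari,
  Fefferman); hence \<open>hankel u\<close> below is well defined.\<close>

definition is_hankel :: "hardy \<Rightarrow> (hardy \<Rightarrow> hardy) \<Rightarrow> bool" where
  "is_hankel u G \<longleftrightarrow> bounded_clinear G \<and>
     (\<forall>j k. cinner (G (monomial k)) (monomial j) = fourier u (j + k))"

definition hankel :: "hardy \<Rightarrow> hardy \<Rightarrow> hardy" where
  "hankel u = (THE G. is_hankel u G)"

text \<open>\<open>P(u \<cdot> cnj f)\<close>, realised through the linear Hankel operator because \<open>u \<cdot> cnj f\<close> need not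
  be square integrable.\<close>

definition anti_hankel :: "hardy \<Rightarrow> hardy \<Rightarrow> hardy" where
  "anti_hankel u = hankel u \<circ> cconj"

text \<open>\<^const>\<open>adjoint\<close> refers to the real inner product, the real part of \<^const>\<open>cinner\<close>; for the
  complex linear operator \<^const>\<open>shift\<close> it gives the usual adjoint.\<close>

definition anti_hankel_tilde :: "hardy \<Rightarrow> hardy \<Rightarrow> hardy" where
  "anti_hankel_tilde u = adjoint shift \<circ> anti_hankel u"

definition ran :: "hardy \<Rightarrow> hardy set" where
  "ran u = closure (range (anti_hankel u))"

definition BMOA_simp :: "hardy set" where
  "BMOA_simp = {u \<in> BMOA.
     simple_spectrum_on (ran u) (anti_hankel u \<circ> anti_hankel u) \<and>
     simple_spectrum_on (ran u) (anti_hankel_tilde u \<circ> anti_hankel_tilde u)}"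

text \<open>The vector \<open>u\<close> lies in \<^term>\<open>ran u\<close>, so applying functions of the restricted moduli to
  \<open>u\<close> is the same as applying functions of the moduli themselves.\<close>

abbreviation absH :: "hardy \<Rightarrow> hardy \<Rightarrow> hardy" where
  "absH u \<equiv> abs_op (anti_hankel u)"

abbreviation absHt :: "hardy \<Rightarrow> hardy \<Rightarrow> hardy" where
  "absHt u \<equiv> abs_op (anti_hankel_tilde u)"

definition rho :: "hardy \<Rightarrow> real measure" where
  "rho u = spectral_measure (absH u) u"

definition rho_tilde :: "hardy \<Rightarrow> real measure" where
  "rho_tilde u = spectral_measure (absHt u) u"

definition rho_tilde0 :: "hardy \<Rightarrow> real measure" where
  "rho_tilde0 u = restrict_space (rho_tilde u) {0<..}"

definition is_Psi :: "hardy \<Rightarrow> (real \<Rightarrow> complex) \<Rightarrow> bool" where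
  "is_Psi u \<Psi> \<longleftrightarrow> \<Psi> \<in> borel_measurable borel \<and> (AE s in rho u. cmod (\<Psi> s) = 1) \<and>
     (\<forall>f. L2_fun (rho u) f \<longrightarrow>
        anti_hankel u (borel_calc f (absH u) u) =
        absH u (borel_calc (\<lambda>s. cnj (\<Psi> s)) (absH u) (borel_calc (\<lambda>s. cnj (f s)) (absH u) u)))"

text \<open>Only the values on \<open>(0, \<infinity>)\<close> matter: the modulus on the left annihilates the
  component belonging to a possible atom at \<open>0\<close>.\<close>

definition is_Psi_tilde :: "hardy \<Rightarrow> (real \<Rightarrow> complex) \<Rightarrow> bool" where
  "is_Psi_tilde u \<Psi> \<longleftrightarrow> \<Psi> \<in> borel_measurable borel \<and> (AE s in rho_tilde0 u. cmod (\<Psi> s) = 1) \<and>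
     (\<forall>f. L2_fun (rho_tilde u) f \<longrightarrow>
        anti_hankel_tilde u (borel_calc f (absHt u) u) =
        absHt u (borel_calc \<Psi> (absHt u) (borel_calc (\<lambda>s. cnj (f s)) (absHt u) u)))"

end

theory Submission
  imports Defs "HOL-Probability.Helly_Selection" "HOL-Probability.Probability_Mass_Function"
begin

text \<open>For real Fourier coefficients both anti-linear operators preserve the real subspace of
  functions with \<open>f(z) = cnj (f (cnj z))\<close>, which contains \<open>u\<close>. Hence \<open>\<integral> t \<Phi>(t) r(t) d\<rho>\<close>, the inner product of
  \<open>H\<^sub>u r(\<bar>H\<^sub>u\<bar>)u\<close> and \<open>u\<close>, is real for all real polynomials \<open>r\<close>, and so is the symbol \<open>\<Phi>\<close>.
  Conversely, let \<open>R\<close> be the closed real span of the vectors \<open>H\<^sub>u\<^sup>2\<^sup>n u\<close>. Since the squares of the two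
  operators differ by the rank one operator \<open>\<langle>\<cdot>, u\<rangle>u\<close>, the tilde operator yields the same \<open>R\<close>, and real
  symbols make both operators map \<open>R\<close> to itself. As \<open>u\<close> is cyclic, \<open>H\<^sub>u R\<close> is dense in \<open>R\<close>, so the backward
  shift, which sends \<open>H\<^sub>u x\<close> to the tilde operator applied to \<open>x\<close>, maps \<open>R\<close> to itself; pairing its
  iterates on \<open>u\<close> with \<open>1\<close> gives real Fourier coefficients.\<close>

section \<open>Polynomials and square integrable functions\<close>

text \<open>The modulus, the spectral measure and the functional calculus are definite descriptions,
  so nothing can be said about a symbol before each is shown to be well defined. Positivity keeps
  this elementary: after scaling by the norm, the moments of a positive \<open>A\<close> at
  \<open>v\<close> form a Hausdorff moment sequence. This yields the spectral measure, which in turn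
  controls the norm of every polynomial in \<open>A\<close>; square roots and the Borel calculus
  follow by polynomial approximation. Simple spectrum supplies some cyclic vector for each of the
  two squares, possibly different ones and not necessarily \<open>u\<close>; that \<open>u\<close>
  itself is cyclic for the square of H_u has to be derived from both together. The symbol is tested
  on the vectors r(|T|)u with r a real polynomial. There the conjugation in the model formula
  disappears, and the anti-linear T acts as multiplication by t \<Phi>(t). Because of the factor t
  the formula says nothing about a symbol at 0, so a possible atom at 0 needs separate care in the
  two measures.\<close>

lemma square_integrable_diff:
  fixes f g :: "'a \<Rightarrow> real"
  assumes [measurable]: "f \<in> borel_measurable M" "g \<in> borel_measurable M"
    and i: "integrable M (\<lambda>x. (f x)\<^sup>2)" "integrable M (\<lambda>x. (g x)\<^sup>2)"
  shows "integrable M (\<lambda>x. (f x - g x)\<^sup>2)"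
    and "(\<integral>x. (f x - g x)\<^sup>2 \<partial>M) \<le> 2 * (\<integral>x. (f x)\<^sup>2 \<partial>M) + 2 * (\<integral>x. (g x)\<^sup>2 \<partial>M)"
proof -
  have le: "(a - b)\<^sup>2 \<le> 2 * a\<^sup>2 + 2 * b\<^sup>2" for a b :: real
    using zero_le_power2[of "a + b"] by (simp add: power2_diff power2_sum)
  have i': "integrable M (\<lambda>x. 2 * (f x)\<^sup>2 + 2 * (g x)\<^sup>2)"
    using i by simp
  show *: "integrable M (\<lambda>x. (f x - g x)\<^sup>2)"
    by (rule Bochner_Integration.integrable_bound[OF i']) (auto intro!: order_trans[OF le])
  show "(\<integral>x. (f x - g x)\<^sup>2 \<partial>M) \<le> 2 * (\<integral>x. (f x)\<^sup>2 \<partial>M) + 2 * (\<integral>x. (g x)\<^sup>2 \<partial>M)"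
    using integral_mono[OF * i' le] i by simp
qed

section \<open>Density of continuous functions and of polynomials in L2\<close>

lemma integrable_bounded_continuous:
  fixes g :: "'a::euclidean_space \<Rightarrow> real"
  assumes "finite_measure M" "sets M = sets borel" "continuous_on UNIV g" "\<And>x. \<bar>g x\<bar> \<le> B"
  shows "integrable M (\<lambda>x. (g x)\<^sup>2)"
proof -
  interpret finite_measure M by fact
  note [measurable_cong] = assms(2)
  have [measurable]: "g \<in> borel_measurable borel"
    by (rule borel_measurable_continuous_onI) fact
  have "(g x)\<^sup>2 \<le> B\<^sup>2" for x
    using power_mono[OF assms(4)[of x], of 2] by simp
  then show ?thesis
    by (intro integrable_const_bound[where B="B\<^sup>2"]) auto
qed

text \<open>By regularity there are a compact \<open>K\<close> inside \<open>A\<close> and an open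
  \<open>U\<close> around \<open>A\<close> with M(U - K) < e. A Urysohn function that is 1 on
  \<open>K\<close> and 0 off \<open>U\<close> differs from the indicator only on U - K, and there by
  at most 1.\<close>

lemma indicator_L2_approx:
  fixes M :: "'a::euclidean_space measure"
  assumes M: "finite_measure M" "sets M = sets borel" and A: "A \<in> sets borel" and e: "e > 0"
  shows "\<exists>g. continuous_on UNIV g \<and> (\<forall>x. \<bar>g x\<bar> \<le> (1::real)) \<and> (\<integral>x. (indicator A x - g x)\<^sup>2 \<partial>M) < e"
proof -
  interpret finite_measure M by fact
  note [measurable_cong] = assms(2)
  note [measurable] = A
  have sp: "space M = UNIV" using sets_eq_imp_space_eq[OF M(2)] by simp
  have "\<exists>K. compact K \<and> K \<subseteq> A \<and> measure M A < measure M K + e/2"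
  proof (rule ccontr)
    assume *: "\<not> ?thesis"
    have "emeasure M A = (SUP K\<in>{K. K \<subseteq> A \<and> compact K}. emeasure M K)"
      by (rule inner_regular[OF M(2)]) (auto simp: A)
    also have "\<dots> \<le> ennreal (measure M A - e/2)"
    proof (rule SUP_least)
      fix K assume K: "K \<in> {K. K \<subseteq> A \<and> compact K}"
      with * have "measure M K + e/2 \<le> measure M A" by auto
      then show "emeasure M K \<le> ennreal (measure M A - e/2)"
        by (auto simp: emeasure_eq_measure intro!: ennreal_leI)
    qed
    \<comment> \<open>\<open>ennreal\<close> truncates at 0, so the supremum bound alone leaves open
      the case of a null set \<open>A\<close>; there the empty compact set gives the
      contradiction.\<close>
    finally have "measure M A \<le> max 0 (measure M A - e/2)"
      using e by (simp add: emeasure_eq_measure ennreal_le_iff2 max_def)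
    then have "measure M A = 0" using e measure_nonneg[of M A] by linarith
    with *[simplified, rule_format, of "{}"] e show False by simp
  qed
  then obtain K where K: "compact K" "K \<subseteq> A" "measure M A < measure M K + e/2" by blast
  have "\<exists>U. open U \<and> A \<subseteq> U \<and> measure M U < measure M A + e/2"
  proof (rule ccontr)
    assume *: "\<not> ?thesis"
    have "ennreal (measure M A + e/2) \<le> (INF U\<in>{U. A \<subseteq> U \<and> open U}. emeasure M U)"
    proof (rule INF_greatest)
      fix U assume U: "U \<in> {U. A \<subseteq> U \<and> open U}"
      with * have "measure M A + e/2 \<le> measure M U" by auto
      then show "ennreal (measure M A + e/2) \<le> emeasure M U"
        by (auto simp: emeasure_eq_measure intro!: ennreal_leI)
    qed
    also have "\<dots> = emeasure M A"
      by (rule outer_regular[OF M(2), symmetric]) (auto simp: A)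
    finally show False
      using e by (simp add: emeasure_eq_measure)
  qed
  then obtain U where U: "open U" "A \<subseteq> U" "measure M U < measure M A + e/2" by blast
  obtain g where g: "continuous_on UNIV g" "\<And>x. g x \<in> closed_segment 0 (1::real)"
      "\<And>x. x \<in> - U \<Longrightarrow> g x = 0" "\<And>x. x \<in> K \<Longrightarrow> g x = 1"
    by (rule Urysohn[of "- U" K 0 1]) (use K U compact_imp_closed in auto)
  have g01: "0 \<le> g x" "g x \<le> 1" for x
    using g(2)[of x] by (auto simp: closed_segment_eq_real_ivl)
  have [measurable]: "g \<in> borel_measurable borel" "K \<in> sets borel" "U \<in> sets borel"
    using K(1) U(1) g(1) by (auto intro: borel_measurable_continuous_onI borel_compact)
  have le: "(indicator A x - g x)\<^sup>2 \<le> indicator (U - K) x" for x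
  proof -
    have "(indicator A x - g x)\<^sup>2 \<le> 1"
      using g01[of x] by (auto simp: abs_square_le_1 split: split_indicator)
    then show ?thesis
      using g(3,4)[of x] K(2) U(2) by (cases "x \<in> U"; cases "x \<in> K"; cases "x \<in> A") auto
  qed
  have "(\<integral>x. (indicator A x - g x)\<^sup>2 \<partial>M) \<le> (\<integral>x. indicator (U - K) x \<partial>M)"
    by (rule integral_mono', rule integrable_real_indicator) (use le in \<open>auto simp: emeasure_eq_measure\<close>)
  also have "\<dots> = measure M U - measure M K"
    using K(2) U(2) sp by (auto simp: measure_Diff)
  also have "\<dots> < e" using K U by simp
  finally show ?thesis
    using g(1) g01 by (intro exI[of _ g]) (auto simp: abs_le_iff intro: order_trans[of _ 0])
qed

text \<open>Square integrability stands in the conclusion so that the induction over nonnegative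
  Borel functions can rederive it in each case: summands and monotone approximants are dominated by
  the whole. Boundedness of \<open>g\<close> makes it square integrable for every finite
  measure.\<close>

lemma nonneg_L2_approx:
  fixes M :: "'a::euclidean_space measure" and f :: "'a \<Rightarrow> real"
  assumes M: "finite_measure M" "sets M = sets borel"
    and f: "f \<in> borel_measurable M" "\<And>x. 0 \<le> f x"
  shows "integrable M (\<lambda>x. (f x)\<^sup>2) \<longrightarrow> (\<forall>e>0. \<exists>g. continuous_on UNIV g \<and> (\<exists>B. \<forall>x. \<bar>g x\<bar> \<le> B) \<and> (\<integral>x. (f x - g x)\<^sup>2 \<partial>M) < e)"
  using f
proof (induction rule: borel_measurable_induct_real)
  case (set A)
  then show ?case using indicator_L2_approx[OF M] M(2) by blast
next
  case (mult u c)
  show ?case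
  proof (intro impI allI)
    fix e :: real assume i: "integrable M (\<lambda>x. (c * u x)\<^sup>2)" and e: "e > 0"
    show "\<exists>g. continuous_on UNIV g \<and> (\<exists>B. \<forall>x. \<bar>g x\<bar> \<le> B) \<and> (\<integral>x. (c * u x - g x)\<^sup>2 \<partial>M) < e"
    proof (cases "c = 0")
      case True
      then show ?thesis using e by (intro exI[of _ "\<lambda>_. 0"]) auto
    next
      case False
      then have "integrable M (\<lambda>x. (u x)\<^sup>2)" using i by (simp add: power_mult_distrib)
      moreover have "e / c\<^sup>2 > 0" using e False by simp
      ultimately obtain g B where g: "continuous_on UNIV g" "\<And>x. \<bar>g x\<bar> \<le> B" "(\<integral>x. (u x - g x)\<^sup>2 \<partial>M) < e / c\<^sup>2"
        using mult.IH by blast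
      have "(\<integral>x. (c * u x - c * g x)\<^sup>2 \<partial>M) = c\<^sup>2 * (\<integral>x. (u x - g x)\<^sup>2 \<partial>M)"
        by (simp add: right_diff_distrib[symmetric] power_mult_distrib)
      also have "\<dots> < e" using g(3) False by (simp add: field_simps)
      finally have "(\<integral>x. (c * u x - c * g x)\<^sup>2 \<partial>M) < e" .
      moreover have "\<bar>c * g x\<bar> \<le> \<bar>c\<bar> * B" for x
        using g(2)[of x] by (simp add: abs_mult mult_left_mono)
      ultimately show ?thesis using g(1)
        by (intro exI[of _ "\<lambda>x. c * g x"]) (auto intro!: continuous_intros)
    qed
  qed
next
  case (add u v)
  note [measurable] = add.hyps(1,3)
  show ?case
  proof (intro impI allI)
    fix e :: real assume i: "integrable M (\<lambda>x. (v x + u x)\<^sup>2)" and e: "e > 0"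
    have iu: "integrable M (\<lambda>x. (u x)\<^sup>2)" "integrable M (\<lambda>x. (v x)\<^sup>2)"
      by (rule Bochner_Integration.integrable_bound[OF i]; use add.hyps(2,4) in \<open>auto intro!: power_mono\<close>)+
    \<comment> \<open>Squared norms obey only |a - b|^2 <= 2 |a|^2 + 2 |b|^2, so each of the two
      errors gets a quarter of \<open>e\<close>.\<close>
    have "e / 4 > 0" using e by simp
    from add.IH(1)[rule_format, OF iu(1) this]
    obtain g B where g: "continuous_on UNIV g" "\<And>x. \<bar>g x\<bar> \<le> B" "(\<integral>x. (u x - g x)\<^sup>2 \<partial>M) < e / 4"
      by blast
    from add.IH(2)[rule_format, OF iu(2) \<open>e / 4 > 0\<close>]
    obtain h C where h: "continuous_on UNIV h" "\<And>x. \<bar>h x\<bar> \<le> C" "(\<integral>x. (v x - h x)\<^sup>2 \<partial>M) < e / 4"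
      by blast
    have [measurable]: "g \<in> borel_measurable M" "h \<in> borel_measurable M"
      using g(1) h(1) by (simp_all add: borel_measurable_continuous_onI measurable_cong_sets[OF M(2) refl])
    have ig: "integrable M (\<lambda>x. (u x - g x)\<^sup>2)" "integrable M (\<lambda>x. (h x - v x)\<^sup>2)"
      by (intro square_integrable_diff integrable_bounded_continuous[OF M g(1,2)]
          integrable_bounded_continuous[OF M h(1,2)] iu; measurable)+
    have "(\<integral>x. (u x - g x - (h x - v x))\<^sup>2 \<partial>M) \<le> 2 * (\<integral>x. (u x - g x)\<^sup>2 \<partial>M) + 2 * (\<integral>x. (h x - v x)\<^sup>2 \<partial>M)"
      by (intro square_integrable_diff ig; measurable)
    also have "\<dots> < e" using g(3) h(3) by (simp add: power2_commute)
    finally have "(\<integral>x. (v x + u x - (g x + h x))\<^sup>2 \<partial>M) < e" by (simp add: algebra_simps)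
    moreover have "\<bar>g x + h x\<bar> \<le> B + C" for x
      using g(2)[of x] h(2)[of x] by linarith
    ultimately show "\<exists>g. continuous_on UNIV g \<and> (\<exists>B. \<forall>x. \<bar>g x\<bar> \<le> B) \<and> (\<integral>x. (v x + u x - g x)\<^sup>2 \<partial>M) < e"
      using g(1) h(1) by (intro exI[of _ "\<lambda>x. g x + h x"]) (auto intro!: continuous_intros)
  qed
next
  case (seq U)
  have sp: "space M = UNIV" using sets_eq_imp_space_eq[OF M(2)] by simp
  note [measurable] = seq.hyps(1) f(1)
  have [measurable]: "f \<in> borel_measurable M"
    by (rule borel_measurable_LIMSEQ_real[OF seq.hyps(4) seq.hyps(1)])
  show ?case
  proof (intro impI allI)
    fix e :: real assume i: "integrable M (\<lambda>x. (f x)\<^sup>2)" and e: "e > 0"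
    have le: "U n x \<le> f x" for n x
      using seq.hyps(3,4) sp by (intro incseq_le) (auto simp: incseq_def le_fun_def)
    have iU: "integrable M (\<lambda>x. (U n x)\<^sup>2)" for n
      by (rule Bochner_Integration.integrable_bound[OF i]) (use le seq.hyps(2) in \<open>auto intro!: power_mono\<close>)
    \<comment> \<open>Since 0 <= U n <= f, the square of \<open>f\<close> dominates.\<close>
    have "(\<lambda>n. \<integral>x. (f x - U n x)\<^sup>2 \<partial>M) \<longlonglongrightarrow> (\<integral>x. 0 \<partial>M)"
    proof (rule integral_dominated_convergence[OF _ _ i])
      show "AE x in M. (\<lambda>n. (f x - U n x)\<^sup>2) \<longlonglongrightarrow> 0"
      proof (rule AE_I2)
        fix x assume "x \<in> space M"
        then have "(\<lambda>n. (f x - U n x)\<^sup>2) \<longlonglongrightarrow> (f x - f x)\<^sup>2"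
          by (intro tendsto_intros seq.hyps(4))
        then show "(\<lambda>n. (f x - U n x)\<^sup>2) \<longlonglongrightarrow> 0" by simp
      qed
      show "AE x in M. norm ((f x - U n x)\<^sup>2) \<le> (f x)\<^sup>2" for n
        using le seq.hyps(2) by (auto intro!: AE_I2 power_mono)
    qed measurable
    then have "\<forall>\<^sub>F n in sequentially. (\<integral>x. (f x - U n x)\<^sup>2 \<partial>M) < e / 4"
      using e by (intro order_tendstoD) auto
    then obtain n where n: "(\<integral>x. (f x - U n x)\<^sup>2 \<partial>M) < e / 4"
      by (auto simp: eventually_sequentially)
    have "e / 4 > 0" using e by simp
    from seq.IH[rule_format, OF iU this]
    obtain g B where g: "continuous_on UNIV g" "\<And>x. \<bar>g x\<bar> \<le> B" "(\<integral>x. (U n x - g x)\<^sup>2 \<partial>M) < e / 4"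
      by blast
    have [measurable]: "g \<in> borel_measurable M"
      using g(1) by (simp add: borel_measurable_continuous_onI measurable_cong_sets[OF M(2) refl])
    have ig: "integrable M (\<lambda>x. (f x - U n x)\<^sup>2)" "integrable M (\<lambda>x. (g x - U n x)\<^sup>2)"
      by (intro square_integrable_diff integrable_bounded_continuous[OF M g(1,2)] i iU; measurable)+
    have "(\<integral>x. (f x - U n x - (g x - U n x))\<^sup>2 \<partial>M) \<le> 2 * (\<integral>x. (f x - U n x)\<^sup>2 \<partial>M) + 2 * (\<integral>x. (g x - U n x)\<^sup>2 \<partial>M)"
      by (intro square_integrable_diff ig; measurable)
    also have "\<dots> < e" using g(3) n by (simp add: power2_commute)
    finally show "\<exists>g. continuous_on UNIV g \<and> (\<exists>B. \<forall>x. \<bar>g x\<bar> \<le> B) \<and> (\<integral>x. (f x - g x)\<^sup>2 \<partial>M) < e"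
      using g by auto
  qed
qed

lemma continuous_integrable_compact:
  fixes M :: "'a::euclidean_space measure" and g :: "'a \<Rightarrow> 'b::{banach, second_countable_topology}"
  assumes M: "finite_measure M" "sets M = sets borel" and K: "compact K" "AE x in M. x \<in> K"
    and g: "continuous_on UNIV g"
  shows "integrable M g"
proof -
  interpret finite_measure M by fact
  note [measurable_cong] = M(2)
  have [measurable]: "g \<in> borel_measurable borel" using g by (rule borel_measurable_continuous_onI)
  have "compact (g ` K)"
    by (rule compact_continuous_image[OF continuous_on_subset[OF g]]) (use K in auto)
  then obtain B where B: "\<And>x. x \<in> K \<Longrightarrow> norm (g x) \<le> B"
    by (force dest!: compact_imp_bounded simp: bounded_iff)
  show ?thesis
    by (rule integrable_const_bound[where B=B]) (use eventually_mono[OF K(2) B] in auto)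
qed

lemma continuous_square_integrable_compact:
  fixes M :: "'a::euclidean_space measure" and p :: "'a \<Rightarrow> real"
  assumes M: "finite_measure M" "sets M = sets borel" and K: "compact K" "AE x in M. x \<in> K"
    and p: "continuous_on UNIV p"
  shows "integrable M (\<lambda>x. (p x)\<^sup>2)"
  by (rule continuous_integrable_compact[OF M K]) (intro continuous_intros p)

text \<open>A bounded continuous approximation is replaced by a polynomial that is uniformly close
  on \<open>K\<close>; as \<open>M\<close> lives on \<open>K\<close>, uniform closeness there
  suffices although the polynomial is unbounded elsewhere.\<close>

lemma real_polynomial_L2_approx_nonneg:
  fixes M :: "'a::euclidean_space measure" and f :: "'a \<Rightarrow> real"
  assumes M: "finite_measure M" "sets M = sets borel" and K: "compact K" "AE x in M. x \<in> K"
    and f: "f \<in> borel_measurable borel" "\<And>x. 0 \<le> f x" "integrable M (\<lambda>x. (f x)\<^sup>2)" and e: "e > 0"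
  shows "\<exists>p. real_polynomial_function p \<and> (\<integral>x. (f x - p x)\<^sup>2 \<partial>M) < e"
proof -
  interpret finite_measure M by fact
  note [measurable_cong] = M(2)
  note [measurable] = f(1)
  obtain g B where g: "continuous_on UNIV g" "\<And>x. \<bar>g x\<bar> \<le> B" "(\<integral>x. (f x - g x)\<^sup>2 \<partial>M) < e / 4"
    using nonneg_L2_approx[OF M _ f(2), rule_format, OF _ f(3), of "e / 4"] e by auto
  define m where "m = measure M (space M)"
  \<comment> \<open>Chosen so that the integral of d^2 is e m / (8 (m + 1)) < e / 4; the summand 1
    covers the null measure.\<close>
  define d where "d = sqrt (e / (8 * (m + 1)))"
  have m: "m \<ge> 0" by (simp add: m_def)
  have d: "d > 0" using e m by (simp add: d_def)
  obtain p where p: "real_polynomial_function p" "\<And>x. x \<in> K \<Longrightarrow> \<bar>g x - p x\<bar> < d"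
    using Stone_Weierstrass_real_polynomial_function[OF K(1) continuous_on_subset[OF g(1)] d] by auto
  have cp: "continuous_on UNIV p"
    using continuous_real_polymonial_function[OF p(1)] by (simp add: continuous_at_imp_continuous_on)
  have [measurable]: "g \<in> borel_measurable borel" "p \<in> borel_measurable borel"
    using g(1) cp by (auto intro: borel_measurable_continuous_onI)
  have ig: "integrable M (\<lambda>x. (f x - g x)\<^sup>2)"
    by (intro square_integrable_diff integrable_bounded_continuous[OF M g(1,2)] f(3)) measurable
  have ip: "integrable M (\<lambda>x. (p x - g x)\<^sup>2)"
    by (intro continuous_square_integrable_compact[OF M K]) (intro continuous_intros cp g(1))
  have "AE x in M. (p x - g x)\<^sup>2 \<le> d\<^sup>2"
    using K(2)
  proof eventually_elim
    case (elim x)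
    then have "\<bar>g x - p x\<bar> \<le> d" using p(2) by force
    then show ?case using power_mono[of "\<bar>g x - p x\<bar>" d 2] by (simp add: power2_commute)
  qed
  then have "(\<integral>x. (p x - g x)\<^sup>2 \<partial>M) \<le> (\<integral>x. d\<^sup>2 \<partial>M)"
    by (intro integral_mono_AE ip) auto
  also have "\<dots> = e * m / (8 * (m + 1))"
    using m e by (simp add: d_def m_def[symmetric])
  also have "\<dots> < e / 4"
  proof -
    have "0 < e * 8 + e * (m * 4)" using m e by (intro add_pos_nonneg) auto
    then show ?thesis using m e by (simp add: field_simps)
  qed
  finally have le: "(\<integral>x. (p x - g x)\<^sup>2 \<partial>M) < e / 4" .
  have "(\<integral>x. (f x - g x - (p x - g x))\<^sup>2 \<partial>M) \<le> 2 * (\<integral>x. (f x - g x)\<^sup>2 \<partial>M) + 2 * (\<integral>x. (p x - g x)\<^sup>2 \<partial>M)"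
    by (intro square_integrable_diff ig ip; measurable)
  also have "\<dots> < e" using g(3) le by simp
  finally show ?thesis using p(1) by auto
qed

text \<open>Positive and negative part are approximated separately. The Euclidean setting lets the
  result serve both for measures on the line and for arc length on the circle.\<close>

lemma real_polynomial_L2_dense:
  fixes M :: "'a::euclidean_space measure" and f :: "'a \<Rightarrow> real"
  assumes M: "finite_measure M" "sets M = sets borel" and K: "compact K" "AE x in M. x \<in> K"
    and f: "f \<in> borel_measurable borel" "integrable M (\<lambda>x. (f x)\<^sup>2)" and e: "e > 0"
  shows "\<exists>p. real_polynomial_function p \<and> (\<integral>x. (f x - p x)\<^sup>2 \<partial>M) < e"
proof -
  note [measurable_cong] = M(2)
  note [measurable] = f(1)
  have i: "integrable M (\<lambda>x. (max 0 (f x))\<^sup>2)" "integrable M (\<lambda>x. (max 0 (- f x))\<^sup>2)"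
    by (rule Bochner_Integration.integrable_bound[OF f(2)]; auto simp: max_def)+
  have e4: "e / 4 > 0" using e by simp
  obtain p where p: "real_polynomial_function p" "(\<integral>x. (max 0 (f x) - p x)\<^sup>2 \<partial>M) < e / 4"
    using real_polynomial_L2_approx_nonneg[OF M K _ _ i(1) e4] by auto
  obtain q where q: "real_polynomial_function q" "(\<integral>x. (max 0 (- f x) - q x)\<^sup>2 \<partial>M) < e / 4"
    using real_polynomial_L2_approx_nonneg[OF M K _ _ i(2) e4] by auto
  have c: "continuous_on UNIV p" "continuous_on UNIV q"
    using p(1) q(1) by (auto intro: continuous_at_imp_continuous_on continuous_real_polymonial_function)
  then have [measurable]: "p \<in> borel_measurable borel" "q \<in> borel_measurable borel"
    by (auto intro: borel_measurable_continuous_onI)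
  have ip: "integrable M (\<lambda>x. (max 0 (f x) - p x)\<^sup>2)" "integrable M (\<lambda>x. (max 0 (- f x) - q x)\<^sup>2)"
    by (intro square_integrable_diff i continuous_square_integrable_compact[OF M K] c; measurable)+
  have "f x - (p x - q x) = max 0 (f x) - p x - (max 0 (- f x) - q x)" for x
    by (auto simp: max_def)
  then have "(\<integral>x. (f x - (p x - q x))\<^sup>2 \<partial>M) = (\<integral>x. (max 0 (f x) - p x - (max 0 (- f x) - q x))\<^sup>2 \<partial>M)"
    by (simp only:)
  also have "\<dots> \<le> 2 * (\<integral>x. (max 0 (f x) - p x)\<^sup>2 \<partial>M) + 2 * (\<integral>x. (max 0 (- f x) - q x)\<^sup>2 \<partial>M)"
    by (intro square_integrable_diff ip; measurable)
  also have "\<dots> < e" using p(2) q(2) by simp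
  finally show ?thesis using p(1) q(1) by (intro exI[of _ "\<lambda>x. p x - q x"]) auto
qed

section \<open>Moments of measures on the line\<close>

text \<open>Continuous ramps increase to the indicator of an open half-line, and the masses of
  half-lines determine a finite measure. This is the uniqueness half of
  \<open>spectral_measure\<close>.\<close>

lemma measure_eqI_continuous:
  fixes M N :: "real measure"
  assumes M: "finite_measure M" "sets M = sets borel" and N: "finite_measure N" "sets N = sets borel"
    and eq: "\<And>f :: real \<Rightarrow> real. continuous_on UNIV f \<Longrightarrow> (\<And>x. \<bar>f x\<bar> \<le> 1) \<Longrightarrow> (\<integral>x. f x \<partial>M) = (\<integral>x. f x \<partial>N)"
  shows "M = N"
proof (rule measure_eqI_lessThan)
  interpret M: finite_measure M by fact
  interpret N: finite_measure N by fact
  fix a :: real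
  show "emeasure M {a<..} < \<infinity>" by (simp add: M.emeasure_eq_measure)
  define f where "f n t = min 1 (max 0 (real n * (t - a)))" for n :: nat and t
  have cf: "continuous_on UNIV (f n)" for n
    unfolding f_def by (intro continuous_intros)
  have f01: "0 \<le> f n t" "f n t \<le> 1" for n t by (auto simp: f_def)
  have conv: "(\<lambda>n. f n t) \<longlonglongrightarrow> indicator {a<..} t" for t
  proof (cases "a < t")
    case True
    obtain m where m: "1 < real m * (t - a)"
      using True reals_Archimedean3[of "t - a"] by auto
    have "f n t = 1" if "m \<le> n" for n
    proof -
      have "real m * (t - a) \<le> real n * (t - a)"
        using that True by (intro mult_right_mono) auto
      then show ?thesis using m by (auto simp: f_def)
    qed
    then have "\<forall>\<^sub>F n in sequentially. f n t = 1"
      by (auto simp: eventually_sequentially)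
    then show ?thesis using True by (auto intro: tendsto_eventually)
  next
    case False
    then have "f n t = 0" for n
      by (auto simp: f_def mult_le_0_iff)
    then show ?thesis using False by simp
  qed
  have lim: "(\<lambda>n. \<integral>t. f n t \<partial>K) \<longlonglongrightarrow> measure K {a<..}"
    if K: "finite_measure K" "sets K = sets borel" for K
  proof -
    interpret K: finite_measure K by fact
    note [measurable_cong] = K(2)
    have [measurable]: "f n \<in> borel_measurable borel" for n
      using cf by (rule borel_measurable_continuous_onI)
    have "(\<lambda>n. \<integral>t. f n t \<partial>K) \<longlonglongrightarrow> (\<integral>t. indicator {a<..} t \<partial>K)"
      by (rule integral_dominated_convergence[where w="\<lambda>_. 1"])
        (use conv f01 in \<open>auto simp: abs_le_iff intro: order_trans[of _ 0]\<close>)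
    then show ?thesis using K sets_eq_imp_space_eq[OF K(2)] by simp
  qed
  have "(\<integral>t. f n t \<partial>M) = (\<integral>t. f n t \<partial>N)" for n
    by (rule eq[OF cf]) (use f01 in \<open>auto simp: abs_le_iff intro: order_trans[of _ 0]\<close>)
  with lim[OF M] lim[OF N] have "measure M {a<..} = measure N {a<..}"
    by (simp add: LIMSEQ_unique)
  then show "emeasure M {a<..} = emeasure N {a<..}"
    by (simp add: M.emeasure_eq_measure N.emeasure_eq_measure)
qed (use M N in auto)

text \<open>The ratio is the product of (j - i) / (n - i) over i < k, and every factor is within K /
  (n - K) of j / n. The bound \<open>K\<close> is kept apart from \<open>k\<close> so that the error
  per factor stays fixed during the induction.\<close>

lemma binomial_ratio_power_diff:
  fixes n K j k :: nat
  assumes "j \<le> n" "K < n" "k \<le> K"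
  shows "\<bar>real (j choose k) / real (n choose k) - (j / n) ^ k\<bar> \<le> real k * (K / (real n - K))"
  using assms(3)
proof (induction k)
  case (Suc k)
  define r where "r = real (j choose k) / real (n choose k)"
  have kn: "k < n" using Suc assms by simp
  have absorb: "Suc k * (l choose Suc k) = (l - k) * (l choose k)" for l
    by (metis binomial_absorb_comp binomial_absorption)
  \<comment> \<open>For l < k the real difference is negative where the natural one is 0, but then
    both binomial coefficients vanish.\<close>
  have absorb': "real (Suc k) * real (l choose Suc k) = (real l - real k) * real (l choose k)" for l
  proof (cases "k \<le> l")
    case True
    then show ?thesis using absorb[of l] by (metis of_nat_diff of_nat_mult)
  next
    case False
    then show ?thesis by (simp add: binomial_eq_0)
  qed
  have rec: "real (j choose Suc k) / real (n choose Suc k) = r * ((real j - k) / (real n - k))"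
  proof -
    have "real (j choose Suc k) / real (n choose Suc k) =
        (real (Suc k) * real (j choose Suc k)) / (real (Suc k) * real (n choose Suc k))"
      by (rule mult_divide_mult_cancel_left[symmetric]) simp
    also have "\<dots> = r * ((real j - k) / (real n - k))"
      unfolding absorb' r_def by (simp add: mult.commute)
    finally show ?thesis .
  qed
  have r01: "0 \<le> r" "r \<le> 1"
    using binomial_right_mono[OF assms(1), of k] kn by (auto simp: r_def divide_le_eq_1)
  have "\<bar>(real j - k) / (real n - k) - j / n\<bar> = k * (real n - j) / (n * (real n - k))"
  proof -
    have "(real j - k) / (real n - k) - j / n = - (k * (real n - j) / (n * (real n - k)))"
      using kn by (simp add: divide_simps) (simp add: algebra_simps)
    then show ?thesis using assms kn by simp
  qed
  also have "\<dots> \<le> real k * real n / (n * (real n - k))"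
    using kn assms by (intro divide_right_mono mult_left_mono) auto
  also have "\<dots> = k / (real n - k)" using kn by simp
  also have "\<dots> \<le> K / (real n - K)"
    using Suc.prems assms by (intro frac_le) auto
  finally have step: "\<bar>(real j - k) / (real n - k) - j / n\<bar> \<le> K / (real n - K)" .
  have t: "0 \<le> real j / n" "real j / n \<le> 1" using assms by (auto simp: divide_le_eq_1)
  have "\<bar>r * ((real j - k) / (real n - k)) - (j / n) ^ Suc k\<bar>
      = \<bar>r * ((real j - k) / (real n - k) - j / n) + (j / n) * (r - (j / n) ^ k)\<bar>"
    by (simp add: algebra_simps)
  also have "\<dots> \<le> r * \<bar>(real j - k) / (real n - k) - j / n\<bar> + (j / n) * \<bar>r - (j / n) ^ k\<bar>"
    using r01 t by (metis abs_mult abs_of_nonneg abs_triangle_ineq)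
  also have "\<dots> \<le> 1 * (K / (real n - K)) + 1 * (real k * (K / (real n - K)))"
    using r01 t step Suc by (intro add_mono mult_mono) (auto simp: r_def)
  finally show ?case unfolding rec by (simp add: algebra_simps add_divide_distrib)
qed simp

text \<open>The array \<open>w j l\<close> stands for the integrals of \<open>t\<^sup>j (1 - t)\<^sup>l\<close>; the approximating
  measures are the Bernstein measures with mass \<open>(n choose j) w j (n - j)\<close> at \<open>j / n\<close>.\<close>

lemma hausdorff_moment_prob:
  fixes w :: "nat \<Rightarrow> nat \<Rightarrow> real"
  assumes rec: "\<And>j l. w j l = w (Suc j) l + w j (Suc l)" and pos: "\<And>j l. 0 \<le> w j l"
    and one: "w 0 0 = 1"
  shows "\<exists>M. sets M = sets borel \<and> finite_measure M \<and> (AE t in M. t \<in> {0..1}) \<and>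
     (\<forall>k. (\<integral>t. t ^ k \<partial>M) = w k 0)"
proof -
  \<comment> \<open>The array version of expanding (t + (1 - t))^N = 1 by the binomial
    theorem.\<close>
  have expand: "w j l = (\<Sum>i\<le>N. real (N choose i) * w (j + i) (l + (N - i)))" for N j l
  proof (induction N arbitrary: j l)
    case (Suc N)
    have "w j l = w (Suc j) l + w j (Suc l)" by (rule rec)
    also have "\<dots> = (\<Sum>i\<le>N. real (N choose i) * w (j + Suc i) (l + (N - i))) +
        (\<Sum>i\<le>N. real (N choose i) * w (j + i) (l + (Suc N - i)))"
      by (subst Suc.IH[of "Suc j"], subst Suc.IH[of j "Suc l"]) (simp add: Suc_diff_le)
    also have "(\<Sum>i\<le>N. real (N choose i) * w (j + i) (l + (Suc N - i))) =
        (\<Sum>i\<le>Suc N. real (N choose i) * w (j + i) (l + (Suc N - i)))"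
      by simp
    also have "\<dots> = w j (l + Suc N) + (\<Sum>i\<le>N. real (N choose Suc i) * w (j + Suc i) (l + (N - i)))"
      by (subst sum.atMost_Suc_shift) simp
    also have "(\<Sum>i\<le>N. real (N choose i) * w (j + Suc i) (l + (N - i))) + \<dots> =
        w j (l + Suc N) + (\<Sum>i\<le>N. real (Suc N choose Suc i) * w (j + Suc i) (l + (N - i)))"
      by (simp add: sum.distrib[symmetric] algebra_simps)
    also have "\<dots> = (\<Sum>i\<le>Suc N. real (Suc N choose i) * w (j + i) (l + (Suc N - i)))"
      by (subst sum.atMost_Suc_shift) simp
    finally show ?case .
  qed simp
  define wt where "wt n j = (if j \<le> n then real (n choose j) * w j (n - j) else 0)" for n j
  have wt0: "0 \<le> wt n j" for n j using pos by (simp add: wt_def)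
  have wt1: "(\<Sum>j\<le>n. wt n j) = 1" for n
    using expand[of 0 0 n] one by (simp add: wt_def)
  \<comment> \<open>The Bernstein measures reproduce the moments exactly if t^k is replaced by the
    binomial ratio at t = j / n: expand to total degree n and use (n choose j) (j choose k) = (n
    choose k) (n - k choose j - k).\<close>
  have moment: "w k 0 = (\<Sum>j\<le>n. real (j choose k) / real (n choose k) * wt n j)" if "k \<le> n" for k n
  proof -
    have "w k 0 = (\<Sum>i\<le>n-k. real (n - k choose i) * w (k + i) (n - (k + i)))"
      using expand[of k 0 "n - k"] by simp
    also have "\<dots> = (\<Sum>j=k..n. real (n - k choose (j - k)) * w j (n - j))"
      by (rule sum.reindex_bij_witness[of _ "\<lambda>j. j - k" "\<lambda>i. k + i"]) (use that in auto)
    also have "\<dots> = (\<Sum>j=k..n. real (j choose k) / real (n choose k) * wt n j)"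
    proof (rule sum.cong[OF refl])
      fix j assume j: "j \<in> {k..n}"
      then have "real (n choose j) * real (j choose k) = real (n choose k) * real (n - k choose (j - k))"
        using choose_mult[of k j n] by (metis atLeastAtMost_iff of_nat_mult)
      then show "real (n - k choose (j - k)) * w j (n - j) = real (j choose k) / real (n choose k) * wt n j"
        using j that by (simp add: wt_def field_simps)
    qed
    also have "\<dots> = (\<Sum>j\<le>n. real (j choose k) / real (n choose k) * wt n j)"
      by (rule sum.mono_neutral_left) auto
    finally show ?thesis .
  qed
  define P where "P n = embed_pmf (wt n)" for n
  have P: "pmf (P n) j = wt n j" for n j
    unfolding P_def
  proof (rule pmf_embed_pmf[OF wt0])
    have "(\<integral>\<^sup>+x. ennreal (wt n x) \<partial>count_space UNIV) = (\<Sum>x\<le>n. ennreal (wt n x))"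
      by (rule nn_integral_count_space') (auto simp: wt_def)
    then show "(\<integral>\<^sup>+x. ennreal (wt n x) \<partial>count_space UNIV) = 1"
      using wt0 by (simp add: sum_ennreal wt1)
  qed
  have Pint: "(\<integral>j. g j \<partial>P n) = (\<Sum>j\<le>n. g j * wt n j)" for g :: "nat \<Rightarrow> real" and n
    by (subst integral_measure_pmf_real[of "{..n}"]) (auto simp: P set_pmf_iff wt_def split: if_splits)
  have Pset: "set_pmf (P n) \<subseteq> {..n}" for n
    by (auto simp: P set_pmf_iff wt_def split: if_splits)
  define \<mu> where "\<mu> n = distr (P n) borel (\<lambda>j. real j / real n)" for n
  have \<mu>int: "(\<integral>t. g t \<partial>\<mu> n) = (\<Sum>j\<le>n. g (real j / real n) * wt n j)"
    if "g \<in> borel_measurable borel" for g :: "real \<Rightarrow> real" and n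
    unfolding \<mu>_def using that by (subst integral_distr) (auto simp: Pint)
  have rd: "real_distribution (\<mu> n)" for n
  proof -
    interpret prob_space "\<mu> n"
      unfolding \<mu>_def by (rule prob_space.prob_space_distr) (auto intro: measure_pmf.prob_space_axioms)
    show ?thesis by unfold_locales (auto simp: \<mu>_def)
  qed
  \<comment> \<open>All masses sit in [0, 1], also for n = 0, where j / 0 is 0. The interval starts
    at -1 because it is open on the left and 0 may carry mass.\<close>
  have "tight \<mu>"
    unfolding tight_def
  proof (intro conjI allI impI rd)
    fix e :: real assume e: "e > 0"
    have "measure (\<mu> n) {-1<..1} = 1" for n
    proof -
      interpret real_distribution "\<mu> n" by (rule rd)
      have "AE t in \<mu> n. t \<in> {-1<..1}"
        unfolding \<mu>_def using Pset[of n]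
        by (subst AE_distr_iff)
          (auto simp: AE_measure_pmf_iff divide_le_eq_1 less_le_trans[of "-1" 0 "_ / _"])
      then show ?thesis by (intro prob_eq_1[THEN iffD2]) auto
    qed
    then show "\<exists>a b. a < b \<and> (\<forall>n. 1 - e < measure (\<mu> n) {a<..b})"
      using e by (intro exI[of _ "-1"] exI[of _ 1]) auto
  qed
  from tight_imp_convergent_subsubsequence[OF this strict_mono_id]
  obtain r M where r: "strict_mono r" and M: "real_distribution M" and conv: "weak_conv_m (\<lambda>n. \<mu> (r n)) M"
    by (auto simp: comp_def)
  interpret M: real_distribution M by fact
  have lim: "(\<lambda>n. \<integral>t. f t \<partial>\<mu> (r n)) \<longlonglongrightarrow> (\<integral>t. f t \<partial>M)"
    if "continuous_on UNIV f" "\<And>t. \<bar>f t\<bar> \<le> 1" for f :: "real \<Rightarrow> real"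
    using weak_conv_imp_integral_bdd_continuous_conv[OF rd M conv, of f 1] that
    by (simp add: continuous_on_eq_continuous_at)
  \<comment> \<open>Weak convergence is available for bounded test functions; clamping to [0, 1]
    makes the powers bounded without changing them where the approximating measures live.\<close>
  define c where "c t = max 0 (min 1 t)" for t :: real
  have cc: "continuous_on UNIV c" unfolding c_def by (intro continuous_intros)
  then have [measurable]: "c \<in> borel_measurable borel" by (rule borel_measurable_continuous_onI)
  have c01: "0 \<le> c t" "c t \<le> 1" for t by (auto simp: c_def)
  have cj: "c (real j / real n) = real j / real n" if "j \<le> n" for j n
    using that divide_le_eq_1[of "real j" "real n"] by (auto simp: c_def)
  \<comment> \<open>The bounded continuous function min 1 |t - c t| vanishes exactly on [0, 1], and
    its integral 0 survives the weak limit.\<close>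
  have supp: "AE t in M. t \<in> {0..1}"
  proof -
    have "(\<integral>t. min 1 \<bar>t - c t\<bar> \<partial>\<mu> n) = 0" for n
      by (subst \<mu>int) (auto simp: cj)
    then have "(\<integral>t. min 1 \<bar>t - c t\<bar> \<partial>M) = 0"
      using lim[of "\<lambda>t. min 1 \<bar>t - c t\<bar>"] cc by (simp add: continuous_intros LIMSEQ_const_iff)
    moreover have "integrable M (\<lambda>t. min 1 \<bar>t - c t\<bar>)"
      by (rule M.integrable_const_bound[where B=1]) auto
    ultimately have "AE t in M. min 1 \<bar>t - c t\<bar> = 0"
      by (subst (asm) integral_nonneg_eq_0_iff_AE) auto
    then show ?thesis
      by eventually_elim (use c01 in \<open>auto simp: c_def min_def split: if_splits\<close>)
  qed
  have mom: "(\<integral>t. t ^ k \<partial>M) = w k 0" for k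
  proof -
    have eq: "(\<integral>t. c t ^ k \<partial>\<mu> n) = (\<Sum>j\<le>n. (real j / real n) ^ k * wt n j)" for n
      by (subst \<mu>int) (auto simp: cj)
    have bd: "\<bar>(\<integral>t. c t ^ k \<partial>\<mu> n) - w k 0\<bar> \<le> real k * (k / (real n - k))" if "k < n" for n
    proof -
      have "\<bar>(\<integral>t. c t ^ k \<partial>\<mu> n) - w k 0\<bar> =
          \<bar>\<Sum>j\<le>n. ((real j / real n) ^ k - real (j choose k) / real (n choose k)) * wt n j\<bar>"
        using that by (simp add: eq moment[of k n] sum_subtractf[symmetric] left_diff_distrib)
      also have "\<dots> \<le> (\<Sum>j\<le>n. \<bar>(real j / real n) ^ k - real (j choose k) / real (n choose k)\<bar> * wt n j)"
        using wt0 by (intro order_trans[OF sum_abs]) (simp add: abs_mult)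
      also have "\<dots> \<le> (\<Sum>j\<le>n. (real k * (k / (real n - k))) * wt n j)"
        using binomial_ratio_power_diff[of _ n k k] that wt0
        by (intro sum_mono mult_right_mono) (auto simp: abs_minus_commute)
      also have "\<dots> = real k * (k / (real n - k))"
        unfolding sum_distrib_left[symmetric] wt1 by simp
      finally show ?thesis .
    qed
    have "(\<lambda>n. real k * (k / (real n - k))) \<longlonglongrightarrow> real k * 0"
      by (intro tendsto_mult tendsto_const real_tendsto_divide_at_top[OF tendsto_const])
        (rule filterlim_tendsto_add_at_top[OF tendsto_const filterlim_real_sequentially, of "- real k", simplified])
    then have z: "(\<lambda>n. real k * (k / (real n - k))) \<longlonglongrightarrow> 0" by simp
    have "(\<lambda>n. (\<integral>t. c t ^ k \<partial>\<mu> n) - w k 0) \<longlonglongrightarrow> 0"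
      by (rule Lim_null_comparison[OF _ z], rule eventually_sequentiallyI[of "Suc k"]) (simp only: real_norm_def bd Suc_le_eq)
    then have "(\<lambda>n. (\<integral>t. c t ^ k \<partial>\<mu> n)) \<longlonglongrightarrow> w k 0" by (simp add: LIM_zero_iff)
    then have "(\<lambda>n. (\<integral>t. c t ^ k \<partial>\<mu> (r n))) \<longlonglongrightarrow> w k 0"
      using LIMSEQ_subseq_LIMSEQ[OF _ r, of "\<lambda>n. \<integral>t. c t ^ k \<partial>\<mu> n"] by (simp add: comp_def)
    moreover have "(\<lambda>n. (\<integral>t. c t ^ k \<partial>\<mu> (r n))) \<longlonglongrightarrow> (\<integral>t. c t ^ k \<partial>M)"
      using c01 by (intro lim continuous_intros cc) (auto simp: power_le_one)
    ultimately have "(\<integral>t. c t ^ k \<partial>M) = w k 0" by (rule LIMSEQ_unique[symmetric])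
    moreover have "(\<integral>t. c t ^ k \<partial>M) = (\<integral>t. t ^ k \<partial>M)"
    proof (rule integral_cong_AE)
      show "AE t in M. c t ^ k = t ^ k"
        using supp by eventually_elim (simp add: c_def)
    qed auto
    ultimately show ?thesis by simp
  qed
  show ?thesis
    using supp mom by (intro exI[of _ M]) (auto intro: M.finite_measure_axioms)
qed

text \<open>Normalises the total mass. If \<open>w 0 0\<close> is 0, recurrence and positivity force
  all moments to vanish, and the null measure represents them.\<close>

lemma hausdorff_moment:
  fixes w :: "nat \<Rightarrow> nat \<Rightarrow> real"
  assumes rec: "\<And>j l. w j l = w (Suc j) l + w j (Suc l)" and pos: "\<And>j l. 0 \<le> w j l"
  shows "\<exists>M. sets M = sets borel \<and> finite_measure M \<and> (AE t in M. t \<in> {0..1}) \<and>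
     (\<forall>k. (\<integral>t. t ^ k \<partial>M) = w k 0)"
proof (cases "w 0 0 = 0")
  case True
  have "w k 0 = 0" for k
  proof (induction k)
    case (Suc k)
    then show ?case using rec[of k 0] pos[of "Suc k" 0] pos[of k "Suc 0"] by simp
  qed (fact True)
  then show ?thesis
    by (intro exI[of _ "density lborel (\<lambda>_. ennreal 0)"])
      (auto intro!: finite_measureI simp: AE_density emeasure_density integral_density simp del: ennreal_0; simp)
next
  case False
  define c where "c = w 0 0"
  have c: "c > 0" using False pos[of 0 0] by (simp add: c_def)
  have "w j l / c = w (Suc j) l / c + w j (Suc l) / c" for j l
    by (subst rec) (simp add: add_divide_distrib)
  then obtain M where M: "sets M = sets borel" "finite_measure M" "AE t in M. t \<in> {0..1}"
     "\<And>k. (\<integral>t. t ^ k \<partial>M) = w k 0 / c"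
    using hausdorff_moment_prob[of "\<lambda>j l. w j l / c"] pos c by (metis c_def divide_nonneg_pos divide_self less_irrefl)
  interpret finite_measure M by fact
  note [measurable_cong] = M(1)
  show ?thesis
  proof (intro exI[of _ "density M (\<lambda>_. ennreal c)"] conjI allI)
    show "finite_measure (density M (\<lambda>_. ennreal c))"
      by (rule finite_measureI) (auto simp: emeasure_density nn_integral_cmult ennreal_mult_eq_top_iff)
    show "AE t in density M (\<lambda>_. ennreal c). t \<in> {0..1}"
      using M(3) by (subst AE_density) auto
    show "(\<integral>t. t ^ k \<partial>density M (\<lambda>_. ennreal c)) = w k 0" for k
      using c by (subst integral_density) (auto simp: M(4))
  qed (simp add: M)
qed

section \<open>The Hardy space as a Hilbert space\<close>

interpretation hardy: vector_space scaleC
  by (rule vector_space_scaleC)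

lemma cinner_add_right: "cinner x (y + z) = cinner x y + cinner x z"
  by (subst (1 2 3) cinner_commute) (simp add: cinner_add_left)

lemma cinner_scaleC_right: "cinner x (c *\<^sub>C y) = cnj c * cinner x y"
  by (subst (1 2) cinner_commute) (simp add: cinner_scaleC_left)

lemma norm_scaleC: "norm (c *\<^sub>C (x::hardy)) = cmod c * norm x"
proof -
  have "cinner (c *\<^sub>C x) (c *\<^sub>C x) = of_real ((cmod c)\<^sup>2) * cinner x x"
    unfolding complex_norm_square by (simp add: cinner_scaleC_left cinner_scaleC_right mult_ac)
  then show ?thesis
    by (simp add: norm_hardy_def inner_hardy_def real_sqrt_mult)
qed

lemma cinner_self_norm: "cinner x x = of_real ((norm x)\<^sup>2)"
  using cinner_self(1)[of x] cinner_self(2)[of x] by (simp add: norm_hardy_def inner_hardy_def)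

text \<open>A unimodular factor turns the complex inner product into its absolute value, which
  reduces the claim to the real Cauchy-Schwarz inequality.\<close>

lemma norm_cinner_le: "cmod (cinner x y) \<le> norm x * norm y"
proof (cases "cinner x y = 0")
  case False
  define c where "c = cnj (cinner x y) / cmod (cinner x y)"
  have c: "cmod c = 1" using False by (simp add: c_def norm_divide)
  have "cinner (c *\<^sub>C x) y = of_real (cmod (cinner x y))"
    using False by (simp add: cinner_scaleC_left c_def mult.commute complex_norm_square[symmetric] power2_eq_square)
  then have "cmod (cinner x y) = inner (c *\<^sub>C x) y"
    by (simp add: inner_hardy_def)
  also have "\<dots> \<le> norm (c *\<^sub>C x) * norm y" by (rule norm_cauchy_schwarz)
  finally show ?thesis using c by (simp add: norm_scaleC)
qed simp

lemma bounded_bilinear_cinner: "bounded_bilinear cinner"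
proof
  fix x y z :: hardy and r :: real
  show "cinner (x + y) z = cinner x z + cinner y z" by (rule cinner_add_left)
  show "cinner x (y + z) = cinner x y + cinner x z" by (rule cinner_add_right)
  show "cinner (r *\<^sub>R x) y = r *\<^sub>R cinner x y" "cinner x (r *\<^sub>R y) = r *\<^sub>R cinner x y"
    by (simp_all add: scaleR_hardy_def cinner_scaleC_left cinner_scaleC_right scaleR_conv_of_real)
  show "\<exists>K. \<forall>a b. cmod (cinner a b) \<le> norm a * norm b * K"
    using norm_cinner_le by (intro exI[of _ 1]) auto
qed

lemma bounded_bilinear_scaleC: "bounded_bilinear scaleC"
proof
  fix x y :: hardy and r :: real and a b :: complex
  show "(a + b) *\<^sub>C x = a *\<^sub>C x + b *\<^sub>C x" by (rule hardy.scale_left_distrib)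
  show "a *\<^sub>C (x + y) = a *\<^sub>C x + a *\<^sub>C y" by (rule hardy.scale_right_distrib)
  show "(r *\<^sub>R a) *\<^sub>C x = r *\<^sub>R (a *\<^sub>C x)" "a *\<^sub>C (r *\<^sub>R x) = r *\<^sub>R (a *\<^sub>C x)"
    by (simp_all add: scaleR_hardy_def scaleR_conv_of_real mult.commute)
  show "\<exists>K. \<forall>(a::complex) b. norm (a *\<^sub>C b) \<le> norm a * norm b * K"
    by (intro exI[of _ 1]) (simp add: norm_scaleC)
qed

interpretation cinner: bounded_bilinear cinner
  by (rule bounded_bilinear_cinner)

interpretation scaleC: bounded_bilinear scaleC
  by (rule bounded_bilinear_scaleC)

lemma cinner_eq_0_all:
  assumes "\<And>y. cinner x y = 0"
  shows "x = 0"
  using assms[of x] cinner_self(3)[of x] by simp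

lemma hardy_cases: obtains f where "hardy_fun f" "x = abs_hardy f"
proof -
  have "hardy_rel (rep_hardy x) (rep_hardy x)" "abs_hardy (rep_hardy x) = x"
    by (rule Quotient_rep_reflp[OF Quotient_hardy] Quotient_abs_rep[OF Quotient_hardy])+
  then show thesis using that[of "rep_hardy x"] by (simp add: hardy_rel_def)
qed

lemma hardy_rel_refl: "hardy_fun f \<Longrightarrow> hardy_rel f f"
  by (simp add: hardy_rel_def)

section \<open>Completeness of the Hardy space\<close>

lemma norm_abs_hardy_diff:
  assumes "hardy_fun f" "hardy_fun g"
  shows "(norm (abs_hardy f - abs_hardy g))\<^sup>2 = (\<integral>z. (cmod (f z - g z))\<^sup>2 \<partial>circ)"
proof -
  have "cinner (abs_hardy f - abs_hardy g) (abs_hardy f - abs_hardy g) = (\<integral>z. of_real ((cmod (f z - g z))\<^sup>2) \<partial>circ)"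
    unfolding complex_norm_square
    using assms by (simp add: minus_hardy.abs_eq cinner.abs_eq hardy_rel_refl hardy_fun_diff)
  then have "cinner (abs_hardy f - abs_hardy g) (abs_hardy f - abs_hardy g) = of_real (\<integral>z. (cmod (f z - g z))\<^sup>2 \<partial>circ)"
    by (simp only: integral_complex_of_real)
  then show ?thesis by (simp add: norm_hardy_def inner_hardy_def)
qed

text \<open>A weighted inequality used in place of Cauchy-Schwarz: on a probability space, c = 2^k
  turns a squared L2 distance of (1/4)^k into an L1 distance of 2 (1/2)^k, which is
  summable.\<close>

lemma square_le_add_squares: "(x::real) \<le> c * x\<^sup>2 + 1 / c" if "c > 0"
proof -
  have "0 \<le> (c * x - 1)\<^sup>2 + c * (c * x\<^sup>2) + 1" using that by simp
  then have "c * (2 * x) \<le> c * (2 * (c * x\<^sup>2 + 1 / c))"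
    using that by (simp add: power2_eq_square algebra_simps)
  then show ?thesis using that by simp
qed

lemma quarter_power: "(1/4::real) ^ k = ((1/2) ^ k)\<^sup>2"
proof -
  have "(1/4::real) = (1/2)\<^sup>2" by (simp add: power2_eq_square)
  then show ?thesis by (simp only: power_mult[symmetric] mult.commute)
qed

lemma half_power_bound: "2 ^ k * (1/4::real) ^ k + 1 / 2 ^ k = 2 * (1/2) ^ k"
  unfolding quarter_power by (simp add: power2_eq_square power_one_over)

lemma integrable_norm_square_diff:
  fixes f g :: "'a \<Rightarrow> complex"
  assumes [measurable]: "f \<in> borel_measurable M" "g \<in> borel_measurable M"
    and i: "integrable M (\<lambda>z. (cmod (f z))\<^sup>2)" "integrable M (\<lambda>z. (cmod (g z))\<^sup>2)"
  shows "integrable M (\<lambda>z. (cmod (f z - g z))\<^sup>2)"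
proof (rule Bochner_Integration.integrable_bound)
  show "integrable M (\<lambda>z. 2 * (cmod (f z))\<^sup>2 + 2 * (cmod (g z))\<^sup>2)"
    using i by simp
  show "AE z in M. norm ((cmod (f z - g z))\<^sup>2) \<le> norm (2 * (cmod (f z))\<^sup>2 + 2 * (cmod (g z))\<^sup>2)"
  proof (rule AE_I2)
    fix z
    have "(cmod (f z - g z))\<^sup>2 \<le> (cmod (f z) + cmod (g z))\<^sup>2"
      by (intro power_mono norm_triangle_ineq4) simp
    also have "\<dots> \<le> 2 * (cmod (f z))\<^sup>2 + 2 * (cmod (g z))\<^sup>2"
      using zero_le_power2[of "cmod (f z) - cmod (g z)"] by (simp add: power2_diff power2_sum)
    finally show "norm ((cmod (f z - g z))\<^sup>2) \<le> norm (2 * (cmod (f z))\<^sup>2 + 2 * (cmod (g z))\<^sup>2)"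
      by simp
  qed
qed measurable

text \<open>The Riesz-Fischer argument on representatives: summable L1 differences give convergence
  almost everywhere, Fatou transfers the rate to the limit, and the rate makes the Fourier
  coefficients of negative index vanish in the limit.\<close>

lemma hardy_fast_Cauchy_convergent:
  assumes g: "\<And>k. hardy_fun (g k)"
    and d: "\<And>k j. k \<le> j \<Longrightarrow> (\<integral>z. (cmod (g j z - g k z))\<^sup>2 \<partial>circ) \<le> (1/4) ^ k"
  shows "\<exists>f. hardy_fun f \<and> (\<forall>k. (\<integral>z. (cmod (f z - g k z))\<^sup>2 \<partial>circ) \<le> (1/4) ^ k)"
proof -
  interpret finite_measure circ by (rule finite_measure_circ)
  have c1: "measure circ UNIV = 1" by (simp add: measure_def emeasure_circ_UNIV)
  have [measurable]: "g k \<in> borel_measurable borel" for k using hardy_funD(1)[OF g] .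
  have iD: "integrable circ (\<lambda>z. (cmod (g j z - g k z))\<^sup>2)" for j k
    using hardy_funD(2)[OF hardy_fun_diff[OF g g]] .
  have sum_fin: "(\<integral>\<^sup>+z. (\<Sum>k. ennreal (cmod (g (Suc k) z - g k z))) \<partial>circ) \<le> ennreal 4"
  proof -
    have "(\<integral>\<^sup>+z. ennreal (cmod (g (Suc k) z - g k z)) \<partial>circ) \<le> ennreal (2 * (1/2) ^ k)" for k
    proof -
      have "(\<integral>\<^sup>+z. ennreal (cmod (g (Suc k) z - g k z)) \<partial>circ)
          \<le> (\<integral>\<^sup>+z. ennreal (2 ^ k * (cmod (g (Suc k) z - g k z))\<^sup>2 + 1 / 2 ^ k) \<partial>circ)"
        by (intro nn_integral_mono ennreal_leI square_le_add_squares) simp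
      also have "\<dots> = ennreal (\<integral>z. 2 ^ k * (cmod (g (Suc k) z - g k z))\<^sup>2 + 1 / 2 ^ k \<partial>circ)"
        using iD by (intro nn_integral_eq_integral) auto
      also have "(\<integral>z. 2 ^ k * (cmod (g (Suc k) z - g k z))\<^sup>2 + 1 / 2 ^ k \<partial>circ)
          = 2 ^ k * (\<integral>z. (cmod (g (Suc k) z - g k z))\<^sup>2 \<partial>circ) + 1 / 2 ^ k"
        using iD by (simp add: c1)
      also have "\<dots> \<le> 2 ^ k * (1/4) ^ k + 1 / 2 ^ k"
        using d[of k "Suc k"] by simp
      also have "\<dots> = 2 * (1/2) ^ k"
        by (rule half_power_bound)
      finally show ?thesis by (simp add: ennreal_leI)
    qed
    then have "(\<integral>\<^sup>+z. (\<Sum>k. ennreal (cmod (g (Suc k) z - g k z))) \<partial>circ) \<le> (\<Sum>k. ennreal (2 * (1/2) ^ k))"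
      by (subst nn_integral_suminf) (auto intro!: suminf_le)
    also have "\<dots> = ennreal (\<Sum>k. 2 * (1/2) ^ k)"
      by (intro suminf_ennreal2 summable_mult summable_geometric) auto
    also have "(\<Sum>k. 2 * (1/2::real) ^ k) = 4"
      by (subst suminf_mult) (auto simp: suminf_geometric)
    finally show ?thesis .
  qed
  have "AE z in circ. (\<Sum>k. ennreal (cmod (g (Suc k) z - g k z))) \<noteq> \<infinity>"
    by (rule nn_integral_PInf_AE) (use sum_fin in \<open>auto simp: top_unique\<close>)
  then have conv: "AE z in circ. convergent (\<lambda>k. g k z)"
  proof eventually_elim
    case (elim z)
    then have "summable (\<lambda>k. cmod (g (Suc k) z - g k z))"
      by (intro summable_suminf_not_top) auto
    then have "summable (\<lambda>k. g (Suc k) z - g k z)" by (rule summable_norm_cancel)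
    then have "convergent (\<lambda>n. \<Sum>k<n. g (Suc k) z - g k z)"
      by (simp add: summable_iff_convergent)
    then have "convergent (\<lambda>n. (\<Sum>k<n. g (Suc k) z - g k z) + g 0 z)"
      by (intro convergent_add convergent_const)
    then show ?case by (simp add: sum_lessThan_telescope[of "\<lambda>k. g k z"])
  qed
  \<comment> \<open>Off the set of convergence \<open>lim\<close> has an unspecified value; this
    affects only a null set, and \<open>f\<close> is still measurable.\<close>
  define f where "f z = lim (\<lambda>k. g k z)" for z
  have f[measurable]: "f \<in> borel_measurable borel" unfolding f_def by measurable
  have fatou: "(\<integral>\<^sup>+z. ennreal ((cmod (f z - g k z))\<^sup>2) \<partial>circ) \<le> ennreal ((1/4) ^ k)" for k
  proof -
    have "AE z in circ. liminf (\<lambda>j. ennreal ((cmod (g j z - g k z))\<^sup>2)) = ennreal ((cmod (f z - g k z))\<^sup>2)"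
      using conv
    proof eventually_elim
      case (elim z)
      then have "(\<lambda>j. g j z) \<longlonglongrightarrow> f z" unfolding f_def by (simp add: convergent_LIMSEQ_iff)
      then have "(\<lambda>j. ennreal ((cmod (g j z - g k z))\<^sup>2)) \<longlonglongrightarrow> ennreal ((cmod (f z - g k z))\<^sup>2)"
        by (intro tendsto_intros)
      then show ?case by (intro lim_imp_Liminf) auto
    qed
    then have "(\<integral>\<^sup>+z. ennreal ((cmod (f z - g k z))\<^sup>2) \<partial>circ) = (\<integral>\<^sup>+z. liminf (\<lambda>j. ennreal ((cmod (g j z - g k z))\<^sup>2)) \<partial>circ)"
      by (intro nn_integral_cong_AE) (auto elim: eventually_mono)
    also have "\<dots> \<le> liminf (\<lambda>j. \<integral>\<^sup>+z. ennreal ((cmod (g j z - g k z))\<^sup>2) \<partial>circ)"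
      by (rule nn_integral_liminf) measurable
    also have "\<dots> \<le> ennreal ((1/4) ^ k)"
    proof (rule Liminf_le[OF sequentially_bot], rule eventually_sequentiallyI)
      fix j assume "k \<le> j"
      have "(\<integral>\<^sup>+z. ennreal ((cmod (g j z - g k z))\<^sup>2) \<partial>circ) = ennreal (\<integral>z. (cmod (g j z - g k z))\<^sup>2 \<partial>circ)"
        using iD by (intro nn_integral_eq_integral) auto
      then show "(\<integral>\<^sup>+z. ennreal ((cmod (g j z - g k z))\<^sup>2) \<partial>circ) \<le> ennreal ((1/4) ^ k)"
        using d[OF \<open>k \<le> j\<close>] by (simp add: ennreal_leI)
    qed
    finally show ?thesis .
  qed
  have ifg: "integrable circ (\<lambda>z. (cmod (f z - g k z))\<^sup>2)" for k
    using fatou[of k] by (intro integrableI_bounded) (auto simp: le_less_trans)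
  have dfg: "(\<integral>z. (cmod (f z - g k z))\<^sup>2 \<partial>circ) \<le> (1/4) ^ k" for k
    using fatou[of k] nn_integral_eq_integral[OF ifg[of k]] by simp
  have iF: "integrable circ (\<lambda>z. (cmod (f z))\<^sup>2)"
    using integrable_norm_square_diff[OF _ _ ifg[of 0], of "\<lambda>z. - g 0 z"] hardy_funD(2)[OF g] by simp
  have "(\<integral>z. f z * z ^ n \<partial>circ) = 0" if n: "n \<ge> 1" for n
  proof -
    have i1: "integrable circ (\<lambda>z. f z * z ^ n)"
      by (rule integrable_circ_prod) (use iF integrable_circ_norm_power in auto)
    have bd: "cmod (\<integral>z. f z * z ^ n \<partial>circ) \<le> 2 * (1/2) ^ k" for k
    proof -
      have "cmod (\<integral>z. f z * z ^ n \<partial>circ) = cmod (\<integral>z. (f z - g k z) * z ^ n \<partial>circ)"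
        using i1 hardy_funD(3,4)[OF g] n by (simp add: left_diff_distrib)
      also have "\<dots> \<le> (\<integral>z. cmod ((f z - g k z) * z ^ n) \<partial>circ)"
        by (rule integral_norm_bound)
      also have "\<dots> \<le> (\<integral>z. 2 ^ k * (cmod (f z - g k z))\<^sup>2 + 1 / 2 ^ k \<partial>circ)"
      proof (rule integral_mono_AE)
        show "integrable circ (\<lambda>z. cmod ((f z - g k z) * z ^ n))"
          using i1 hardy_funD(4)[OF g] by (intro integrable_norm) (simp add: left_diff_distrib)
        show "integrable circ (\<lambda>z. 2 ^ k * (cmod (f z - g k z))\<^sup>2 + 1 / 2 ^ k)"
          using ifg by simp
        show "AE z in circ. cmod ((f z - g k z) * z ^ n) \<le> 2 ^ k * (cmod (f z - g k z))\<^sup>2 + 1 / 2 ^ k"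
          using AE_circ_norm by eventually_elim (simp add: norm_mult norm_power square_le_add_squares)
      qed
      also have "\<dots> = 2 ^ k * (\<integral>z. (cmod (f z - g k z))\<^sup>2 \<partial>circ) + 1 / 2 ^ k"
        using ifg by (simp add: c1)
      also have "\<dots> \<le> 2 ^ k * (1/4) ^ k + 1 / 2 ^ k"
        using dfg[of k] by simp
      also have "\<dots> = 2 * (1/2) ^ k"
        by (rule half_power_bound)
      finally show ?thesis .
    qed
    have "(\<lambda>k. 2 * (1/2::real) ^ k) \<longlonglongrightarrow> 2 * 0"
      by (intro tendsto_intros LIMSEQ_power_zero) auto
    then have "cmod (\<integral>z. f z * z ^ n \<partial>circ) \<le> 2 * 0"
      by (rule LIMSEQ_le_const) (use bd in auto)
    then show ?thesis by simp
  qed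
  then have "hardy_fun f" using iF f by (simp add: hardy_fun_def)
  then show ?thesis using dfg by blast
qed

instance hardy :: complete_space
proof
  fix X :: "nat \<Rightarrow> hardy" assume X: "Cauchy X"
  have "\<exists>N. \<forall>m\<ge>N. \<forall>n\<ge>N. norm (X m - X n) < (1/2) ^ k" for k
    using X by (simp add: Cauchy_def dist_norm)
  then obtain N where N: "\<And>k m n. N k \<le> m \<Longrightarrow> N k \<le> n \<Longrightarrow> norm (X m - X n) < (1/2) ^ k"
    by metis
  \<comment> \<open>The sum dominates every \<open>N i\<close> with i <= k, and the summand
    \<open>k\<close> makes the index strictly increasing.\<close>
  define s where "s k = (\<Sum>i\<le>k. N i) + k" for k
  have s: "strict_mono s" by (auto simp: strict_mono_Suc_iff s_def)
  have sN: "N k \<le> s j" if "k \<le> j" for k j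
    using member_le_sum[of k "{..j}" N] that by (auto simp: s_def)
  have "\<exists>f. hardy_fun f \<and> X n = abs_hardy f" for n by (metis hardy_cases)
  then obtain f where f: "\<And>n. hardy_fun (f n)" "\<And>n. X n = abs_hardy (f n)" by metis
  have "(\<integral>z. (cmod (f (s j) z - f (s k) z))\<^sup>2 \<partial>circ) \<le> (1/4) ^ k" if "k \<le> j" for k j
  proof -
    have "(norm (X (s j) - X (s k)))\<^sup>2 \<le> ((1/2) ^ k)\<^sup>2"
      using N[OF sN[OF that] sN[OF order_refl]] by (intro power_mono) auto
    also have "\<dots> = (1/4 :: real) ^ k" by (rule quarter_power[symmetric])
    finally show ?thesis by (simp add: f norm_abs_hardy_diff)
  qed
  from hardy_fast_Cauchy_convergent[OF f(1) this]
  obtain g where g: "hardy_fun g" "\<And>k. (\<integral>z. (cmod (g z - f (s k) z))\<^sup>2 \<partial>circ) \<le> (1/4) ^ k"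
    by blast
  have "norm (X (s k) - abs_hardy g) \<le> (1/2) ^ k" for k
  proof (rule power2_le_imp_le)
    have "(norm (X (s k) - abs_hardy g))\<^sup>2 \<le> (1/4) ^ k"
      using g by (simp add: f norm_abs_hardy_diff norm_minus_commute[of "f (s k) _"])
    also have "\<dots> = ((1/2 :: real) ^ k)\<^sup>2" by (rule quarter_power)
    finally show "(norm (X (s k) - abs_hardy g))\<^sup>2 \<le> ((1/2) ^ k)\<^sup>2" .
  qed simp
  then have "\<forall>\<^sub>F k in sequentially. norm (X (s k) - abs_hardy g) \<le> (1/2) ^ k" by simp
  moreover have "(\<lambda>k. (1/2::real) ^ k) \<longlonglongrightarrow> 0" by (intro LIMSEQ_power_zero) simp
  ultimately have "(\<lambda>k. X (s k) - abs_hardy g) \<longlonglongrightarrow> 0" by (rule Lim_null_comparison)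
  then have "(X \<circ> s) \<longlonglongrightarrow> abs_hardy g" by (simp add: LIM_zero_iff comp_def)
  then show "convergent X"
    using Cauchy_converges_subseq[OF X s] by (auto simp: convergent_def)
qed

text \<open>A minimising sequence for the distance is Cauchy by the parallelogram law, and
  minimality in every direction of \<open>S\<close> gives orthogonality. Real subspaces are allowed,
  because the agreement set of two anti-linear maps is in general no better.\<close>

lemma orthogonal_projection_exists:
  fixes S :: "'a::{real_inner, complete_space} set"
  assumes S: "subspace S" "closed S"
  shows "\<exists>y\<in>S. \<forall>z\<in>S. inner (x - y) z = 0"
proof -
  have ne: "S \<noteq> {}" using subspace_0[OF S(1)] by auto
  define d where "d = infdist x S"
  have d0: "d \<ge> 0" by (simp add: d_def infdist_nonneg)
  have dle: "d \<le> norm (x - y)" if "y \<in> S" for y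
    using infdist_le[OF that, of x] by (simp add: d_def dist_norm)
  have "\<exists>y\<in>S. norm (x - y) < d + inverse (Suc n)" for n
  proof (rule ccontr)
    assume "\<not> ?thesis"
    then have "d + inverse (Suc n) \<le> d"
      unfolding d_def infdist_notempty[OF ne] by (intro cINF_greatest[OF ne]) (auto simp: dist_norm not_less)
    then show False by simp
  qed
  then obtain Y where Y: "\<And>n. Y n \<in> S" "\<And>n. norm (x - Y n) < d + inverse (Suc n)" by metis
  \<comment> \<open>The midpoint of two members lies in \<open>S\<close>, hence at distance at least
    \<open>d\<close> from \<open>x\<close>.\<close>
  have par: "(norm (Y m - Y n))\<^sup>2 \<le> 2 * (d + inverse (Suc m))\<^sup>2 + 2 * (d + inverse (Suc n))\<^sup>2 - 4 * d\<^sup>2" for m n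
  proof -
    have "(1/2) *\<^sub>R (Y m + Y n) \<in> S" using Y S by (intro subspace_scale subspace_add)
    from dle[OF this] have "d\<^sup>2 \<le> (norm (x - (1/2) *\<^sub>R (Y m + Y n)))\<^sup>2" using d0 by (intro power_mono)
    moreover have "(norm (Y m - Y n))\<^sup>2 = 2 * (norm (x - Y m))\<^sup>2 + 2 * (norm (x - Y n))\<^sup>2
        - 4 * (norm (x - (1/2) *\<^sub>R (Y m + Y n)))\<^sup>2"
      by (simp add: power2_norm_eq_inner algebra_simps inner_commute)
    moreover have "(norm (x - Y k))\<^sup>2 \<le> (d + inverse (Suc k))\<^sup>2" for k
      using Y(2)[of k] by (intro power_mono) auto
    note this[of m] this[of n]
    ultimately show ?thesis by linarith
  qed
  have "(\<lambda>n. d + inverse (real (Suc n))) \<longlonglongrightarrow> d + 0"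
    by (intro tendsto_intros LIMSEQ_inverse_real_of_nat)
  then have lim: "(\<lambda>n. (d + inverse (real (Suc n)))\<^sup>2) \<longlonglongrightarrow> d\<^sup>2" by (intro tendsto_intros) simp
  have "Cauchy Y"
  proof (rule metric_CauchyI)
    fix e :: real assume e: "e > 0"
    have "\<forall>\<^sub>F n in sequentially. (d + inverse (real (Suc n)))\<^sup>2 < d\<^sup>2 + e\<^sup>2 / 4"
      using lim e by (intro order_tendstoD) auto
    then obtain N where N: "\<And>n. n \<ge> N \<Longrightarrow> (d + inverse (real (Suc n)))\<^sup>2 < d\<^sup>2 + e\<^sup>2 / 4"
      by (auto simp: eventually_sequentially)
    show "\<exists>M. \<forall>m\<ge>M. \<forall>n\<ge>M. dist (Y m) (Y n) < e"
    proof (intro exI allI impI)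
      fix m n assume "N \<le> m" "N \<le> n"
      then have "(norm (Y m - Y n))\<^sup>2 < e\<^sup>2" using par[of m n] N[of m] N[of n] by linarith
      then show "dist (Y m) (Y n) < e"
        using e by (simp add: dist_norm power2_less_imp_less)
    qed
  qed
  then obtain y where y: "Y \<longlonglongrightarrow> y" by (auto simp: Cauchy_convergent_iff convergent_def)
  have yS: "y \<in> S" using S(2) Y(1) y by (rule closed_sequentially)
  have "(\<lambda>n. norm (x - Y n)) \<longlonglongrightarrow> norm (x - y)" by (intro tendsto_intros y)
  then have "norm (x - y) \<le> d"
    using \<open>(\<lambda>n. d + inverse (real (Suc n))) \<longlonglongrightarrow> d + 0\<close> Y(2)
    by (intro LIMSEQ_le[of _ _ "\<lambda>n. d + inverse (real (Suc n))"]) (auto intro: less_imp_le)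
  then have yd: "norm (x - y) = d" using dle[OF yS] by simp
  have "inner (x - y) z = 0" if z: "z \<in> S" for z
  proof (cases "z = 0")
    case False
    define t where "t = inner (x - y) z / inner z z"
    have "y + t *\<^sub>R z \<in> S" using S yS z by (intro subspace_add subspace_scale)
    then have "d\<^sup>2 \<le> (norm (x - (y + t *\<^sub>R z)))\<^sup>2" using dle d0 by (intro power_mono)
    also have "\<dots> = d\<^sup>2 - 2 * t * inner (x - y) z + t * t * inner z z"
      unfolding yd[symmetric] power2_norm_eq_inner by (simp add: algebra_simps inner_commute)
    also have "\<dots> = d\<^sup>2 - (inner (x - y) z)\<^sup>2 / inner z z"
      using False by (simp add: t_def power2_eq_square)
    finally have "(inner (x - y) z)\<^sup>2 / inner z z \<le> 0" by simp
    then show ?thesis using False inner_gt_zero_iff[of z] by (auto simp: divide_le_0_iff dest: leD)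
  qed simp
  then show ?thesis using yS by blast
qed

text \<open>Orthogonality gives |f - p|^2 = |f|^2 + |p|^2 in L2 norms, so a polynomial close to
  \<open>f\<close> forces \<open>f\<close> to be small. It serves twice: for the totality of the
  monomials and for the reality of the symbols.\<close>

lemma AE_eq_0_if_orthogonal_polynomials:
  fixes M :: "'a::euclidean_space measure" and f :: "'a \<Rightarrow> real"
  assumes M: "finite_measure M" "sets M = sets borel" and K: "compact K" "AE x in M. x \<in> K"
    and f: "f \<in> borel_measurable borel" "integrable M (\<lambda>x. (f x)\<^sup>2)"
    and orth: "\<And>p. real_polynomial_function p \<Longrightarrow> (\<integral>x. f x * p x \<partial>M) = 0"
  shows "AE x in M. f x = 0"
proof -
  note [measurable_cong] = M(2)
  note [measurable] = f(1)
  have "(\<integral>x. (f x)\<^sup>2 \<partial>M) \<le> 0"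
  proof (rule field_le_epsilon)
    fix e :: real assume "e > 0"
    then obtain p where p: "real_polynomial_function p" "(\<integral>x. (f x - p x)\<^sup>2 \<partial>M) < e"
      using real_polynomial_L2_dense[OF M K f] by blast
    have c: "continuous_on UNIV p"
      using p(1) by (auto intro: continuous_at_imp_continuous_on continuous_real_polymonial_function)
    then have [measurable]: "p \<in> borel_measurable borel" by (rule borel_measurable_continuous_onI)
    have ip: "integrable M (\<lambda>x. (p x)\<^sup>2)" by (rule continuous_square_integrable_compact[OF M K c])
    have ifp: "integrable M (\<lambda>x. f x * p x)"
    proof (rule Bochner_Integration.integrable_bound)
      show "integrable M (\<lambda>x. (f x)\<^sup>2 + (p x)\<^sup>2)" using f ip by simp
      have "\<bar>a * b\<bar> \<le> a\<^sup>2 + b\<^sup>2" for a b :: real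
        using zero_le_power2[of "\<bar>a\<bar> - \<bar>b\<bar>"] zero_le_power2[of "\<bar>a\<bar> + \<bar>b\<bar>"]
          mult_nonneg_nonneg[OF abs_ge_zero abs_ge_zero, of a b]
        unfolding power2_diff power2_sum abs_mult power2_abs by linarith
      then show "AE x in M. norm (f x * p x) \<le> norm ((f x)\<^sup>2 + (p x)\<^sup>2)" by simp
    qed measurable
    have "(\<integral>x. (f x - p x)\<^sup>2 \<partial>M) = (\<integral>x. (f x)\<^sup>2 + (p x)\<^sup>2 - 2 * (f x * p x) \<partial>M)"
      by (simp add: power2_diff mult.assoc)
    also have "\<dots> = (\<integral>x. (f x)\<^sup>2 \<partial>M) + (\<integral>x. (p x)\<^sup>2 \<partial>M)"
      using f ip ifp orth[OF p(1)] by simp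
    finally have "(\<integral>x. (f x - p x)\<^sup>2 \<partial>M) = (\<integral>x. (f x)\<^sup>2 \<partial>M) + (\<integral>x. (p x)\<^sup>2 \<partial>M)" .
    moreover have "0 \<le> (\<integral>x. (p x)\<^sup>2 \<partial>M)" by simp
    ultimately show "(\<integral>x. (f x)\<^sup>2 \<partial>M) \<le> 0 + e" using p(2) by linarith
  qed
  moreover have "0 \<le> (\<integral>x. (f x)\<^sup>2 \<partial>M)" by simp
  ultimately have "(\<integral>x. (f x)\<^sup>2 \<partial>M) = 0" by simp
  then have "AE x in M. (f x)\<^sup>2 = 0"
    using f(2) by (subst (asm) integral_nonneg_eq_0_iff_AE) auto
  then show ?thesis by simp
qed

section \<open>Totality of the monomials and its consequences\<close>

lemma AE_circ_mult_cnj: "AE z in circ. z * cnj z = 1"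
  using AE_circ_norm by eventually_elim (simp add: complex_norm_square[symmetric])

text \<open>On the circle z^m cnj(z)^n is a power of z or of its conjugate. Against the former
  \<open>f\<close> integrates to 0 as a Hardy function, against the latter by hypothesis, so
  \<open>f\<close> is orthogonal to all real polynomials in the plane.\<close>

lemma hardy_fun_eq_0_AE:
  assumes f: "hardy_fun f" and z: "\<And>k. (\<integral>z. f z * cnj (z ^ k) \<partial>circ) = 0"
  shows "AE z in circ. f z = 0"
proof -
  note [measurable] = hardy_funD(1)[OF f]
  have ic: "integrable circ (\<lambda>z. f z * cnj (z ^ k))" for k
    using integrable_circ_prod_cnj[OF f hardy_fun_monomial] by simp
  \<comment> \<open>Quantifying over all exponents makes \<open>Q\<close> stable under
    multiplication by z and its conjugate; integrability is carried along for the additivity of the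
    integral.\<close>
  define Q where "Q h \<longleftrightarrow> (\<forall>m n. integrable circ (\<lambda>z. f z * h z * (z ^ m * cnj z ^ n)) \<and>
      (\<integral>z. f z * h z * (z ^ m * cnj z ^ n) \<partial>circ) = 0)" for h
  have base: "Q (\<lambda>_. 1)"
    unfolding Q_def
  proof (intro allI)
    fix m n :: nat
    show "integrable circ (\<lambda>z. f z * 1 * (z ^ m * cnj z ^ n)) \<and> (\<integral>z. f z * 1 * (z ^ m * cnj z ^ n) \<partial>circ) = 0"
    proof (cases "n < m")
      case True
      have ae: "AE z in circ. f z * 1 * (z ^ m * cnj z ^ n) = f z * z ^ (m - n)"
        using AE_circ_mult_cnj
      proof eventually_elim
        case (elim z)
        have "z ^ m * cnj z ^ n = z ^ (m - n) * (z * cnj z) ^ n"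
          using True by (simp add: power_mult_distrib mult.assoc[symmetric] power_add[symmetric])
        then show ?case using elim by simp
      qed
      have "integrable circ (\<lambda>z. f z * 1 * (z ^ m * cnj z ^ n)) = integrable circ (\<lambda>z. f z * z ^ (m - n))"
        by (rule integrable_cong_AE[OF _ _ ae]) measurable
      moreover have "(\<integral>z. f z * 1 * (z ^ m * cnj z ^ n) \<partial>circ) = (\<integral>z. f z * z ^ (m - n) \<partial>circ)"
        by (rule integral_cong_AE[OF _ _ ae]) measurable
      ultimately show ?thesis using hardy_funD(3,4)[OF f] True by simp
    next
      case False
      have ae: "AE z in circ. f z * 1 * (z ^ m * cnj z ^ n) = f z * cnj (z ^ (n - m))"
        using AE_circ_mult_cnj
      proof eventually_elim
        case (elim z)
        have "z ^ m * cnj z ^ n = cnj z ^ (n - m) * (z * cnj z) ^ m"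
          using False by (simp add: power_mult_distrib mult.left_commute power_add[symmetric])
        then show ?case using elim by simp
      qed
      have "integrable circ (\<lambda>z. f z * 1 * (z ^ m * cnj z ^ n)) = integrable circ (\<lambda>z. f z * cnj (z ^ (n - m)))"
        by (rule integrable_cong_AE[OF _ _ ae]) measurable
      moreover have "(\<integral>z. f z * 1 * (z ^ m * cnj z ^ n) \<partial>circ) = (\<integral>z. f z * cnj (z ^ (n - m)) \<partial>circ)"
        by (rule integral_cong_AE[OF _ _ ae]) measurable
      ultimately show ?thesis using ic z by simp
    qed
  qed
  have Qlin: "Q (\<lambda>z. a * h1 z + b * h2 z)" if "Q h1" "Q h2" for a b h1 h2
    unfolding Q_def
  proof (intro allI)
    fix m n
    have eq: "(\<lambda>z. f z * (a * h1 z + b * h2 z) * (z ^ m * cnj z ^ n)) =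
        (\<lambda>z. a * (f z * h1 z * (z ^ m * cnj z ^ n)) + b * (f z * h2 z * (z ^ m * cnj z ^ n)))"
      by (simp add: algebra_simps)
    show "integrable circ (\<lambda>z. f z * (a * h1 z + b * h2 z) * (z ^ m * cnj z ^ n)) \<and>
        (\<integral>z. f z * (a * h1 z + b * h2 z) * (z ^ m * cnj z ^ n) \<partial>circ) = 0"
      unfolding eq using that by (simp add: Q_def)
  qed
  have Qz: "Q (\<lambda>z. z * h z)" "Q (\<lambda>z. cnj z * h z)" if "Q h" for h
  proof -
    have "(\<lambda>z. f z * (z * h z) * (z ^ m * cnj z ^ n)) = (\<lambda>z. f z * h z * (z ^ Suc m * cnj z ^ n))"
      "(\<lambda>z. f z * (cnj z * h z) * (z ^ m * cnj z ^ n)) = (\<lambda>z. f z * h z * (z ^ m * cnj z ^ Suc n))" for m n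
      by (auto simp: mult_ac)
    then show "Q (\<lambda>z. z * h z)" "Q (\<lambda>z. cnj z * h z)"
      using that unfolding Q_def by metis+
  qed
  have Qp: "Q h \<Longrightarrow> Q (\<lambda>z. of_real (p z) * h z)" if "real_polynomial_function p" for p h
    using that
  proof (induction arbitrary: h)
    case (linear p)
    \<comment> \<open>Every real linear functional on the plane has the form a z + b cnj(z).\<close>
    define a b where "a = (p 1 - \<i> * p \<i>) / 2" and "b = (p 1 + \<i> * p \<i>) / 2"
    have lin: "p z = Re z * p 1 + Im z * p \<i>" for z
    proof -
      interpret bounded_linear p by fact
      have "z = Re z *\<^sub>R 1 + Im z *\<^sub>R \<i>" by (simp add: complex_eq_iff)
      then have "p z = p (Re z *\<^sub>R 1 + Im z *\<^sub>R \<i>)" by simp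
      also have "\<dots> = Re z * p 1 + Im z * p \<i>" by (simp only: add scaleR real_scaleR_def)
      finally show ?thesis .
    qed
    have "of_real (p z) = a * z + b * cnj z" for z
      by (subst lin) (simp add: a_def b_def complex_eq_iff field_simps)
    then have "of_real (p z) * h z = a * (z * h z) + b * (cnj z * h z)" for z
      by (simp only: distrib_right mult.assoc)
    then show ?case using Qlin[OF Qz[OF linear.prems], of a b] by simp
  next
    case (const c)
    then show ?case using Qlin[of h h "of_real c" 0] by simp
  next
    case (add p q)
    then show ?case using Qlin[OF add.IH, of h h 1 1] by (simp add: distrib_right)
  next
    case (mult p q)
    then show ?case using mult.IH(1)[OF mult.IH(2)] by (simp add: mult.assoc)
  qed
  have orth: "integrable circ (\<lambda>z. f z * of_real (p z))" "(\<integral>z. f z * of_real (p z) \<partial>circ) = 0"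
    if "real_polynomial_function p" for p
    using Qp[OF that base] unfolding Q_def by (auto dest!: spec[of _ 0])
  note circ = finite_measure_circ sets_circ compact_sphere[of 0 1]
  have K: "AE z in circ. z \<in> sphere (0::complex) 1" using AE_circ_norm by simp
  have iRI: "integrable circ (\<lambda>z. (Re (f z))\<^sup>2)" "integrable circ (\<lambda>z. (Im (f z))\<^sup>2)"
    by (rule Bochner_Integration.integrable_bound[OF hardy_funD(2)[OF f]]; simp add: cmod_power2)+
  have "AE z in circ. Re (f z) = 0"
  proof (rule AE_eq_0_if_orthogonal_polynomials[OF circ K _ iRI(1)])
    fix p :: "complex \<Rightarrow> real" assume p: "real_polynomial_function p"
    show "(\<integral>z. Re (f z) * p z \<partial>circ) = 0"
      using integral_Re[OF orth(1)[OF p]] orth(2)[OF p] by simp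
  qed simp
  moreover have "AE z in circ. Im (f z) = 0"
  proof (rule AE_eq_0_if_orthogonal_polynomials[OF circ K _ iRI(2)])
    fix p :: "complex \<Rightarrow> real" assume p: "real_polynomial_function p"
    show "(\<integral>z. Im (f z) * p z \<partial>circ) = 0"
      using integral_Im[OF orth(1)[OF p]] orth(2)[OF p] by simp
  qed simp
  ultimately show ?thesis by eventually_elim (simp add: complex_eq_iff)
qed

lemma fourier_eq_cinner: "fourier x k = cinner x (monomial k)"
  by transfer simp

lemma hardy_eq_0_if_monomials: "(\<And>k. cinner x (monomial k) = 0) \<Longrightarrow> x = 0"
  unfolding fourier_eq_cinner[symmetric]
  by transfer (auto simp: hardy_rel_def hardy_fun_zero intro: hardy_fun_eq_0_AE)

lemma hardy_eqI_monomials: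
  assumes "\<And>k. cinner x (monomial k) = cinner y (monomial k)"
  shows "x = y"
proof -
  have "x - y = 0"
    by (rule hardy_eq_0_if_monomials) (simp add: cinner.diff_left assms)
  then show ?thesis by simp
qed

text \<open>\<open>S\<close> is only a real subspace, so all complex multiples of the monomials are
  required: the multiples by 1 and by i remove the real and the imaginary part of each Fourier
  coefficient of a vector orthogonal to \<open>S\<close>.\<close>

lemma hardy_closed_subspace_UNIV:
  fixes S :: "hardy set"
  assumes S: "subspace S" "closed S" and m: "\<And>c k. c *\<^sub>C monomial k \<in> S"
  shows "S = UNIV"
proof -
  have "x \<in> S" for x
  proof -
    obtain y where y: "y \<in> S" "\<And>z. z \<in> S \<Longrightarrow> inner (x - y) z = 0"
      using orthogonal_projection_exists[OF S] by blast
    have "cinner (x - y) (monomial k) = 0" for k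
    proof -
      have "Re (cnj c * cinner (x - y) (monomial k)) = 0" for c
        using y(2)[OF m[of c k]] by (simp add: inner_hardy_def cinner_scaleC_right)
      from this[of 1] this[of \<i>] show ?thesis by (simp add: complex_eq_iff)
    qed
    then have "x - y = 0" by (rule hardy_eq_0_if_monomials)
    then show ?thesis using y(1) by simp
  qed
  then show ?thesis by blast
qed

text \<open>Only real linearity is assumed, so that the principle also covers anti-linear maps built
  from \<open>cconj\<close>; this is why agreement is tested on complex multiples of
  monomials.\<close>

lemma hardy_bounded_linear_eqI:
  fixes f g :: "hardy \<Rightarrow> 'b::real_normed_vector"
  assumes f: "bounded_linear f" and g: "bounded_linear g"
    and eq: "\<And>c k. f (c *\<^sub>C monomial k) = g (c *\<^sub>C monomial k)"
  shows "f x = g x"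
proof -
  interpret f: bounded_linear f by fact
  interpret g: bounded_linear g by fact
  have "{x. f x = g x} = UNIV"
    by (rule hardy_closed_subspace_UNIV)
      (auto simp: subspace_def f.add g.add f.scaleR g.scaleR f.zero g.zero eq
        intro!: closed_Collect_eq linear_continuous_on f g)
  then show ?thesis by auto
qed

lemma hardy_subspace_imp_subspace: "hardy.subspace S \<Longrightarrow> subspace S"
  by (auto simp: hardy.subspace_def subspace_def scaleR_hardy_def)

lemma hardy_orthogonal_projection:
  assumes S: "hardy.subspace S" "closed S"
  obtains y where "y \<in> S" "\<And>z. z \<in> S \<Longrightarrow> cinner (x - y) z = 0"
proof -
  obtain y where y: "y \<in> S" "\<And>z. z \<in> S \<Longrightarrow> inner (x - y) z = 0"
    using orthogonal_projection_exists[OF hardy_subspace_imp_subspace[OF S(1)] S(2)] by blast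
  have "cinner (x - y) z = 0" if z: "z \<in> S" for z
  proof -
    have "Re (cnj c * cinner (x - y) z) = 0" for c
      using y(2)[OF hardy.subspace_scale[OF S(1) z, of c]] by (simp add: inner_hardy_def cinner_scaleC_right)
    from this[of 1] this[of \<i>] show ?thesis by (simp add: complex_eq_iff)
  qed
  with y(1) that show thesis by blast
qed

lemma bounded_linear_hardyI:
  fixes f :: "hardy \<Rightarrow> hardy"
  assumes "\<And>x y. f (x + y) = f x + f y" "\<And>r x. f (of_real r *\<^sub>C x) = of_real r *\<^sub>C f x"
    "\<And>x. norm (f x) \<le> norm x"
  shows "bounded_linear f"
  by (rule bounded_linear_intro[where K=1]) (use assms in \<open>auto simp: scaleR_hardy_def\<close>)

section \<open>The shift, the backward shift and the conjugation of coefficients\<close>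

lemma norm_eqI_cinner: "cinner x x = cinner y y \<Longrightarrow> norm x = norm y"
  by (simp add: norm_hardy_def inner_hardy_def)

lemma shift_add: "shift (x + y) = shift x + shift y"
  by transfer (auto simp: hardy_rel_def distrib_left intro!: hardy_fun_shift hardy_fun_add)

lemma shift_scaleC: "shift (c *\<^sub>C x) = c *\<^sub>C shift x"
  by transfer (auto simp: hardy_rel_def mult_ac intro!: hardy_fun_shift hardy_fun_cmult)

lemma cinner_shift_shift: "cinner (shift x) (shift y) = cinner x y"
proof (transfer, rule integral_cong_AE)
  fix f g assume h: "hardy_rel f f" "hardy_rel g g"
  then have [measurable]: "f \<in> borel_measurable borel" "g \<in> borel_measurable borel"
    by (auto simp: hardy_rel_def dest: hardy_funD(1))
  show "(\<lambda>z. z * f z * cnj (z * g z)) \<in> borel_measurable circ" "(\<lambda>z. f z * cnj (g z)) \<in> borel_measurable circ"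
    by measurable
  show "AE z in circ. z * f z * cnj (z * g z) = f z * cnj (g z)"
    using AE_circ_mult_cnj
  proof eventually_elim
    case (elim z)
    then have "z * cnj z * (f z * cnj (g z)) = f z * cnj (g z)" by simp
    then show ?case by (simp add: mult_ac)
  qed
qed

lemma bounded_linear_shift: "bounded_linear shift"
  using norm_eqI_cinner[OF cinner_shift_shift]
  by (intro bounded_linear_hardyI shift_add shift_scaleC) simp

lemma shift_monomial: "shift (monomial k) = monomial (Suc k)"
  by transfer (auto simp: hardy_rel_def intro: hardy_fun_shift hardy_fun_monomial hardy_fun_monomial[of "Suc _", simplified])

lemma hardy_fun_bshift:
  assumes f: "hardy_fun f"
  shows "hardy_fun (\<lambda>z. (f z - (\<integral>w. f w \<partial>circ)) * cnj z)"
proof -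
  let ?c = "\<integral>w. f w \<partial>circ"
  have h: "hardy_fun (\<lambda>z. f z - ?c)"
    using hardy_fun_diff[OF f hardy_fun_cmult[OF hardy_fun_monomial[of 0], of ?c]] by simp
  note [measurable] = hardy_funD(1)[OF h]
  have fm [measurable]: "f \<in> borel_measurable borel" using hardy_funD(1)[OF f] .
  have "integrable circ (\<lambda>z. (cmod ((f z - ?c) * cnj z))\<^sup>2) \<longleftrightarrow> integrable circ (\<lambda>z. (cmod (f z - ?c))\<^sup>2)"
    by (rule integrable_cong_AE) (use AE_circ_norm in \<open>auto simp: norm_mult\<close>)
  moreover have "(\<integral>z. (f z - ?c) * cnj z * z ^ n \<partial>circ) = 0" if n: "n \<ge> 1" for n
  proof -
    have "(\<integral>z. (f z - ?c) * cnj z * z ^ n \<partial>circ) = (\<integral>z. (f z - ?c) * z ^ (n - 1) \<partial>circ)"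
    proof (rule integral_cong_AE)
      show "AE z in circ. (f z - ?c) * cnj z * z ^ n = (f z - ?c) * z ^ (n - 1)"
        using AE_circ_mult_cnj
      proof eventually_elim
        case (elim z)
        have "cnj z * z ^ n = (z * cnj z) * z ^ (n - 1)"
          using n by (cases n) (auto simp: mult_ac)
        then show ?case using elim by (simp add: mult.assoc)
      qed
    qed measurable
    also have "\<dots> = 0"
    \<comment> \<open>The case n = 1 is the one that the subtraction of the mean repairs.\<close>
    proof (cases "n = 1")
      case True
      have "measure circ UNIV = 1" by (simp add: measure_def emeasure_circ_UNIV)
      then show ?thesis
        using True hardy_funD(4)[OF f, of 0] finite_measure.integrable_const[OF finite_measure_circ, of ?c] by simp
    next
      case False
      then show ?thesis using hardy_funD(3)[OF h, of "n - 1"] n by simp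
    qed
    finally show ?thesis .
  qed
  ultimately show ?thesis
    using hardy_funD(2)[OF h] by (simp add: hardy_fun_def)
qed

text \<open>A concrete form of the adjoint of the shift: remove the constant term and divide by z,
  division being multiplication by the conjugate on the circle.\<close>

lift_definition bshift :: "hardy \<Rightarrow> hardy" is "\<lambda>f z. (f z - (\<integral>w. f w \<partial>circ)) * cnj z"
proof -
  fix f g assume h: "hardy_rel f g"
  then have "(\<integral>w. f w \<partial>circ) = (\<integral>w. g w \<partial>circ)"
    by (intro integral_cong_AE) (auto simp: hardy_rel_def dest: hardy_funD(1))
  then show "hardy_rel (\<lambda>z. (f z - (\<integral>w. f w \<partial>circ)) * cnj z) (\<lambda>z. (g z - (\<integral>w. g w \<partial>circ)) * cnj z)"
    using h hardy_fun_bshift[of f] hardy_fun_bshift[of g] by (auto simp: hardy_rel_def elim: eventually_mono)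
qed

text \<open>The constant removed by \<open>bshift\<close> is paired with the Fourier coefficient of
  f at index -1, which is 0.\<close>

lemma cinner_shift_left: "cinner (shift x) y = cinner x (bshift y)"
proof transfer
  fix f g assume h: "hardy_rel f f" "hardy_rel g g"
  let ?c = "\<integral>w. g w \<partial>circ"
  have f: "hardy_fun f" and g: "hardy_fun g" using h by (auto simp: hardy_rel_def)
  have i: "integrable circ (\<lambda>z. z * f z * cnj (g z))"
    using integrable_circ_prod_cnj[OF hardy_fun_shift[OF f] g] .
  have "(\<integral>z. f z * cnj ((g z - ?c) * cnj z) \<partial>circ) = (\<integral>z. z * f z * cnj (g z) - cnj ?c * (f z * z ^ 1) \<partial>circ)"
    by (rule Bochner_Integration.integral_cong) (auto simp: algebra_simps)
  also have "\<dots> = (\<integral>z. z * f z * cnj (g z) \<partial>circ) - cnj ?c * (\<integral>z. f z * z ^ 1 \<partial>circ)"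
    using i hardy_funD(4)[OF f, of 1] by (subst Bochner_Integration.integral_diff) auto
  also have "(\<integral>z. f z * z ^ 1 \<partial>circ) = 0" by (rule hardy_funD(3)[OF f]) simp
  finally show "(\<integral>z. z * f z * cnj (g z) \<partial>circ) = (\<integral>z. f z * cnj ((g z - ?c) * cnj z) \<partial>circ)" by simp
qed

lemma cinner_bshift_left: "cinner (bshift x) y = cinner x (shift y)"
  by (subst (1 2) cinner_commute) (simp add: cinner_shift_left)

lemma adjoint_shift: "adjoint shift = bshift"
  by (rule adjoint_unique) (simp add: inner_hardy_def cinner_shift_left)

lemma bounded_linear_bshift: "bounded_linear bshift"
proof (rule bounded_linear_hardyI)
  fix x y :: hardy and r :: real
  show "bshift (x + y) = bshift x + bshift y"
    by (rule hardy_eqI_monomials) (simp add: cinner_bshift_left cinner_add_left)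
  show "bshift (of_real r *\<^sub>C x) = of_real r *\<^sub>C bshift x"
    by (rule hardy_eqI_monomials) (simp add: cinner_bshift_left cinner_scaleC_left)
  have "norm (bshift x) * norm (bshift x) = cmod (cinner (bshift x) (bshift x))"
    by (simp add: cinner_self_norm power2_eq_square norm_mult)
  also have "\<dots> = cmod (cinner x (shift (bshift x)))" by (simp add: cinner_bshift_left)
  also have "\<dots> \<le> norm x * norm (shift (bshift x))" by (rule norm_cinner_le)
  also have "\<dots> = norm x * norm (bshift x)" by (simp add: norm_eqI_cinner[OF cinner_shift_shift])
  finally show "norm (bshift x) \<le> norm x"
    by (cases "norm (bshift x) = 0") auto
qed

text \<open>This rank one defect is the origin of the rank one difference in
  \<open>Ht_square\<close>.\<close>

lemma shift_bshift: "shift (bshift x) = x - cinner x (monomial 0) *\<^sub>C monomial 0"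
proof transfer
  fix f assume "hardy_rel f f"
  then have f: "hardy_fun f" by (simp add: hardy_rel_def)
  let ?c = "\<integral>w. f w \<partial>circ"
  have "hardy_fun (\<lambda>z. f z - ?c)"
    using hardy_fun_diff[OF f hardy_fun_cmult[OF hardy_fun_monomial[of 0], of ?c]] by simp
  moreover have "AE z in circ. z * ((f z - ?c) * cnj z) = f z - ?c"
    using AE_circ_mult_cnj
  proof eventually_elim
    case (elim z)
    then show ?case by (metis mult.left_commute mult.right_neutral)
  qed
  ultimately show "hardy_rel (\<lambda>z. z * ((f z - ?c) * cnj z)) (\<lambda>z. f z - (\<integral>z. f z * cnj (z ^ 0) \<partial>circ) * z ^ 0)"
    using hardy_fun_shift[OF hardy_fun_bshift[OF f]] by (simp add: hardy_rel_def)
qed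

lemma cconj_add: "cconj (x + y) = cconj x + cconj y"
  by transfer (auto simp: hardy_rel_def intro!: hardy_fun_add hardy_fun_cconj[of "\<lambda>z. _ z + _ z", simplified] hardy_fun_cconj)

lemma cconj_scaleC: "cconj (c *\<^sub>C x) = cnj c *\<^sub>C cconj x"
  by transfer (auto simp: hardy_rel_def intro!: hardy_fun_cmult hardy_fun_cconj)

lemma cconj_cconj [simp]: "cconj (cconj x) = x"
  by transfer (auto simp: hardy_rel_def)

lemma cconj_monomial [simp]: "cconj (monomial k) = monomial k"
  by transfer (auto simp: hardy_rel_def hardy_fun_monomial)

lemma shift_cconj: "shift (cconj x) = cconj (shift x)"
  by transfer (auto simp: hardy_rel_def intro!: hardy_fun_shift hardy_fun_cconj)

lemma cinner_cconj_cconj: "cinner (cconj x) (cconj y) = cnj (cinner x y)"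
proof transfer
  fix f g assume h: "hardy_rel f f" "hardy_rel g g"
  then have [measurable]: "f \<in> borel_measurable borel" "g \<in> borel_measurable borel"
    by (auto simp: hardy_rel_def dest: hardy_funD(1))
  have "(\<integral>z. cnj (f (cnj z)) * cnj (cnj (g (cnj z))) \<partial>circ) = (\<integral>z. cnj (f (cnj z) * cnj (g (cnj z))) \<partial>circ)"
    by simp
  also have "\<dots> = cnj (\<integral>z. f (cnj z) * cnj (g (cnj z)) \<partial>circ)"
    by (rule Bochner_Integration.integral_cnj)
  also have "\<dots> = cnj (\<integral>z. f z * cnj (g z) \<partial>circ)"
    using integral_circ_cnj(1)[of "\<lambda>z. f z * cnj (g z)"] by simp
  finally show "(\<integral>z. cnj (f (cnj z)) * cnj (cnj (g (cnj z))) \<partial>circ) = cnj (\<integral>z. f z * cnj (g z) \<partial>circ)" .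
qed

lemma norm_cconj: "norm (cconj x) = norm x"
proof -
  have "cinner (cconj x) (cconj x) = cinner x x"
    using cinner_cconj_cconj[of x x] cinner_self(1)[of x] by (metis complex_cnj_complex_of_real)
  then show ?thesis by (rule norm_eqI_cinner)
qed

lemma bounded_linear_cconj: "bounded_linear cconj"
  by (intro bounded_linear_hardyI cconj_add) (simp_all add: cconj_scaleC norm_cconj)

section \<open>Spectral measures of positive operators\<close>

declare cinner.zero_left [simp] cinner.zero_right [simp]

text \<open>Frees the sum from the exact degree, which may drop when polynomials are added.\<close>

lemma poly_op_altdef:
  assumes "degree p \<le> n"
  shows "poly_op p A v = (\<Sum>i\<le>n. coeff p i *\<^sub>C (A ^^ i) v)"
  unfolding poly_op_def
  by (rule sum.mono_neutral_left) (use assms in \<open>auto simp: coeff_eq_0\<close>)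

lemma poly_op_0 [simp]: "poly_op 0 A v = 0"
  by (simp add: poly_op_def)

lemma poly_op_1 [simp]: "poly_op 1 A v = v"
  by (simp add: poly_op_def)

lemma poly_op_add: "poly_op (p + q) A v = poly_op p A v + poly_op q A v"
proof -
  let ?n = "max (degree p) (degree q)"
  show ?thesis
    by (subst (1 2 3) poly_op_altdef[of _ ?n])
      (auto simp: degree_add_le_max hardy.scale_left_distrib sum.distrib)
qed

lemma poly_op_smult: "poly_op (smult c p) A v = c *\<^sub>C poly_op p A v"
  by (subst (1 2) poly_op_altdef[of _ "degree p"]) (auto simp: degree_smult_le hardy.scale_sum_right)

lemma poly_op_diff: "poly_op (p - q) A v = poly_op p A v - poly_op q A v"
  using poly_op_add[of p "smult (-1) q" A v] poly_op_smult[of "-1" q A v] by simp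

lemma poly_op_monom: "poly_op (monom c k) A v = c *\<^sub>C (A ^^ k) v"
  by (subst poly_op_altdef[of _ k]) (auto simp: degree_monom_le if_distrib[of "\<lambda>c. c *\<^sub>C _"] cong: if_cong)

section \<open>Real polynomials among the complex ones and Weierstrass approximation\<close>

abbreviation cpoly :: "real poly \<Rightarrow> complex poly" where
  "cpoly \<equiv> map_poly complex_of_real"

lemma poly_cpoly [simp]: "poly (cpoly r) (of_real t) = of_real (poly r t)"
  by (induction r) (auto simp: map_poly_pCons)

lemma poly_map_poly_cnj: "poly (map_poly cnj p) (of_real t) = cnj (poly p (of_real t))"
  by (induction p) (auto simp: map_poly_pCons)

lemma map_poly_cnj_cpoly [simp]: "map_poly cnj (cpoly r) = cpoly r"
  by (rule poly_eqI) (simp add: coeff_map_poly)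

lemma poly_eqI_real:
  fixes p q :: "complex poly"
  assumes "\<And>t::real. poly p (of_real t) = poly q (of_real t)"
  shows "p = q"
proof (rule ccontr)
  assume "p \<noteq> q"
  then have "finite {z. poly (p - q) z = 0}" by (intro poly_roots_finite) simp
  moreover have "range complex_of_real \<subseteq> {z. poly (p - q) z = 0}" using assms by auto
  ultimately have "finite (range complex_of_real)" by (rule rev_finite_subset)
  then show False
    using finite_imageD[of complex_of_real UNIV] infinite_UNIV_char_0[where 'a=real] by (auto simp: inj_on_def)
qed

lemma cpoly_add: "cpoly (p + q) = cpoly p + cpoly q"
  and cpoly_mult: "cpoly (p * q) = cpoly p * cpoly q"
  and cpoly_smult: "cpoly (smult c p) = smult (of_real c) (cpoly p)"
  by (rule poly_eqI_real, simp)+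

lemma real_polynomial_function_poly:
  assumes "real_polynomial_function (g :: real \<Rightarrow> real)"
  obtains r where "g = poly r"
proof -
  obtain a n where "g = (\<lambda>x. \<Sum>i\<le>n. a i * x ^ i)"
    using assms by (auto simp: real_polynomial_function_iff_sum)
  then have "g = poly (\<Sum>i\<le>n. monom (a i) i)"
    by (auto simp: poly_sum poly_monom)
  then show thesis by (rule that)
qed

lemma Weierstrass_poly_real:
  fixes f :: "real \<Rightarrow> real"
  assumes "continuous_on {a..b} f"
  obtains r :: "nat \<Rightarrow> real poly" where "\<And>n t. t \<in> {a..b} \<Longrightarrow> \<bar>poly (r n) t - f t\<bar> < 1 / Suc n"
proof -
  have "\<exists>r. \<forall>t\<in>{a..b}. \<bar>poly r t - f t\<bar> < 1 / Suc n" for n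
  proof -
    obtain g where g: "real_polynomial_function g" "\<And>t. t \<in> {a..b} \<Longrightarrow> \<bar>f t - g t\<bar> < 1 / Suc n"
      using Stone_Weierstrass_real_polynomial_function[OF compact_Icc assms, of "1 / Suc n"] by auto
    show ?thesis
      using real_polynomial_function_poly[OF g(1)] g(2) by (metis abs_minus_commute)
  qed
  then show thesis using that by metis
qed

lemma LIMSEQ_inverse_Suc_mult: "(\<lambda>n. 1 / real (Suc n) * c) \<longlonglongrightarrow> 0"
proof -
  have "(\<lambda>n. 1 / real (Suc n)) \<longlonglongrightarrow> 0"
    using LIMSEQ_inverse_real_of_nat by (simp add: inverse_eq_divide)
  from tendsto_mult_right[OF this, of c] show ?thesis by simp
qed

lemma uniform_limit_inverse_Suc:
  assumes "\<And>n t. t \<in> S \<Longrightarrow> dist (f n t) (g t) \<le> 1 / Suc n * c"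
  shows "uniform_limit S f g sequentially"
proof (rule uniform_limitI)
  fix e :: real assume "e > 0"
  then have "\<forall>\<^sub>F n in sequentially. 1 / real (Suc n) * c < e"
    by (rule order_tendstoD(2)[OF LIMSEQ_inverse_Suc_mult])
  then show "\<forall>\<^sub>F n in sequentially. \<forall>t\<in>S. dist (f n t) (g t) < e"
    by eventually_elim (use assms in \<open>auto intro: le_less_trans\<close>)
qed

lemma Weierstrass_poly_complex:
  fixes f :: "real \<Rightarrow> complex"
  assumes "continuous_on {a..b} f"
  obtains p :: "nat \<Rightarrow> complex poly" where "uniform_limit {a..b} (\<lambda>n t. poly (p n) (of_real t)) f sequentially"
proof -
  obtain r where r: "\<And>n t. t \<in> {a..b} \<Longrightarrow> \<bar>poly (r n) t - Re (f t)\<bar> < 1 / Suc n"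
    using Weierstrass_poly_real[of a b "\<lambda>t. Re (f t)"] assms by (auto intro: continuous_intros)
  obtain s where s: "\<And>n t. t \<in> {a..b} \<Longrightarrow> \<bar>poly (s n) t - Im (f t)\<bar> < 1 / Suc n"
    using Weierstrass_poly_real[of a b "\<lambda>t. Im (f t)"] assms by (auto intro: continuous_intros)
  have "uniform_limit {a..b} (\<lambda>n t. poly (cpoly (r n) + smult \<i> (cpoly (s n))) (of_real t)) f sequentially"
  proof (rule uniform_limit_inverse_Suc[where c=2])
    fix n t assume t: "t \<in> {a..b}"
    have "cmod (poly (cpoly (r n) + smult \<i> (cpoly (s n))) (of_real t) - f t)
        \<le> \<bar>poly (r n) t - Re (f t)\<bar> + \<bar>poly (s n) t - Im (f t)\<bar>"
      by (rule order_trans[OF cmod_le]) simp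
    then show "dist (poly (cpoly (r n) + smult \<i> (cpoly (s n))) (of_real t)) (f t) \<le> 1 / Suc n * 2"
      using r[OF t, of n] s[OF t, of n] unfolding dist_norm by linarith
  qed
  then show thesis by (rule that)
qed

section \<open>Polynomials in a positive operator and the spectral measure\<close>

locale positive_operator =
  fixes A :: "hardy \<Rightarrow> hardy"
  assumes positive: "positive_op A"
begin

lemma bounded_linear_A: "bounded_linear A"
  using positive by (auto simp: positive_op_def bounded_clinear_def)

sublocale bounded_linear A by (rule bounded_linear_A)

lemma scaleC: "A (c *\<^sub>C x) = c *\<^sub>C A x"
  using positive by (auto simp: positive_op_def bounded_clinear_def)

lemma selfadjoint: "cinner (A x) y = cinner x (A y)"
  using positive by (auto simp: positive_op_def selfadjoint_def)

lemma nonneg: "0 \<le> Re (cinner (A x) x)"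
  using positive by (auto simp: positive_op_def)

lemma poly_op_pCons: "poly_op (pCons a p) A v = a *\<^sub>C v + A (poly_op p A v)"
proof -
  have "poly_op (pCons a p) A v = (\<Sum>i\<le>Suc (degree p). coeff (pCons a p) i *\<^sub>C (A ^^ i) v)"
    by (rule poly_op_altdef) (simp add: degree_pCons_le)
  also have "\<dots> = a *\<^sub>C v + (\<Sum>i\<le>degree p. coeff p i *\<^sub>C (A ^^ Suc i) v)"
    by (subst sum.atMost_Suc_shift) simp
  also have "(\<Sum>i\<le>degree p. coeff p i *\<^sub>C (A ^^ Suc i) v) = A (poly_op p A v)"
    by (simp add: poly_op_def sum scaleC)
  finally show ?thesis .
qed

lemma bounded_linear_poly_op: "bounded_linear (poly_op p A)"
proof (induction p)
  case 0
  have "poly_op 0 A = (\<lambda>v. 0)" by (simp add: fun_eq_iff)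
  then show ?case by simp
next
  case (pCons a p)
  have "poly_op (pCons a p) A = (\<lambda>v. a *\<^sub>C v + A (poly_op p A v))"
    by (simp add: fun_eq_iff poly_op_pCons)
  then show ?case
    using bounded_linear_add[OF scaleC.bounded_linear_right bounded_linear_compose[OF bounded_linear_A pCons.IH]] by simp
qed

lemma poly_op_add_arg: "poly_op p A (x + y) = poly_op p A x + poly_op p A y"
  using bounded_linear_poly_op by (simp add: bounded_linear.linear linear_add)

lemma poly_op_diff_arg: "poly_op p A (x - y) = poly_op p A x - poly_op p A y"
  using bounded_linear_poly_op by (simp add: bounded_linear.linear linear_diff)

lemma poly_op_scaleC_arg: "poly_op p A (c *\<^sub>C x) = c *\<^sub>C poly_op p A x"
  by (induction p) (auto simp: poly_op_pCons scaleC hardy.scale_right_distrib mult.commute)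

lemma poly_op_commute: "poly_op p A (A x) = A (poly_op p A x)"
  by (induction p) (auto simp: poly_op_pCons scaleC add)

lemma poly_op_mult: "poly_op (p * q) A v = poly_op p A (poly_op q A v)"
  by (induction p) (auto simp: poly_op_pCons mult_pCons_left poly_op_add poly_op_smult)

lemma poly_op_X: "poly_op [:0, 1:] A v = A v"
  by (simp add: poly_op_pCons)

lemma poly_op_adjoint: "cinner (poly_op p A x) y = cinner x (poly_op (map_poly cnj p) A y)"
proof (induction p arbitrary: x)
  case (pCons a p)
  have "cinner (poly_op (pCons a p) A x) y = a * cinner x y + cinner (poly_op p A (A x)) y"
    by (simp add: poly_op_pCons cinner_add_left cinner_scaleC_left poly_op_commute)
  also have "\<dots> = a * cinner x y + cinner x (A (poly_op (map_poly cnj p) A y))"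
    by (simp add: pCons.IH selfadjoint)
  finally show ?case
    by (simp add: map_poly_pCons poly_op_pCons cinner_add_right cinner_scaleC_right)
qed (simp add: cinner.zero_left cinner.zero_right)

lemma funpow_poly_op: "(A ^^ k) v = poly_op (monom 1 k) A v"
  by (simp add: poly_op_monom)

text \<open>Describes the spectral measure by its moments, the form in which the Hausdorff theorem
  delivers it; compact support lets polynomials stand for all continuous functions. Positivity of
  \<open>A\<close> puts the support in [0, norm of A].\<close>

definition spectral_rep :: "real measure \<Rightarrow> hardy \<Rightarrow> bool" where
  "spectral_rep M v \<longleftrightarrow> sets M = sets borel \<and> finite_measure M \<and> (AE t in M. t \<in> {0..onorm A}) \<and>
     (\<forall>k. (\<integral>t. t ^ k \<partial>M) = Re (cinner ((A ^^ k) v) v))"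

text \<open>Put X = t / R and Y = 1 - t / R with R the norm of \<open>A\<close>. The numbers <X^j
  Y^l (A) v, v> obey the Hausdorff recurrence because X + Y = 1. They are nonnegative because even
  powers can be absorbed as squares into the vector, which leaves exponents 0 and 1.\<close>

lemma spectral_rep_exists: "\<exists>M. spectral_rep M v"
proof -
  define R where "R = onorm A"
  have R0: "R \<ge> 0" unfolding R_def by (rule onorm_pos_le[OF bounded_linear_A])
  \<comment> \<open>For R = 0 the convention 1 / 0 = 0 gives X = 0 and Y = 1, so the recurrence
    still holds.\<close>
  define X Y where "X = [:0, 1 / R:]" and "Y = [:1, - 1 / R:]"
  define w where "w j l v = Re (cinner (poly_op (cpoly (X ^ j * Y ^ l)) A v) v)" for j l v
  have XY: "X + Y = 1" by (simp add: X_def Y_def)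
  have lin: "Re (cinner (poly_op (cpoly (p + q)) A v) v) =
      Re (cinner (poly_op (cpoly p) A v) v) + Re (cinner (poly_op (cpoly q) A v) v)" for p q v
    by (simp add: cpoly_add poly_op_add cinner_add_left)
  have rec: "w j l v = w (Suc j) l v + w j (Suc l) v" for j l v
  proof -
    have "X ^ j * Y ^ l = X ^ j * Y ^ l * (X + Y)" by (simp only: XY mult_1_right)
    also have "\<dots> = X ^ Suc j * Y ^ l + X ^ j * Y ^ Suc l" by (simp add: algebra_simps)
    finally show ?thesis unfolding w_def using lin by metis
  qed
  have sq: "Re (cinner (poly_op (cpoly (q * q * p)) A v) v) =
      Re (cinner (poly_op (cpoly p) A (poly_op (cpoly q) A v)) (poly_op (cpoly q) A v))" for p q v
  proof -
    have "poly_op (cpoly (q * q * p)) A v = poly_op (cpoly q) A (poly_op (cpoly p) A (poly_op (cpoly q) A v))"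
      by (simp only: cpoly_mult poly_op_mult[symmetric] mult_ac)
    then show ?thesis by (simp add: poly_op_adjoint[of "cpoly q"])
  qed
  have w10: "0 \<le> w 1 0 v" for v
    using nonneg[of v] R0
    by (simp add: w_def X_def map_poly_pCons poly_op_pCons scaleC cinner_scaleC_left)
  have w01: "0 \<le> w 0 1 v" for v
  proof (cases "R = 0")
    case True
    then show ?thesis using cinner_self(2)[of v]
      by (simp add: w_def Y_def map_poly_pCons poly_op_pCons zero)
  next
    case False
    have "Re (cinner (A v) v) \<le> norm (A v) * norm v"
      using norm_cinner_le[of "A v" v] complex_Re_le_cmod order_trans by blast
    also have "\<dots> \<le> R * norm v * norm v"
      unfolding R_def by (intro mult_right_mono onorm[OF bounded_linear_A]) simp
    finally have "Re (cinner (A v) v) / R \<le> (norm v)\<^sup>2"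
      using False R0 by (simp add: field_simps power2_eq_square)
    then show ?thesis
      by (simp add: w_def Y_def map_poly_pCons poly_op_pCons cinner_add_left scaleC cinner_scaleC_left
          cinner_self_norm cinner.minus_left cinner.diff_left neg)
  qed
  have w00: "0 \<le> w 0 0 v" for v
    using cinner_self(2)[of v] by (simp add: w_def)
  have w11: "0 \<le> w 1 1 v" for v
  proof -
    \<comment> \<open>Multiplying by X + Y = 1 exhibits X Y as X^2 Y + Y^2 X, which reduces its
      positivity to that of X and of Y.\<close>
    have "X * Y = X * Y * (X + Y)" by (simp only: XY mult_1_right)
    also have "\<dots> = X * X * Y + Y * Y * X" by (simp add: algebra_simps)
    finally have "w 1 1 v = Re (cinner (poly_op (cpoly (X * X * Y)) A v) v) + Re (cinner (poly_op (cpoly (Y * Y * X)) A v) v)"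
      unfolding w_def using lin[of "X * X * Y" "Y * Y * X" v] by simp
    then show ?thesis using w01 w10 unfolding sq w_def by simp
  qed
  have wpos: "0 \<le> w j l v" for j l v
  proof -
    have pw: "Z ^ j = Z ^ (j div 2) * Z ^ (j div 2) * Z ^ (j mod 2)" for Z :: "real poly" and j
      unfolding power_add[symmetric] mult_2[symmetric] by simp
    have "X ^ j * Y ^ l = (X ^ (j div 2) * Y ^ (l div 2)) * (X ^ (j div 2) * Y ^ (l div 2)) * (X ^ (j mod 2) * Y ^ (l mod 2))"
      by (subst (1) pw[of X j], subst (1) pw[of Y l]) (simp only: mult_ac)
    then have "w j l v = w (j mod 2) (l mod 2) (poly_op (cpoly (X ^ (j div 2) * Y ^ (l div 2))) A v)"
      unfolding w_def by (simp only: sq)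
    moreover have "j mod 2 = 0 \<or> j mod 2 = 1" "l mod 2 = 0 \<or> l mod 2 = 1" by auto
    ultimately show ?thesis using w00 w01 w10 w11 by metis
  qed
  obtain M0 where M0: "sets M0 = sets borel" "finite_measure M0" "AE t in M0. t \<in> {0..1}"
     "\<And>k. (\<integral>t. t ^ k \<partial>M0) = w k 0 v"
    using hausdorff_moment[of "\<lambda>j l. w j l v", OF rec wpos] by blast
  interpret M0: finite_measure M0 by fact
  note [measurable_cong] = M0(1)
  have "spectral_rep (distr M0 borel (\<lambda>t. R * t)) v"
    unfolding spectral_rep_def
  proof (intro conjI allI)
    show "finite_measure (distr M0 borel ((*) R))"
      by (rule M0.finite_measure_distr) simp
    show "AE t in distr M0 borel ((*) R). t \<in> {0..onorm A}"
    proof -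
      have "AE t in M0. R * t \<in> {0..R}"
        using M0(3) by eventually_elim (use R0 in \<open>auto simp: mult_left_le\<close>)
      then show ?thesis
        by (subst AE_distr_iff) (simp_all add: R_def[symmetric] del: atLeastAtMost_iff)
    qed
    fix k
    have "(\<integral>t. t ^ k \<partial>distr M0 borel ((*) R)) = R ^ k * w k 0 v"
      by (subst integral_distr) (auto simp: power_mult_distrib M0(4))
    also have "\<dots> = Re (cinner ((A ^^ k) v) v)"
    proof (cases "R = 0")
      case True
      then have A0: "A x = 0" for x using onorm[OF bounded_linear_A, of x] by (simp add: R_def)
      show ?thesis
        by (cases k) (use True A0 in \<open>auto simp: w_def\<close>)
    next
      case False
      have "smult (R ^ k) (X ^ k) = monom 1 k"
        using False by (simp add: X_def monom_altdef smult_power[symmetric] power_mult_distrib[symmetric])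
      have "of_real (R ^ k) *\<^sub>C poly_op (cpoly (X ^ k)) A v = poly_op (cpoly (smult (R ^ k) (X ^ k))) A v"
        by (simp add: cpoly_smult poly_op_smult)
      also have "\<dots> = (A ^^ k) v"
        by (simp add: \<open>smult (R ^ k) (X ^ k) = monom 1 k\<close> map_poly_monom poly_op_monom)
      finally have "(A ^^ k) v = of_real (R ^ k) *\<^sub>C poly_op (cpoly (X ^ k)) A v" by simp
      then show ?thesis by (simp add: w_def cinner_scaleC_left flip: of_real_power)
    qed
    finally show "(\<integral>t. t ^ k \<partial>distr M0 borel ((*) R)) = Re (cinner ((A ^^ k) v) v)" .
  qed simp
  then show ?thesis by blast
qed

lemma cinner_funpow_real: "cinner ((A ^^ k) v) v = of_real (Re (cinner ((A ^^ k) v) v))"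
proof -
  have "map_poly cnj (monom 1 k) = (monom 1 k :: complex poly)" by (simp add: map_poly_monom)
  then have "cinner ((A ^^ k) v) v = cinner v ((A ^^ k) v)"
    unfolding funpow_poly_op by (simp add: poly_op_adjoint)
  then have "cinner ((A ^^ k) v) v = cnj (cinner ((A ^^ k) v) v)"
    by (subst (asm) cinner_commute) simp
  then show ?thesis by (simp add: complex_eq_iff)
qed

context
  fixes M v assumes rep: "spectral_rep M v"
begin

lemma sets_M: "sets M = sets borel"
  and finite_M: "finite_measure M"
  and supp_M: "AE t in M. t \<in> {0..onorm A}"
  and moment_M: "(\<integral>t. t ^ k \<partial>M) = Re (cinner ((A ^^ k) v) v)"
  using rep by (auto simp: spectral_rep_def)

lemma space_M: "space M = UNIV"
  using sets_eq_imp_space_eq[OF sets_M] by simp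

lemma integrable_continuous:
  fixes g :: "real \<Rightarrow> 'b::{banach, second_countable_topology}"
  assumes "continuous_on UNIV g"
  shows "integrable M g"
  by (rule continuous_integrable_compact[OF finite_M sets_M compact_Icc supp_M assms])

lemma integral_poly: "(\<integral>t. poly p (of_real t) \<partial>M) = cinner (poly_op p A v) v"
proof -
  have "(\<integral>t. poly p (of_real t) \<partial>M) = (\<integral>t. (\<Sum>i\<le>degree p. coeff p i * of_real (t ^ i)) \<partial>M)"
    by (simp add: poly_altdef)
  also have "\<dots> = (\<Sum>i\<le>degree p. \<integral>t. coeff p i * of_real (t ^ i) \<partial>M)"
    by (rule Bochner_Integration.integral_sum) (intro integrable_continuous continuous_intros)
  also have "\<dots> = (\<Sum>i\<le>degree p. coeff p i * cinner ((A ^^ i) v) v)"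
  proof (rule sum.cong[OF refl])
    fix i
    have "(\<integral>t. coeff p i * of_real (t ^ i) \<partial>M) = coeff p i * of_real (\<integral>t. t ^ i \<partial>M)"
      by (simp only: integral_mult_right_zero integral_complex_of_real)
    then show "(\<integral>t. coeff p i * of_real (t ^ i) \<partial>M) = coeff p i * cinner ((A ^^ i) v) v"
      using cinner_funpow_real[of i v] by (simp only: moment_M)
  qed
  also have "\<dots> = cinner (poly_op p A v) v"
    by (simp add: poly_op_def cinner.sum_left cinner_scaleC_left)
  finally show ?thesis .
qed

text \<open>The isometry from polynomials in L2(M) onto the vectors p(A) v, on which the whole
  functional calculus rests: the integrand is the value of the conjugate polynomial times p.\<close>

lemma integral_norm_poly:
  "(\<integral>t. (cmod (poly p (of_real t)))\<^sup>2 \<partial>M) = (norm (poly_op p A v))\<^sup>2"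
proof -
  have "complex_of_real (\<integral>t. (cmod (poly p (of_real t)))\<^sup>2 \<partial>M) = (\<integral>t. of_real ((cmod (poly p (of_real t)))\<^sup>2) \<partial>M)"
    by (simp only: integral_complex_of_real)
  also have "\<dots> = (\<integral>t. poly (map_poly cnj p * p) (of_real t) \<partial>M)"
    unfolding complex_norm_square by (simp add: poly_map_poly_cnj mult.commute)
  also have "\<dots> = cinner (poly_op (map_poly cnj p) A (poly_op p A v)) v"
    by (simp only: integral_poly poly_op_mult)
  also have "\<dots> = cinner (poly_op p A v) (poly_op p A v)"
  proof -
    have "map_poly cnj (map_poly cnj p) = p" by (rule poly_eqI) (simp add: coeff_map_poly)
    then show ?thesis by (simp add: poly_op_adjoint[of "map_poly cnj p"])
  qed
  also have "\<dots> = complex_of_real ((norm (poly_op p A v))\<^sup>2)" by (rule cinner_self_norm)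
  finally show ?thesis by (simp only: of_real_eq_iff)
qed

lemma nn_integral_norm_poly:
  "(\<integral>\<^sup>+t. ennreal ((cmod (poly p (of_real t)))\<^sup>2) \<partial>M) = ennreal ((norm (poly_op p A v))\<^sup>2)"
  unfolding integral_norm_poly[symmetric]
  by (intro nn_integral_eq_integral integrable_continuous continuous_intros) auto

lemma measure_M: "measure M UNIV = (norm v)\<^sup>2"
  using integral_norm_poly[of 1] by (simp add: space_M)

end

text \<open>The isometry and the support of the measure bound p(A) by the size of p on
  [0, norm of A], without reference to the spectrum.\<close>

lemma norm_poly_op_le:
  assumes "\<And>t. t \<in> {0..onorm A} \<Longrightarrow> cmod (poly p (of_real t)) \<le> C"
  shows "norm (poly_op p A v) \<le> C * norm v"
proof -
  obtain M where M: "spectral_rep M v" using spectral_rep_exists by blast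
  interpret finite_measure M by (rule finite_M[OF M])
  have C0: "C \<ge> 0"
    by (rule order_trans[OF norm_ge_zero assms[of 0]]) (simp add: onorm_pos_le[OF bounded_linear_A])
  have "(norm (poly_op p A v))\<^sup>2 = (\<integral>t. (cmod (poly p (of_real t)))\<^sup>2 \<partial>M)"
    by (rule integral_norm_poly[OF M, symmetric])
  also have "\<dots> \<le> (\<integral>t. C\<^sup>2 \<partial>M)"
  proof (rule integral_mono_AE)
    show "AE t in M. (cmod (poly p (of_real t)))\<^sup>2 \<le> C\<^sup>2"
      using supp_M[OF M] by eventually_elim (intro power_mono assms norm_ge_zero)
  qed (intro integrable_continuous[OF M] continuous_intros)+
  also have "\<dots> = (C * norm v)\<^sup>2"
    by (simp add: space_M[OF M] measure_M[OF M] power_mult_distrib mult.commute)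
  finally show ?thesis by (rule power2_le_imp_le) (simp add: C0)
qed

section \<open>Continuous functional calculus and uniqueness of the spectral measure\<close>

lemma poly_op_uniform_limit:
  assumes lim: "uniform_limit {0..onorm A} (\<lambda>n t. poly (p n) (of_real t)) f sequentially"
  shows "convergent (\<lambda>n. poly_op (p n) A v)"
    and "uniform_limit {0..onorm A} (\<lambda>n t. poly (q n) (of_real t)) f sequentially \<Longrightarrow>
      (\<lambda>n. poly_op (p n) A v - poly_op (q n) A v) \<longlonglongrightarrow> 0"
proof -
  have key: "norm (poly_op p A v - poly_op q A v) \<le> 2 * e * norm v"
    if "\<And>t. t \<in> {0..onorm A} \<Longrightarrow> dist (poly p (of_real t)) (f t) < e"
      "\<And>t. t \<in> {0..onorm A} \<Longrightarrow> dist (poly q (of_real t)) (f t) < e" for p q e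
  proof -
    have "cmod (poly (p - q) (of_real t)) \<le> 2 * e" if t: "t \<in> {0..onorm A}" for t
    proof -
      have "dist (poly p (of_real t)) (poly q (of_real t)) < 2 * e"
        using dist_triangle2[of "poly p (of_real t)" "poly q (of_real t)" "f t"] \<open>\<And>t. t \<in> {0..onorm A} \<Longrightarrow> dist (poly p (of_real t)) (f t) < e\<close>[OF t]
          \<open>\<And>t. t \<in> {0..onorm A} \<Longrightarrow> dist (poly q (of_real t)) (f t) < e\<close>[OF t] by linarith
      then show ?thesis by (simp add: dist_norm)
    qed
    from norm_poly_op_le[OF this] show ?thesis by (simp add: poly_op_diff)
  qed
  have small: "\<exists>e>0. 2 * e * norm v < d" if "d > 0" for d
    using that by (intro exI[of _ "d / (2 * (norm v + 1))"]) (auto simp: field_simps add_pos_nonneg)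
  have "Cauchy (\<lambda>n. poly_op (p n) A v)"
  proof (rule metric_CauchyI)
    fix d :: real assume "d > 0"
    then obtain e where e: "e > 0" "2 * e * norm v < d" using small by blast
    obtain N where N: "\<And>n t. n \<ge> N \<Longrightarrow> t \<in> {0..onorm A} \<Longrightarrow> dist (poly (p n) (of_real t)) (f t) < e"
      using uniform_limitD[OF lim e(1)] unfolding eventually_sequentially by blast
    show "\<exists>N. \<forall>m\<ge>N. \<forall>n\<ge>N. dist (poly_op (p m) A v) (poly_op (p n) A v) < d"
      using key[OF N N] e(2) by (intro exI[of _ N]) (auto simp: dist_norm intro: le_less_trans)
  qed
  then show "convergent (\<lambda>n. poly_op (p n) A v)" by (simp add: Cauchy_convergent_iff)
  assume limq: "uniform_limit {0..onorm A} (\<lambda>n t. poly (q n) (of_real t)) f sequentially"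
  show "(\<lambda>n. poly_op (p n) A v - poly_op (q n) A v) \<longlonglongrightarrow> 0"
  proof (rule tendstoI)
    fix d :: real assume "d > 0"
    then obtain e where e: "e > 0" "2 * e * norm v < d" using small by blast
    show "\<forall>\<^sub>F n in sequentially. dist (poly_op (p n) A v - poly_op (q n) A v) 0 < d"
      using uniform_limitD[OF lim e(1)] uniform_limitD[OF limq e(1)]
    proof eventually_elim
      case (elim n)
      then show ?case using key[of "p n" e "q n"] e(2) by auto
    qed
  qed
qed

lemma cinner_cont_calc:
  assumes f: "continuous_on UNIV f" and M: "spectral_rep M v"
  shows "cinner (cont_calc f A v) v = (\<integral>t. f t \<partial>M)"
proof -
  let ?I = "{- onorm A..onorm A}"
  \<comment> \<open>\<open>cont_calc\<close> asks for approximation on the symmetric interval; since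
    \<open>A\<close> is positive, the right half already controls the operators.\<close>
  have sub: "{0..onorm A} \<subseteq> ?I" using onorm_pos_le[OF bounded_linear_A] by auto
  obtain p where p: "uniform_limit ?I (\<lambda>n t. poly (p n) (of_real t)) f sequentially"
    using Weierstrass_poly_complex[OF continuous_on_subset[OF f]] by blast
  note p' = uniform_limit_on_subset[OF p sub]
  obtain w where w: "(\<lambda>n. poly_op (p n) A v) \<longlonglongrightarrow> w"
    using poly_op_uniform_limit(1)[OF p'] by (auto simp: convergent_def)
  have "cont_calc f A v = w"
    unfolding cont_calc_def
  proof (rule the_equality)
    fix w' assume "\<exists>p. uniform_limit ?I (\<lambda>n t. poly (p n) (of_real t)) f sequentially \<and> (\<lambda>n. poly_op (p n) A v) \<longlonglongrightarrow> w'"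
    then obtain q where q: "uniform_limit ?I (\<lambda>n t. poly (q n) (of_real t)) f sequentially" "(\<lambda>n. poly_op (q n) A v) \<longlonglongrightarrow> w'"
      by blast
    from LIMSEQ_unique[OF tendsto_diff[OF w q(2)] poly_op_uniform_limit(2)[OF p' uniform_limit_on_subset[OF q(1) sub]]]
    show "w' = w" by simp
  qed (use p w in blast)
  moreover have "(\<lambda>n. cinner (poly_op (p n) A v) v) \<longlonglongrightarrow> cinner w v"
    by (intro cinner.tendsto w tendsto_const)
  moreover have "(\<lambda>n. cinner (poly_op (p n) A v) v) \<longlonglongrightarrow> (\<integral>t. f t \<partial>M)"
  proof (rule tendstoI)
    interpret finite_measure M by (rule finite_M[OF M])
    fix d :: real assume d: "d > 0"
    define e where "e = d / (2 * (measure M (space M) + 1))"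
    have e: "e > 0" "e * measure M (space M) < d"
      using d measure_nonneg[of M "space M"] by (auto simp: e_def field_simps add_pos_nonneg)
    show "\<forall>\<^sub>F n in sequentially. dist (cinner (poly_op (p n) A v) v) (\<integral>t. f t \<partial>M) < d"
      using uniform_limitD[OF p' e(1)]
    proof eventually_elim
      case (elim n)
      have ic: "integrable M f" "integrable M (\<lambda>t. poly (p n) (of_real t))"
        by (intro integrable_continuous[OF M] f continuous_intros)+
      have "dist (cinner (poly_op (p n) A v) v) (\<integral>t. f t \<partial>M) = cmod (\<integral>t. poly (p n) (of_real t) - f t \<partial>M)"
        using ic by (simp add: integral_poly[OF M, symmetric] dist_norm)
      also have "\<dots> \<le> (\<integral>t. cmod (poly (p n) (of_real t) - f t) \<partial>M)" by (rule integral_norm_bound)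
      also have "\<dots> \<le> (\<integral>t. e \<partial>M)"
      proof (rule integral_mono_AE)
        show "AE t in M. cmod (poly (p n) (of_real t) - f t) \<le> e"
          using supp_M[OF M] by eventually_elim (use elim in \<open>auto simp: dist_norm intro: less_imp_le\<close>)
      qed (use ic in simp_all)
      also have "\<dots> < d" using e(2) by (simp add: mult.commute)
      finally show ?case .
    qed
  qed
  ultimately show ?thesis by (simp add: LIMSEQ_unique)
qed

text \<open>Turns the definite description into a criterion on moments. Uniqueness holds because the
  integrals of continuous functions are prescribed by \<open>cont_calc\<close>.\<close>

lemma spectral_measure_eq:
  assumes M: "spectral_rep M v"
  shows "spectral_measure A v = M"
  unfolding spectral_measure_def
proof (rule the_equality)
  show "sets M = sets borel \<and> finite_measure M \<and>
     (\<forall>f :: real \<Rightarrow> complex. continuous_on UNIV f \<longrightarrow>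
        integrable M f \<and> (\<integral>t. f t \<partial>M) = cinner (cont_calc f A v) v)"
    using M integrable_continuous[OF M] cinner_cont_calc[OF _ M] by (auto simp: spectral_rep_def)
  fix N assume N: "sets N = sets borel \<and> finite_measure N \<and>
     (\<forall>f :: real \<Rightarrow> complex. continuous_on UNIV f \<longrightarrow>
        integrable N f \<and> (\<integral>t. f t \<partial>N) = cinner (cont_calc f A v) v)"
  show "N = M"
  proof (rule measure_eqI_continuous)
    fix f :: "real \<Rightarrow> real" assume f: "continuous_on UNIV f"
    have c: "continuous_on UNIV (\<lambda>t. complex_of_real (f t))"
      by (intro continuous_intros f)
    have "(\<integral>t. complex_of_real (f t) \<partial>N) = (\<integral>t. complex_of_real (f t) \<partial>M)"
      using N c cinner_cont_calc[OF c M] by metis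
    then show "(\<integral>t. f t \<partial>N) = (\<integral>t. f t \<partial>M)"
      by (simp only: integral_complex_of_real of_real_eq_iff)
  qed (use N finite_M[OF M] sets_M[OF M] in auto)
qed

lemma spectral_rep_spectral_measure: "spectral_rep (spectral_measure A v) v"
  using spectral_rep_exists spectral_measure_eq by metis

end

section \<open>Borel functional calculus\<close>

lemma ennreal_tendsto_0_le:
  fixes a b :: "nat \<Rightarrow> ennreal"
  assumes "\<And>n. a n \<le> b n" "b \<longlonglongrightarrow> 0"
  shows "a \<longlonglongrightarrow> 0"
  by (rule tendsto_sandwich[of "\<lambda>_. 0" a sequentially b]) (use assms in auto)

lemma tendsto_0_if_ennreal_norm_square_le:
  fixes a :: "nat \<Rightarrow> 'a::real_normed_vector"
  assumes le: "\<And>n. ennreal ((norm (a n))\<^sup>2) \<le> b n" and b: "b \<longlonglongrightarrow> 0"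
  shows "a \<longlonglongrightarrow> 0"
proof (rule tendstoI)
  fix e :: real assume e: "e > 0"
  have "\<forall>\<^sub>F n in sequentially. b n < ennreal (e\<^sup>2)"
    using b e by (intro order_tendstoD) auto
  then show "\<forall>\<^sub>F n in sequentially. dist (a n) 0 < e"
  proof eventually_elim
    case (elim n)
    then have "ennreal ((norm (a n))\<^sup>2) < ennreal (e\<^sup>2)" using le[of n] by (rule le_less_trans[rotated])
    then have "(norm (a n))\<^sup>2 < e\<^sup>2" by (simp add: ennreal_less_iff)
    then show ?case using e by (simp add: power2_less_imp_less)
  qed
qed

lemma nn_integral_norm_square_triangle:
  fixes f g h :: "'a \<Rightarrow> complex"
  assumes [measurable]: "f \<in> borel_measurable M" "g \<in> borel_measurable M" "h \<in> borel_measurable M"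
  shows "(\<integral>\<^sup>+x. ennreal ((cmod (f x - h x))\<^sup>2) \<partial>M) \<le>
    2 * (\<integral>\<^sup>+x. ennreal ((cmod (f x - g x))\<^sup>2) \<partial>M) + 2 * (\<integral>\<^sup>+x. ennreal ((cmod (h x - g x))\<^sup>2) \<partial>M)"
proof -
  have le: "(cmod (a - c))\<^sup>2 \<le> 2 * (cmod (a - b))\<^sup>2 + 2 * (cmod (c - b))\<^sup>2" for a b c
  proof -
    have "cmod (a - c) \<le> cmod (a - b) + cmod (c - b)"
      using norm_triangle_ineq4[of "a - b" "c - b"] by simp
    then have "(cmod (a - c))\<^sup>2 \<le> (cmod (a - b) + cmod (c - b))\<^sup>2" by (intro power_mono) auto
    also have "\<dots> \<le> 2 * (cmod (a - b))\<^sup>2 + 2 * (cmod (c - b))\<^sup>2"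
      using zero_le_power2[of "cmod (a - b) - cmod (c - b)"] by (simp add: power2_diff power2_sum)
    finally show ?thesis .
  qed
  have "(\<integral>\<^sup>+x. ennreal ((cmod (f x - h x))\<^sup>2) \<partial>M) \<le>
      (\<integral>\<^sup>+x. 2 * ennreal ((cmod (f x - g x))\<^sup>2) + 2 * ennreal ((cmod (h x - g x))\<^sup>2) \<partial>M)"
    by (intro nn_integral_mono) (use le in \<open>auto simp flip: ennreal_plus ennreal_mult simp: ennreal_leI
        ennreal_mult[of 2, symmetric, simplified]\<close>)
  also have "\<dots> = 2 * (\<integral>\<^sup>+x. ennreal ((cmod (f x - g x))\<^sup>2) \<partial>M) + 2 * (\<integral>\<^sup>+x. ennreal ((cmod (h x - g x))\<^sup>2) \<partial>M)"
    by (simp add: nn_integral_add nn_integral_cmult)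
  finally show ?thesis .
qed

lemma borel_measurable_poly [measurable]:
  "poly r \<in> borel_measurable (borel :: real measure)"
  "(\<lambda>t::real. poly p (complex_of_real t)) \<in> borel_measurable borel"
  by (intro borel_measurable_continuous_onI continuous_intros)+

lemma real_L2_poly_sequence:
  fixes f :: "real \<Rightarrow> real"
  assumes M: "finite_measure M" "sets M = sets borel" "AE t in M. t \<in> {a..b}"
    and f: "f \<in> borel_measurable borel" "integrable M (\<lambda>t. (f t)\<^sup>2)"
  obtains r :: "nat \<Rightarrow> real poly" where "(\<lambda>n. \<integral>\<^sup>+t. ennreal ((poly (r n) t - f t)\<^sup>2) \<partial>M) \<longlonglongrightarrow> 0"
proof -
  note [measurable_cong] = M(2)
  note [measurable] = f(1)
  have "\<exists>r. (\<integral>\<^sup>+t. ennreal ((poly r t - f t)\<^sup>2) \<partial>M) \<le> ennreal (1 / Suc n)" for n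
  proof -
    obtain g where g: "real_polynomial_function g" "(\<integral>t. (f t - g t)\<^sup>2 \<partial>M) < 1 / Suc n"
      using real_polynomial_L2_dense[OF M(1,2) compact_Icc M(3) f, of "1 / Suc n"] by auto
    obtain r where r: "g = poly r" using real_polynomial_function_poly[OF g(1)] .
    have "integrable M (\<lambda>t. (f t - g t)\<^sup>2)"
      unfolding r
      by (intro square_integrable_diff f continuous_square_integrable_compact[OF M(1,2) compact_Icc M(3)] continuous_intros)
        measurable
    then have "(\<integral>\<^sup>+t. ennreal ((f t - g t)\<^sup>2) \<partial>M) = ennreal (\<integral>t. (f t - g t)\<^sup>2 \<partial>M)"
      by (intro nn_integral_eq_integral) auto
    then show ?thesis
      using g(2) by (intro exI[of _ r]) (auto simp: r power2_commute intro!: ennreal_leI)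
  qed
  then obtain r where r: "\<And>n. (\<integral>\<^sup>+t. ennreal ((poly (r n) t - f t)\<^sup>2) \<partial>M) \<le> ennreal (1 / Suc n)" by metis
  have "(\<lambda>n. ennreal (1 / Suc n)) \<longlonglongrightarrow> ennreal 0"
    using LIMSEQ_inverse_real_of_nat by (intro tendsto_ennrealI) (simp add: inverse_eq_divide)
  then have "(\<lambda>n. ennreal (1 / Suc n)) \<longlonglongrightarrow> 0" by simp
  from ennreal_tendsto_0_le[OF r this]
  have "(\<lambda>n. \<integral>\<^sup>+t. ennreal ((poly (r n) t - f t)\<^sup>2) \<partial>M) \<longlonglongrightarrow> 0" .
  then show thesis by (rule that)
qed

lemma L2_fun_integrable:
  assumes M: "finite_measure M" "sets M = sets borel" and f: "L2_fun M f"
  shows "integrable M f" "integrable M (\<lambda>t. (Re (f t))\<^sup>2)" "integrable M (\<lambda>t. (Im (f t))\<^sup>2)"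
proof -
  interpret finite_measure M by fact
  note [measurable_cong] = M(2)
  have [measurable]: "f \<in> borel_measurable borel" and i: "integrable M (\<lambda>t. (cmod (f t))\<^sup>2)"
    using f by (auto simp: L2_fun_def)
  show "integrable M f"
  proof (rule Bochner_Integration.integrable_bound)
    show "integrable M (\<lambda>t. 1 * (cmod (f t))\<^sup>2 + 1 / 1)" using i by simp
    show "AE t in M. norm (f t) \<le> norm (1 * (cmod (f t))\<^sup>2 + 1 / 1)"
      using square_le_add_squares[of 1] by (intro AE_I2) simp
  qed measurable
  show "integrable M (\<lambda>t. (Re (f t))\<^sup>2)" "integrable M (\<lambda>t. (Im (f t))\<^sup>2)"
    by (rule Bochner_Integration.integrable_bound[OF i]; simp add: cmod_power2)+
qed

lemma complex_L2_poly_sequence: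
  fixes f :: "real \<Rightarrow> complex"
  assumes M: "finite_measure M" "sets M = sets borel" "AE t in M. t \<in> {a..b}"
    and f: "L2_fun M f"
  obtains p :: "nat \<Rightarrow> complex poly"
  where "(\<lambda>n. \<integral>\<^sup>+t. ennreal ((cmod (poly (p n) (of_real t) - f t))\<^sup>2) \<partial>M) \<longlonglongrightarrow> 0"
proof -
  note [measurable_cong] = M(2)
  note i = L2_fun_integrable(2,3)[OF M(1,2) f]
  have [measurable]: "f \<in> borel_measurable borel" using f by (simp add: L2_fun_def)
  obtain r where r: "(\<lambda>n. \<integral>\<^sup>+t. ennreal ((poly (r n) t - Re (f t))\<^sup>2) \<partial>M) \<longlonglongrightarrow> 0"
    by (rule real_L2_poly_sequence[OF M _ i(1)]) auto
  obtain s where s: "(\<lambda>n. \<integral>\<^sup>+t. ennreal ((poly (s n) t - Im (f t))\<^sup>2) \<partial>M) \<longlonglongrightarrow> 0"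
    by (rule real_L2_poly_sequence[OF M _ i(2)]) auto
  have "(\<integral>\<^sup>+t. ennreal ((cmod (poly (cpoly (r n) + smult \<i> (cpoly (s n))) (of_real t) - f t))\<^sup>2) \<partial>M) =
      (\<integral>\<^sup>+t. ennreal ((poly (r n) t - Re (f t))\<^sup>2) \<partial>M) + (\<integral>\<^sup>+t. ennreal ((poly (s n) t - Im (f t))\<^sup>2) \<partial>M)" for n
    by (subst nn_integral_add[symmetric]) (auto simp: cmod_power2 ennreal_plus)
  then show thesis
    using tendsto_add[OF r s] that[of "\<lambda>n. cpoly (r n) + smult \<i> (cpoly (s n))"] by simp
qed

lemma L2_fun_bounded:
  assumes M: "finite_measure M" "sets M = sets borel" and f: "f \<in> borel_measurable borel" "AE t in M. cmod (f t) \<le> C"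
  shows "L2_fun M f"
proof -
  interpret finite_measure M by fact
  note [measurable_cong] = M(2)
  note [measurable] = f(1)
  have "AE t in M. norm ((cmod (f t))\<^sup>2) \<le> C\<^sup>2"
    using f(2) by eventually_elim (auto intro: power_mono)
  then have "integrable M (\<lambda>t. (cmod (f t))\<^sup>2)"
    by (rule integrable_const_bound) measurable
  then show ?thesis using f(1) by (simp add: L2_fun_def)
qed

section \<open>Borel functions of a positive operator\<close>

context positive_operator
begin

lemmas spectral_sets = sets_M[OF spectral_rep_spectral_measure]
lemmas spectral_finite = finite_M[OF spectral_rep_spectral_measure]
lemmas spectral_support = supp_M[OF spectral_rep_spectral_measure]

lemma norm_poly_op_diff_le:
  assumes [measurable]: "f \<in> borel_measurable borel"
  shows "ennreal ((norm (poly_op p A v - poly_op q A v))\<^sup>2) \<le>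
    2 * (\<integral>\<^sup>+t. ennreal ((cmod (poly p (of_real t) - f t))\<^sup>2) \<partial>spectral_measure A v) +
    2 * (\<integral>\<^sup>+t. ennreal ((cmod (poly q (of_real t) - f t))\<^sup>2) \<partial>spectral_measure A v)"
proof -
  note [measurable_cong] = spectral_sets[of v]
  have "ennreal ((norm (poly_op p A v - poly_op q A v))\<^sup>2) =
      (\<integral>\<^sup>+t. ennreal ((cmod (poly p (of_real t) - poly q (of_real t)))\<^sup>2) \<partial>spectral_measure A v)"
    using nn_integral_norm_poly[OF spectral_rep_spectral_measure[of v], where p="p - q"] by (simp add: poly_op_diff)
  also have "\<dots> \<le> 2 * (\<integral>\<^sup>+t. ennreal ((cmod (poly p (of_real t) - f t))\<^sup>2) \<partial>spectral_measure A v) +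
    2 * (\<integral>\<^sup>+t. ennreal ((cmod (poly q (of_real t) - f t))\<^sup>2) \<partial>spectral_measure A v)"
    by (rule nn_integral_norm_square_triangle) measurable
  finally show ?thesis .
qed

text \<open>By the isometry, two polynomials close to \<open>f\<close> in L2 give close vectors.
  This yields both the existence and the uniqueness of the limit that \<open>borel_calc\<close>
  describes.\<close>

lemma borel_calc_tendsto:
  assumes f: "f \<in> borel_measurable borel"
    and lim: "(\<lambda>n. \<integral>\<^sup>+t. ennreal ((cmod (poly (p n) (of_real t) - f t))\<^sup>2) \<partial>spectral_measure A v) \<longlonglongrightarrow> 0"
  shows "(\<lambda>n. poly_op (p n) A v) \<longlonglongrightarrow> borel_calc f A v"
proof -
  define N where "N p = (\<integral>\<^sup>+t. ennreal ((cmod (poly p (of_real t) - f t))\<^sup>2) \<partial>spectral_measure A v)" for p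
  have le: "ennreal ((norm (poly_op p A v - poly_op q A v))\<^sup>2) \<le> 2 * N p + 2 * N q" for p q
    unfolding N_def by (rule norm_poly_op_diff_le[OF f])
  have limN: "(\<lambda>n. N (p n)) \<longlonglongrightarrow> 0" unfolding N_def by (rule lim)
  have uniq: "(\<lambda>n. poly_op (p n) A v - poly_op (q n) A v) \<longlonglongrightarrow> 0" if "(\<lambda>n. N (q n)) \<longlonglongrightarrow> 0" for q
  proof (rule tendsto_0_if_ennreal_norm_square_le[OF le])
    have "(\<lambda>n. 2 * N (p n) + 2 * N (q n)) \<longlonglongrightarrow> 2 * 0 + 2 * 0"
      by (intro tendsto_add ennreal_tendsto_cmult limN that) auto
    then show "(\<lambda>n. 2 * N (p n) + 2 * N (q n)) \<longlonglongrightarrow> 0" by simp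
  qed
  have "Cauchy (\<lambda>n. poly_op (p n) A v)"
  proof (rule metric_CauchyI)
    fix e :: real assume e: "e > 0"
    have "\<forall>\<^sub>F n in sequentially. N (p n) < ennreal (e\<^sup>2 / 4)"
      using limN e by (intro order_tendstoD) auto
    then obtain K where K: "\<And>n. n \<ge> K \<Longrightarrow> N (p n) < ennreal (e\<^sup>2 / 4)"
      by (auto simp: eventually_sequentially)
    show "\<exists>K. \<forall>m\<ge>K. \<forall>n\<ge>K. dist (poly_op (p m) A v) (poly_op (p n) A v) < e"
    proof (intro exI allI impI)
      fix m n assume "m \<ge> K" "n \<ge> K"
      then have "2 * N (p m) + 2 * N (p n) < 2 * ennreal (e\<^sup>2 / 4) + 2 * ennreal (e\<^sup>2 / 4)"
        by (intro add_strict_mono ennreal_mult_strict_left_mono K) auto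
      also have "\<dots> = ennreal (e\<^sup>2)"
      proof -
        have "2 * x + 2 * x = ennreal 4 * x" for x by (simp add: distrib_right[symmetric])
        also have "ennreal 4 * ennreal (e\<^sup>2 / 4) = ennreal (4 * (e\<^sup>2 / 4))"
          by (rule ennreal_mult''[symmetric]) simp
        finally show ?thesis by simp
      qed
      finally have "ennreal ((norm (poly_op (p m) A v - poly_op (p n) A v))\<^sup>2) < ennreal (e\<^sup>2)"
        by (rule le_less_trans[OF le])
      then show "dist (poly_op (p m) A v) (poly_op (p n) A v) < e"
        using e by (simp add: ennreal_less_iff dist_norm power2_less_imp_less)
    qed
  qed
  then obtain w where w: "(\<lambda>n. poly_op (p n) A v) \<longlonglongrightarrow> w"
    by (auto simp: Cauchy_convergent_iff convergent_def)
  have "borel_calc f A v = w"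
    unfolding borel_calc_def
  proof (rule the_equality)
    fix w' assume "\<exists>q. (\<lambda>n. \<integral>\<^sup>+t. ennreal ((cmod (poly (q n) (of_real t) - f t))\<^sup>2) \<partial>spectral_measure A v) \<longlonglongrightarrow> 0 \<and>
      (\<lambda>n. poly_op (q n) A v) \<longlonglongrightarrow> w'"
    then obtain q where q: "(\<lambda>n. N (q n)) \<longlonglongrightarrow> 0" "(\<lambda>n. poly_op (q n) A v) \<longlonglongrightarrow> w'"
      unfolding N_def by blast
    from LIMSEQ_unique[OF tendsto_diff[OF w q(2)] uniq[OF q(1)]] show "w' = w" by simp
  qed (use lim w in blast)
  with w show ?thesis by simp
qed

lemma borel_calc_poly: "borel_calc (\<lambda>t. poly p (of_real t)) A v = poly_op p A v"
proof -
  from borel_calc_tendsto[OF borel_measurable_poly(2)[of p], where p="\<lambda>_. p" and v=v] show ?thesis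
    by (simp add: LIMSEQ_const_iff)
qed

text \<open>In the model formula the symbol is applied to a vector p(A) v, so the relevant measure
  is that of p(A) v and not that of v. It is |p|^2 times the latter, as a comparison of moments
  shows.\<close>

lemma spectral_rep_density:
  "spectral_rep (density (spectral_measure A v) (\<lambda>t. ennreal ((cmod (poly p (of_real t)))\<^sup>2))) (poly_op p A v)"
proof -
  let ?M = "spectral_measure A v"
  let ?d = "\<lambda>t::real. (cmod (poly p (complex_of_real t)))\<^sup>2"
  note rep = spectral_rep_spectral_measure[of v]
  note [measurable_cong] = spectral_sets[of v]
  have "emeasure (density ?M (\<lambda>t. ennreal (?d t))) UNIV = ennreal ((norm (poly_op p A v))\<^sup>2)"
    using nn_integral_norm_poly[OF rep, of p] by (subst emeasure_density) auto
  then have fin: "finite_measure (density ?M (\<lambda>t. ennreal (?d t)))"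
    by (intro finite_measureI) (simp add: space_M[OF rep])
  have "(\<integral>t. t ^ k \<partial>density ?M (\<lambda>t. ennreal (?d t))) = Re (cinner ((A ^^ k) (poly_op p A v)) (poly_op p A v))" for k
  proof -
    have "complex_of_real (\<integral>t. t ^ k \<partial>density ?M (\<lambda>t. ennreal (?d t))) = complex_of_real (\<integral>t. ?d t * t ^ k \<partial>?M)"
      by (subst integral_density) auto
    also have "\<dots> = (\<integral>t. of_real (?d t * t ^ k) \<partial>?M)" by (simp only: integral_complex_of_real)
    also have "\<dots> = (\<integral>t. poly (map_poly cnj p * (monom 1 k * p)) (of_real t) \<partial>?M)"
      unfolding of_real_mult complex_norm_square by (simp add: poly_map_poly_cnj poly_monom mult_ac)
    also have "\<dots> = cinner (poly_op (map_poly cnj p) A ((A ^^ k) (poly_op p A v))) v"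
      by (simp only: integral_poly[OF rep] poly_op_mult funpow_poly_op)
    also have "\<dots> = cinner ((A ^^ k) (poly_op p A v)) (poly_op p A v)"
    proof -
      have "map_poly cnj (map_poly cnj p) = p" by (rule poly_eqI) (simp add: coeff_map_poly)
      then show ?thesis by (simp add: poly_op_adjoint[of "map_poly cnj p"])
    qed
    finally show ?thesis by (metis Re_complex_of_real)
  qed
  moreover have "AE t in density ?M (\<lambda>t. ennreal (?d t)). t \<in> {0..onorm A}"
    using spectral_support[of v] by (subst AE_density) (auto elim: eventually_mono simp del: atLeastAtMost_iff)
  ultimately show ?thesis
    using fin by (simp add: spectral_rep_def spectral_sets)
qed

text \<open>Collapses the nested calculus of the model formula into one function at
  \<open>v\<close>. If q approximates \<Phi> in L2 for the density |p|^2, then t q p approximates t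
  \<Phi> p in L2 for the original measure, since t is bounded by the norm of
  \<open>A\<close>.\<close>

lemma apply_borel_calc_poly_op:
  assumes Phi [measurable]: "\<Phi> \<in> borel_measurable borel" and bd: "AE t in spectral_measure A v. cmod (\<Phi> t) \<le> C"
  shows "A (borel_calc \<Phi> A (poly_op p A v)) = borel_calc (\<lambda>t. of_real t * \<Phi> t * poly p (of_real t)) A v"
proof -
  let ?M = "spectral_measure A v" and ?x = "poly_op p A v"
  let ?d = "\<lambda>t::real. (cmod (poly p (complex_of_real t)))\<^sup>2"
  note [measurable_cong] = spectral_sets[of v]
  have Mx: "spectral_measure A ?x = density ?M (\<lambda>t. ennreal (?d t))"
    by (rule spectral_measure_eq[OF spectral_rep_density])
  have "AE t in spectral_measure A ?x. cmod (\<Phi> t) \<le> C"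
    unfolding Mx using bd by (subst AE_density) (auto elim: eventually_mono)
  then have "L2_fun (spectral_measure A ?x) \<Phi>"
    by (intro L2_fun_bounded spectral_finite spectral_sets Phi)
  then obtain q where q: "(\<lambda>n. \<integral>\<^sup>+t. ennreal ((cmod (poly (q n) (of_real t) - \<Phi> t))\<^sup>2) \<partial>spectral_measure A ?x) \<longlonglongrightarrow> 0"
    by (rule complex_L2_poly_sequence[OF spectral_finite spectral_sets spectral_support])
  have l1: "(\<lambda>n. A (poly_op (q n) A ?x)) \<longlonglongrightarrow> A (borel_calc \<Phi> A ?x)"
    by (intro tendsto borel_calc_tendsto[OF Phi q])
  let ?g = "\<lambda>t. complex_of_real t * \<Phi> t * poly p (of_real t)"
  let ?s = "\<lambda>n. [:0, 1:] * (q n * p)"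
  have le: "(\<integral>\<^sup>+t. ennreal ((cmod (poly (?s n) (of_real t) - ?g t))\<^sup>2) \<partial>?M) \<le>
      ennreal ((onorm A)\<^sup>2) * (\<integral>\<^sup>+t. ennreal ((cmod (poly (q n) (of_real t) - \<Phi> t))\<^sup>2) \<partial>spectral_measure A ?x)" for n
  proof -
    have "(\<integral>\<^sup>+t. ennreal ((cmod (poly (?s n) (of_real t) - ?g t))\<^sup>2) \<partial>?M) \<le>
      (\<integral>\<^sup>+t. ennreal ((onorm A)\<^sup>2) * (ennreal (?d t) * ennreal ((cmod (poly (q n) (of_real t) - \<Phi> t))\<^sup>2)) \<partial>?M)"
    proof (rule nn_integral_mono_AE)
      show "AE t in ?M. ennreal ((cmod (poly (?s n) (of_real t) - ?g t))\<^sup>2) \<le>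
          ennreal ((onorm A)\<^sup>2) * (ennreal (?d t) * ennreal ((cmod (poly (q n) (of_real t) - \<Phi> t))\<^sup>2))"
        using spectral_support
      proof eventually_elim
        case (elim t)
        have "poly (?s n) (of_real t) - ?g t = of_real t * (poly p (of_real t) * (poly (q n) (of_real t) - \<Phi> t))"
          by (simp add: algebra_simps)
        then have "(cmod (poly (?s n) (of_real t) - ?g t))\<^sup>2 = t\<^sup>2 * (?d t * (cmod (poly (q n) (of_real t) - \<Phi> t))\<^sup>2)"
          by (simp only: norm_mult power_mult_distrib norm_of_real power2_abs)
        also have "\<dots> \<le> (onorm A)\<^sup>2 * (?d t * (cmod (poly (q n) (of_real t) - \<Phi> t))\<^sup>2)"
          using elim by (intro mult_right_mono power_mono) auto
        finally show ?case by (simp add: ennreal_leI flip: ennreal_mult)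
      qed
    qed
    also have "\<dots> = ennreal ((onorm A)\<^sup>2) * (\<integral>\<^sup>+t. ennreal ((cmod (poly (q n) (of_real t) - \<Phi> t))\<^sup>2) \<partial>spectral_measure A ?x)"
      unfolding Mx by (subst nn_integral_density) (auto simp: nn_integral_cmult)
    finally show ?thesis .
  qed
  have "(\<lambda>n. ennreal ((onorm A)\<^sup>2) * (\<integral>\<^sup>+t. ennreal ((cmod (poly (q n) (of_real t) - \<Phi> t))\<^sup>2) \<partial>spectral_measure A ?x))
      \<longlonglongrightarrow> ennreal ((onorm A)\<^sup>2) * 0"
    by (intro ennreal_tendsto_cmult q) auto
  then have "(\<lambda>n. ennreal ((onorm A)\<^sup>2) * (\<integral>\<^sup>+t. ennreal ((cmod (poly (q n) (of_real t) - \<Phi> t))\<^sup>2) \<partial>spectral_measure A ?x))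
      \<longlonglongrightarrow> 0" by (simp only: mult_zero_right)
  from ennreal_tendsto_0_le[OF le this]
  have "(\<lambda>n. \<integral>\<^sup>+t. ennreal ((cmod (poly (?s n) (of_real t) - ?g t))\<^sup>2) \<partial>?M) \<longlonglongrightarrow> 0" .
  then have "(\<lambda>n. poly_op (?s n) A v) \<longlonglongrightarrow> borel_calc ?g A v"
    by (intro borel_calc_tendsto) measurable
  moreover have "poly_op (?s n) A v = A (poly_op (q n) A ?x)" for n
    by (simp only: poly_op_mult poly_op_X)
  ultimately show ?thesis using l1 by (simp add: LIMSEQ_unique)
qed

lemma cinner_borel_calc:
  assumes g: "L2_fun (spectral_measure A v) g"
  shows "cinner (borel_calc g A v) v = (\<integral>t. g t \<partial>spectral_measure A v)"
proof -
  let ?M = "spectral_measure A v"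
  interpret finite_measure ?M by (rule spectral_finite)
  note [measurable_cong] = spectral_sets[of v]
  have g'[measurable]: "g \<in> borel_measurable borel" using g by (simp add: L2_fun_def)
  note ig = L2_fun_integrable(1)[OF spectral_finite spectral_sets g]
  obtain p where p: "(\<lambda>n. \<integral>\<^sup>+t. ennreal ((cmod (poly (p n) (of_real t) - g t))\<^sup>2) \<partial>?M) \<longlonglongrightarrow> 0"
    by (rule complex_L2_poly_sequence[OF spectral_finite spectral_sets spectral_support g])
  have ip: "integrable ?M (\<lambda>t. poly p (complex_of_real t))" for p
    by (intro integrable_continuous[OF spectral_rep_spectral_measure] continuous_intros)
  have le: "ennreal ((norm (cinner (poly_op (p n) A v) v - (\<integral>t. g t \<partial>?M)))\<^sup>2) \<le>
      emeasure ?M UNIV * (\<integral>\<^sup>+t. ennreal ((cmod (poly (p n) (of_real t) - g t))\<^sup>2) \<partial>?M)" for n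
  proof -
    let ?h = "\<lambda>t. poly (p n) (complex_of_real t) - g t"
    have "cinner (poly_op (p n) A v) v - (\<integral>t. g t \<partial>?M) = (\<integral>t. ?h t \<partial>?M)"
      using ip ig by (simp add: integral_poly[OF spectral_rep_spectral_measure])
    then have "ennreal (norm (cinner (poly_op (p n) A v) v - (\<integral>t. g t \<partial>?M))) \<le> (\<integral>\<^sup>+t. ennreal (cmod (?h t)) * 1 \<partial>?M)"
      using integral_norm_bound_ennreal[of ?M ?h] ip ig by simp
    then have "(ennreal (norm (cinner (poly_op (p n) A v) v - (\<integral>t. g t \<partial>?M))))\<^sup>2 \<le> (\<integral>\<^sup>+t. ennreal (cmod (?h t)) * 1 \<partial>?M)\<^sup>2"
      by (rule power_mono) simp
    also have "\<dots> \<le> (\<integral>\<^sup>+t. (ennreal (cmod (?h t)))\<^sup>2 \<partial>?M) * (\<integral>\<^sup>+t. 1\<^sup>2 \<partial>?M)"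
      by (rule Cauchy_Schwarz_nn_integral) measurable
    finally show ?thesis
      by (simp add: ennreal_power mult.commute space_M[OF spectral_rep_spectral_measure])
  qed
  have "(\<lambda>n. emeasure ?M UNIV * (\<integral>\<^sup>+t. ennreal ((cmod (poly (p n) (of_real t) - g t))\<^sup>2) \<partial>?M)) \<longlonglongrightarrow> emeasure ?M UNIV * 0"
    by (intro ennreal_tendsto_cmult p) (auto simp: less_top[symmetric])
  then have "(\<lambda>n. cinner (poly_op (p n) A v) v - (\<integral>t. g t \<partial>?M)) \<longlonglongrightarrow> 0"
    by (intro tendsto_0_if_ennreal_norm_square_le[OF le]) simp
  then have "(\<lambda>n. cinner (poly_op (p n) A v) v) \<longlonglongrightarrow> (\<integral>t. g t \<partial>?M)"
    by (simp add: LIM_zero_iff)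
  moreover have "(\<lambda>n. cinner (poly_op (p n) A v) v) \<longlonglongrightarrow> cinner (borel_calc g A v) v"
    by (intro cinner.tendsto tendsto_const borel_calc_tendsto g' p)
  ultimately show ?thesis by (simp add: LIMSEQ_unique)
qed

lemma L2_fun_symbol:
  assumes Phi [measurable]: "\<Phi> \<in> borel_measurable borel" and bd: "AE t in spectral_measure A v. cmod (\<Phi> t) \<le> C"
  shows "L2_fun (spectral_measure A v) (\<lambda>t. of_real t * \<Phi> t * of_real (poly r t))"
proof -
  have "compact (poly r ` {0..onorm A})" by (intro compact_continuous_image continuous_intros) auto
  then obtain B where B: "\<And>t. t \<in> {0..onorm A} \<Longrightarrow> \<bar>poly r t\<bar> \<le> B"
    by (force dest!: compact_imp_bounded simp: bounded_iff)
  have "AE t in spectral_measure A v. cmod (of_real t * \<Phi> t * of_real (poly r t)) \<le> onorm A * C * B"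
    using bd spectral_support
  proof eventually_elim
    case (elim t)
    have "0 \<le> C" using elim(1) norm_ge_zero order_trans by blast
    moreover have "\<bar>t\<bar> \<le> onorm A" using elim(2) by auto
    ultimately show ?case
      unfolding norm_mult norm_of_real using B[OF elim(2)] elim by (intro mult_mono) auto
  qed
  then show ?thesis
    by (rule L2_fun_bounded[OF spectral_finite spectral_sets, rotated]) measurable
qed

text \<open>The hypothesis says that the imaginary part of t \<Phi>(t) is orthogonal to all real
  polynomials. The factor t stays in the conclusion because the value at 0 is not
  accessible.\<close>

lemma AE_Im_eq_0_if_real:
  assumes Phi [measurable]: "\<Phi> \<in> borel_measurable borel" and bd: "AE t in spectral_measure A v. cmod (\<Phi> t) \<le> C"
    and real: "\<And>r. Im (cinner (A (borel_calc \<Phi> A (poly_op (cpoly r) A v))) v) = 0"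
  shows "AE t in spectral_measure A v. t * Im (\<Phi> t) = 0"
proof (rule AE_eq_0_if_orthogonal_polynomials[OF spectral_finite spectral_sets compact_Icc spectral_support])
  let ?M = "spectral_measure A v"
  note L2 = L2_fun_symbol[OF Phi bd]
  show "integrable ?M (\<lambda>t. (t * Im (\<Phi> t))\<^sup>2)"
    using L2_fun_integrable(3)[OF spectral_finite spectral_sets L2[of 1]] by simp
  fix g :: "real \<Rightarrow> real" assume "real_polynomial_function g"
  then obtain r where r: "g = poly r" by (rule real_polynomial_function_poly)
  have "(\<integral>t. of_real t * \<Phi> t * of_real (poly r t) \<partial>?M) = cinner (A (borel_calc \<Phi> A (poly_op (cpoly r) A v))) v"
    using cinner_borel_calc[OF L2[of r]] apply_borel_calc_poly_op[OF Phi bd, of "cpoly r"] by simp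
  then have "Im (\<integral>t. of_real t * \<Phi> t * of_real (poly r t) \<partial>?M) = 0" by (simp add: real)
  then show "(\<integral>t. t * Im (\<Phi> t) * g t \<partial>?M) = 0"
    using integral_Im[OF L2_fun_integrable(1)[OF spectral_finite spectral_sets L2[of r]]] by (simp add: r)
qed measurable

text \<open>When t \<Phi>(t) is real almost everywhere, t \<Phi> r is an L2 limit of real
  polynomials, and the calculus carries these to the vectors s(A) v with s real.\<close>

lemma borel_calc_in_closure_real:
  assumes Phi [measurable]: "\<Phi> \<in> borel_measurable borel" and bd: "AE t in spectral_measure A v. cmod (\<Phi> t) \<le> C"
    and real: "AE t in spectral_measure A v. t * Im (\<Phi> t) = 0"
  shows "A (borel_calc \<Phi> A (poly_op (cpoly r) A v)) \<in> closure (range (\<lambda>s. poly_op (cpoly s) A v))"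
proof -
  let ?M = "spectral_measure A v"
  let ?g = "\<lambda>t. complex_of_real t * \<Phi> t * complex_of_real (poly r t)"
  have "integrable ?M (\<lambda>t. (t * Re (\<Phi> t) * poly r t)\<^sup>2)"
    using L2_fun_integrable(2)[OF spectral_finite spectral_sets L2_fun_symbol[OF Phi bd, of r]] by simp
  then obtain s where s: "(\<lambda>n. \<integral>\<^sup>+t. ennreal ((poly (s n) t - t * Re (\<Phi> t) * poly r t)\<^sup>2) \<partial>?M) \<longlonglongrightarrow> 0"
    by (rule real_L2_poly_sequence[OF spectral_finite spectral_sets spectral_support, rotated]) measurable
  have "(\<integral>\<^sup>+t. ennreal ((cmod (poly (cpoly (s n)) (of_real t) - ?g t))\<^sup>2) \<partial>?M) =
      (\<integral>\<^sup>+t. ennreal ((poly (s n) t - t * Re (\<Phi> t) * poly r t)\<^sup>2) \<partial>?M)" for n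
  proof (rule nn_integral_cong_AE)
    show "AE t in ?M. ennreal ((cmod (poly (cpoly (s n)) (of_real t) - ?g t))\<^sup>2) = ennreal ((poly (s n) t - t * Re (\<Phi> t) * poly r t)\<^sup>2)"
      using real by eventually_elim (auto simp: cmod_power2)
  qed
  with s have "(\<lambda>n. \<integral>\<^sup>+t. ennreal ((cmod (poly (cpoly (s n)) (of_real t) - ?g t))\<^sup>2) \<partial>?M) \<longlonglongrightarrow> 0" by simp
  then have "(\<lambda>n. poly_op (cpoly (s n)) A v) \<longlonglongrightarrow> borel_calc ?g A v"
    by (intro borel_calc_tendsto) measurable
  moreover have "\<forall>n. poly_op (cpoly (s n)) A v \<in> range (\<lambda>s. poly_op (cpoly s) A v)" by blast
  ultimately show ?thesis
    unfolding closure_sequential apply_borel_calc_poly_op[OF Phi bd] poly_cpoly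
    by (intro exI[of _ "\<lambda>n. poly_op (cpoly (s n)) A v"] conjI)
qed

text \<open>The indicator of {0} applied to \<open>v\<close> gives a vector w that \<open>A\<close>
  annihilates, because t times the indicator is 0; and <w, v> is the mass of {0}.\<close>

lemma spectral_atom_0:
  assumes ker: "\<And>w. A w = 0 \<Longrightarrow> cinner w v = 0"
  shows "AE t in spectral_measure A v. t \<noteq> 0"
proof -
  let ?M = "spectral_measure A v"
  interpret finite_measure ?M by (rule spectral_finite)
  note [measurable_cong] = spectral_sets[of v]
  let ?f = "\<lambda>t::real. complex_of_real (indicator {0} t)"
  have bd: "AE t in ?M. cmod (?f t) \<le> 1" by (intro AE_I2) (simp split: split_indicator)
  have "A (borel_calc ?f A (poly_op 1 A v)) = borel_calc (\<lambda>t. of_real t * ?f t * poly 1 (of_real t)) A v"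
    by (rule apply_borel_calc_poly_op[OF _ bd]) measurable
  also have "(\<lambda>t::real. complex_of_real t * ?f t * poly 1 (of_real t)) = (\<lambda>t. poly 0 (of_real t))"
    by (auto split: split_indicator)
  also have "borel_calc \<dots> A v = 0" by (simp only: borel_calc_poly poly_op_0)
  finally have "cinner (borel_calc ?f A v) v = 0" by (intro ker) simp
  moreover have "L2_fun ?M ?f" by (intro L2_fun_bounded[OF spectral_finite spectral_sets _ bd]) measurable
  ultimately have "(\<integral>t. ?f t \<partial>?M) = 0" by (simp add: cinner_borel_calc)
  moreover have "(\<integral>t. ?f t \<partial>?M) = of_real (measure ?M {0})"
    by (simp add: space_M[OF spectral_rep_spectral_measure])
  ultimately have "emeasure ?M {0} = 0" by (simp add: emeasure_eq_measure)
  then have "AE t in ?M. t \<notin> {0}" by (intro AE_not_in) (auto simp: null_sets_def spectral_sets)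
  then show ?thesis by simp
qed

end

section \<open>Square roots and anti-linear symmetric operators\<close>

lemma bounded_linear_image_closure:
  assumes "bounded_linear f" "\<And>x. x \<in> S \<Longrightarrow> f x \<in> T" "closed T" "x \<in> closure S"
  shows "f x \<in> T"
  using image_closure_subset[of S f T] assms linear_continuous_on[OF assms(1)] by blast

lemma subspace_closure:
  fixes S :: "'a::real_normed_vector set"
  assumes "subspace S"
  shows "subspace (closure S)"
  unfolding subspace_def
proof (intro conjI ballI allI)
  show "0 \<in> closure S" using subspace_0[OF assms] closure_subset by blast
next
  fix x y assume "x \<in> closure S" "y \<in> closure S"
  then obtain X Y where XY: "\<And>n. X n \<in> S" "X \<longlonglongrightarrow> x" "\<And>n. Y n \<in> S" "Y \<longlonglongrightarrow> y"
    by (auto simp: closure_sequential)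
  then show "x + y \<in> closure S"
    unfolding closure_sequential
    by (intro exI[of _ "\<lambda>n. X n + Y n"]) (auto intro: subspace_add[OF assms] tendsto_add)
next
  fix c x assume "x \<in> closure S"
  then obtain X where X: "\<And>n. X n \<in> S" "X \<longlonglongrightarrow> x"
    by (auto simp: closure_sequential)
  then show "c *\<^sub>R x \<in> closure S"
    unfolding closure_sequential
    by (intro exI[of _ "\<lambda>n. c *\<^sub>R X n"]) (auto intro: subspace_scale[OF assms] tendsto_scaleR)
qed

lemma hardy_subspace_closure:
  assumes "hardy.subspace S"
  shows "hardy.subspace (closure S)"
proof -
  have s: "subspace (closure S)" by (intro subspace_closure hardy_subspace_imp_subspace assms)
  have "c *\<^sub>C x \<in> closure S" if x: "x \<in> closure S" for c x
  proof -
    obtain X where X: "\<And>n. X n \<in> S" "X \<longlonglongrightarrow> x"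
      using x by (auto simp: closure_sequential)
    then show ?thesis
      unfolding closure_sequential
      by (intro exI[of _ "\<lambda>n. c *\<^sub>C X n"])
        (auto intro: hardy.subspace_scale[OF assms] scaleC.tendsto tendsto_const)
  qed
  with s show ?thesis by (simp add: subspace_def hardy.subspace_def)
qed

section \<open>Existence and uniqueness of positive square roots\<close>

context positive_operator
begin

lemma poly_op_pcompose_square: "poly_op (pcompose p [:0, 0, 1:]) A x = poly_op p (A \<circ> A) x"
proof -
  interpret sq: positive_operator "A \<circ> A"
  proof
    have "bounded_linear (A \<circ> A)"
      using bounded_linear_compose[OF bounded_linear_A bounded_linear_A] by (simp add: comp_def)
    moreover have "cinner (A (A x)) y = cinner x (A (A y))" for x y by (simp add: selfadjoint)
    moreover have "0 \<le> Re (cinner (A (A x)) x)" for x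
      unfolding selfadjoint[of "A x" x] by (rule cinner_self(2))
    ultimately show "positive_op (A \<circ> A)"
      by (simp add: positive_op_def bounded_clinear_def selfadjoint_def scaleC)
  qed
  show ?thesis
  proof (induction p)
    case (pCons a p)
    have "poly_op [:0, 0, 1:] A y = A (A y)" for y
      by (simp add: poly_op_pCons)
    moreover have "poly_op [:a:] A x = a *\<^sub>C x"
      by (simp add: poly_op_pCons zero)
    ultimately have "poly_op (pcompose (pCons a p) [:0, 0, 1:]) A x = a *\<^sub>C x + A (A (poly_op p (A \<circ> A) x))"
      by (simp only: pcompose_pCons poly_op_add poly_op_mult pCons.IH)
    also have "\<dots> = poly_op (pCons a p) (A \<circ> A) x"
      by (subst sq.poly_op_pCons) (simp only: o_apply)
    finally show ?case .
  qed simp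
qed

text \<open>The limit does not depend on Q, which is the uniqueness of the positive root. In the
  calculus of Q the difference is r_n(t^2) - t, and this is small on [0, norm of Q] because t is the
  square root of t^2 there.\<close>

lemma poly_op_sqrt_tendsto:
  assumes Q: "positive_op Q" "\<And>x. Q (Q x) = A x"
    and r: "\<And>n t. t \<in> {0..onorm A} \<Longrightarrow> \<bar>poly (r n) t - sqrt t\<bar> < 1 / Suc n"
  shows "(\<lambda>n. poly_op (cpoly (r n)) A x) \<longlonglongrightarrow> Q x"
proof -
  interpret Q: positive_operator Q by standard (rule Q(1))
  have QQ: "Q \<circ> Q = A" using Q(2) by (simp add: fun_eq_iff)
  \<comment> \<open>Ensures that t^2 stays in the interval where the r_n are controlled whenever t
    is at most the norm of Q.\<close>
  have "norm (Q x) \<le> sqrt (onorm A) * norm x" for x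
  proof (rule power2_le_imp_le)
    have "(norm (Q x))\<^sup>2 = Re (cinner (A x) x)"
      using cinner_self_norm[of "Q x"] by (simp add: Q(2)[symmetric] Q.selfadjoint)
    also have "\<dots> \<le> norm (A x) * norm x"
      using norm_cinner_le[of "A x" x] complex_Re_le_cmod order_trans by blast
    also have "\<dots> \<le> onorm A * norm x * norm x"
      by (intro mult_right_mono onorm[OF bounded_linear_A]) simp
    also have "\<dots> = (sqrt (onorm A) * norm x)\<^sup>2"
      using onorm_pos_le[OF bounded_linear_A] by (simp add: power_mult_distrib power2_eq_square)
    finally show "(norm (Q x))\<^sup>2 \<le> (sqrt (onorm A) * norm x)\<^sup>2" .
  qed (simp add: onorm_pos_le[OF bounded_linear_A])
  then have onQ: "onorm Q \<le> sqrt (onorm A)"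
    by (intro onorm_bound) (simp_all add: onorm_pos_le[OF bounded_linear_A])
  have le: "norm (poly_op (cpoly (r n)) A x - Q x) \<le> 1 / Suc n * norm x" for n
  proof -
    have "poly_op (cpoly (r n)) A x - Q x = poly_op (pcompose (cpoly (r n)) [:0, 0, 1:] - [:0, 1:]) Q x"
      by (simp add: poly_op_diff Q.poly_op_pcompose_square QQ Q.poly_op_X)
    also have "norm \<dots> \<le> 1 / Suc n * norm x"
    proof (rule Q.norm_poly_op_le)
      fix t assume t: "t \<in> {0..onorm Q}"
      then have "t\<^sup>2 \<le> (sqrt (onorm A))\<^sup>2" using onQ by (intro power_mono) auto
      then have t2: "t * t \<in> {0..onorm A}"
        using onorm_pos_le[OF bounded_linear_A] by (simp add: power2_eq_square)
      have "poly (pcompose (cpoly (r n)) [:0, 0, 1:] - [:0, 1:]) (of_real t) = of_real (poly (r n) (t * t) - sqrt (t * t))"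
        using t by (simp add: poly_pcompose flip: of_real_mult)
      then have "cmod (poly (pcompose (cpoly (r n)) [:0, 0, 1:] - [:0, 1:]) (of_real t)) = \<bar>poly (r n) (t * t) - sqrt (t * t)\<bar>"
        by (simp only: norm_of_real)
      then show "cmod (poly (pcompose (cpoly (r n)) [:0, 0, 1:] - [:0, 1:]) (of_real t)) \<le> 1 / Suc n"
        using r[OF t2, of n] by linarith
    qed
    finally show ?thesis .
  qed
  have "(\<lambda>n. poly_op (cpoly (r n)) A x - Q x) \<longlonglongrightarrow> 0"
    by (rule Lim_null_comparison[OF always_eventually LIMSEQ_inverse_Suc_mult]) (use le in blast)
  then show ?thesis by (simp add: LIM_zero_iff)
qed

lemma positive_sqrt_exists:
  assumes r: "\<And>n t. t \<in> {0..onorm A} \<Longrightarrow> \<bar>poly (r n) t - sqrt t\<bar> < 1 / Suc n"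
  shows "\<exists>Q. positive_op Q \<and> (\<forall>x. Q (Q x) = A x)"
proof -
  define C where "C = sqrt (onorm A) + 1"
  have C: "C \<ge> 1" by (simp add: C_def onorm_pos_le[OF bounded_linear_A])
  have le1: "1 / real (Suc n) \<le> 1" for n by simp
  have rC: "\<bar>poly (r n) t\<bar> \<le> C" if t: "t \<in> {0..onorm A}" for n t
  proof -
    have "sqrt t \<le> sqrt (onorm A)" "0 \<le> sqrt t" using t by auto
    then show ?thesis using r[OF t, of n] le1[of n] unfolding C_def by linarith
  qed
  define q where "q n = poly_op (cpoly (r n)) A" for n
  have qC: "norm (q n x) \<le> C * norm x" for n x
    unfolding q_def by (rule norm_poly_op_le) (simp add: rC del: atLeastAtMost_iff)
  have "uniform_limit {0..onorm A} (\<lambda>n t. poly (cpoly (r n)) (of_real t)) (\<lambda>t. of_real (sqrt t)) sequentially"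
    by (rule uniform_limit_inverse_Suc[where c=1])
      (use r in \<open>auto simp: dist_of_real dist_real_def intro: less_imp_le\<close>)
  from poly_op_uniform_limit(1)[OF this]
  have "\<exists>y. (\<lambda>n. q n x) \<longlonglongrightarrow> y" for x by (simp add: convergent_def q_def)
  then obtain Q where Q: "\<And>x. (\<lambda>n. q n x) \<longlonglongrightarrow> Q x" by metis
  have Qadd: "Q (x + y) = Q x + Q y" for x y
    using LIMSEQ_unique[OF Q[of "x + y"], of "Q x + Q y"] tendsto_add[OF Q[of x] Q[of y]]
    by (simp add: q_def poly_op_add_arg)
  have QscaleC: "Q (c *\<^sub>C x) = c *\<^sub>C Q x" for c x
    using LIMSEQ_unique[OF Q[of "c *\<^sub>C x"], of "c *\<^sub>C Q x"] scaleC.tendsto[OF tendsto_const[of c] Q[of x]]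
    by (simp add: q_def poly_op_scaleC_arg)
  have Qnorm: "norm (Q x) \<le> C * norm x" for x
    by (rule LIMSEQ_le_const2[OF tendsto_norm[OF Q]]) (use qC in blast)
  have bl: "bounded_linear Q"
    by (rule bounded_linear_intro[where K=C])
      (auto simp: Qadd scaleR_hardy_def QscaleC Qnorm mult.commute[of _ C])
  have self: "cinner (Q x) y = cinner x (Q y)" for x y
  proof (rule LIMSEQ_unique)
    show "(\<lambda>n. cinner (q n x) y) \<longlonglongrightarrow> cinner (Q x) y" by (intro cinner.tendsto Q tendsto_const)
    have "(\<lambda>n. cinner x (q n y)) \<longlonglongrightarrow> cinner x (Q y)" by (intro cinner.tendsto Q tendsto_const)
    then show "(\<lambda>n. cinner (q n x) y) \<longlonglongrightarrow> cinner x (Q y)" by (simp add: q_def poly_op_adjoint)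
  qed
  have pos: "0 \<le> Re (cinner (Q x) x)" for x
  proof -
    obtain M where M: "spectral_rep M x" using spectral_rep_exists by blast
    interpret finite_measure M by (rule finite_M[OF M])
    \<comment> \<open>The r_n need not be nonnegative, but they exceed -1/(n+1) because the square
      root is nonnegative.\<close>
    have "- (1 / Suc n) * (norm x)\<^sup>2 \<le> Re (cinner (q n x) x)" for n
    proof -
      have "- (1 / Suc n) * (norm x)\<^sup>2 = (\<integral>t. - (1 / Suc n) \<partial>M)"
        by (simp add: space_M[OF M] measure_M[OF M])
      also have "\<dots> \<le> (\<integral>t. poly (r n) t \<partial>M)"
      proof (rule integral_mono_AE)
        show "AE t in M. - (1 / Suc n) \<le> poly (r n) t"
          using supp_M[OF M]
        proof eventually_elim
          case (elim t)
          then have "0 \<le> sqrt t" by simp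
          then show ?case using r[OF elim, of n] by linarith
        qed
      qed (intro integrable_continuous[OF M] continuous_intros)+
      also have "\<dots> = Re (cinner (q n x) x)"
        using integral_poly[OF M, of "cpoly (r n)"] by (simp add: q_def flip: integral_complex_of_real)
          (metis Re_complex_of_real integral_complex_of_real)
      finally show ?thesis .
    qed
    moreover have "(\<lambda>n. Re (cinner (q n x) x)) \<longlonglongrightarrow> Re (cinner (Q x) x)"
      by (intro tendsto_intros cinner.tendsto Q)
    moreover have "(\<lambda>n. - (1 / real (Suc n)) * (norm x)\<^sup>2) \<longlonglongrightarrow> 0"
      using tendsto_minus[OF LIMSEQ_inverse_Suc_mult[of "(norm x)\<^sup>2"]] by simp
    ultimately show ?thesis
      by (intro LIMSEQ_le[of "\<lambda>n. - (1 / real (Suc n)) * (norm x)\<^sup>2" _ "\<lambda>n. Re (cinner (q n x) x)"]) auto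
  qed
  have "Q (Q x) = A x" for x
  proof -
    have "norm (q n (q n x) - A x) \<le> 1 / Suc n * (2 * C) * norm x" for n
    proof -
      have "q n (q n x) - A x = poly_op (cpoly (r n * r n - [:0, 1:])) A x"
      proof -
        have "cpoly (r n * r n - [:0, 1:]) = cpoly (r n) * cpoly (r n) - [:0, 1:]"
          by (rule poly_eqI_real) simp
        then show ?thesis by (simp only: q_def poly_op_diff poly_op_mult poly_op_X)
      qed
      also have "norm \<dots> \<le> 1 / Suc n * (2 * C) * norm x"
      proof (rule norm_poly_op_le)
        fix t assume t: "t \<in> {0..onorm A}"
        have "poly (r n * r n - [:0, 1:]) t = (poly (r n) t - sqrt t) * (poly (r n) t + sqrt t)"
          using t by (simp add: algebra_simps)
        then have "\<bar>poly (r n * r n - [:0, 1:]) t\<bar> = \<bar>poly (r n) t - sqrt t\<bar> * \<bar>poly (r n) t + sqrt t\<bar>"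
          by (simp only: abs_mult)
        also have "\<dots> \<le> 1 / Suc n * (2 * C)"
        proof (intro mult_mono)
          have "sqrt t \<le> C" "0 \<le> sqrt t" using t unfolding C_def by (auto intro: order_trans[of _ "sqrt (onorm A)"])
          then show "\<bar>poly (r n) t + sqrt t\<bar> \<le> 2 * C" using rC[OF t, of n] by linarith
        qed (use r[OF t, of n] in auto)
        finally show "cmod (poly (cpoly (r n * r n - [:0, 1:])) (of_real t)) \<le> 1 / Suc n * (2 * C)"
          by (simp only: poly_cpoly norm_of_real)
      qed
      finally show ?thesis .
    qed
    moreover have "(\<lambda>n. 1 / real (Suc n) * (2 * C) * norm x) \<longlonglongrightarrow> 0"
      unfolding mult.assoc[of "1 / real (Suc _)"] by (rule LIMSEQ_inverse_Suc_mult)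
    ultimately have l1: "(\<lambda>n. q n (q n x) - A x) \<longlonglongrightarrow> 0"
      by (intro Lim_null_comparison[of "\<lambda>n. q n (q n x) - A x" "\<lambda>n. 1 / real (Suc n) * (2 * C) * norm x"]) auto
    \<comment> \<open>The bound \<open>C\<close>, uniform in n, lets the inner approximant be
      replaced by its limit using pointwise convergence alone.\<close>
    have "(\<lambda>n. C * norm (q n x - Q x)) \<longlonglongrightarrow> C * norm (Q x - Q x)"
      by (intro tendsto_intros Q)
    moreover have "norm (q n (q n x) - q n (Q x)) \<le> C * norm (q n x - Q x)" for n
      using qC[of n "q n x - Q x"] by (simp add: q_def poly_op_diff_arg)
    ultimately have l2: "(\<lambda>n. q n (q n x) - q n (Q x)) \<longlonglongrightarrow> 0"
      by (intro Lim_null_comparison[of "\<lambda>n. q n (q n x) - q n (Q x)" "\<lambda>n. C * norm (q n x - Q x)"]) auto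
    have "(\<lambda>n. (q n (q n x) - q n (Q x)) + q n (Q x) - (q n (q n x) - A x)) \<longlonglongrightarrow> 0 + Q (Q x) - 0"
      by (intro tendsto_intros l1 l2 Q)
    then show ?thesis by (simp add: LIMSEQ_const_iff)
  qed
  with bl QscaleC self pos show ?thesis
    by (auto simp: positive_op_def bounded_clinear_def selfadjoint_def)
qed

end

text \<open>The third clause keeps the approximating real polynomials in the square of
  \<open>T\<close>: through them a closed real subspace invariant under the square is invariant
  under the modulus.\<close>

lemma abs_op:
  assumes T: "positive_op (T \<circ> T)"
  shows "positive_op (abs_op T)" "abs_op T (abs_op T x) = T (T x)"
    "\<exists>r. \<forall>x. (\<lambda>n. poly_op (cpoly (r n)) (T \<circ> T) x) \<longlonglongrightarrow> abs_op T x"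
proof -
  interpret positive_operator "T \<circ> T" by standard (rule T)
  have c: "continuous_on {0..onorm (T \<circ> T)} sqrt" by (intro continuous_intros)
  obtain r where r: "\<And>n t. t \<in> {0..onorm (T \<circ> T)} \<Longrightarrow> \<bar>poly (r n) t - sqrt t\<bar> < 1 / Suc n"
    by (rule Weierstrass_poly_real[OF c]) (rule that)
  obtain Q where Q: "positive_op Q" "\<And>x. Q (Q x) = (T \<circ> T) x"
    using positive_sqrt_exists[OF r] by blast
  have "abs_op T = Q"
    unfolding abs_op_def
  proof (rule the_equality)
    show "positive_op Q \<and> Q \<circ> Q = T \<circ> T" using Q by (auto simp: fun_eq_iff)
    fix B assume B: "positive_op B \<and> B \<circ> B = T \<circ> T"
    then have B': "positive_op B" "\<And>x. B (B x) = (T \<circ> T) x" by (auto simp: fun_eq_iff)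
    show "B = Q"
    proof
      fix x
      show "B x = Q x"
        by (rule LIMSEQ_unique[OF poly_op_sqrt_tendsto[OF B' r] poly_op_sqrt_tendsto[OF Q r]])
    qed
  qed
  then show "positive_op (abs_op T)" "abs_op T (abs_op T x) = T (T x)"
    "\<exists>r. \<forall>x. (\<lambda>n. poly_op (cpoly (r n)) (T \<circ> T) x) \<longlonglongrightarrow> abs_op T x"
    using Q poly_op_sqrt_tendsto[OF Q r] by auto
qed

section \<open>Real cyclic subspaces\<close>

context positive_operator
begin

text \<open>Under the isometry p \<mapsto> p(A) u this is the copy of the real-valued functions in
  L2 of the spectral measure.\<close>

definition real_cyclic :: "hardy \<Rightarrow> hardy set" where
  "real_cyclic u = closure (range (\<lambda>r. poly_op (cpoly r) A u))"

lemma subspace_real_cyclic: "subspace (real_cyclic u)"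
  unfolding real_cyclic_def
proof (intro subspace_closure, unfold subspace_def, safe)
  show "0 \<in> range (\<lambda>r. poly_op (cpoly r) A u)" by (rule range_eqI[of _ _ 0]) simp
next
  fix r s
  show "poly_op (cpoly r) A u + poly_op (cpoly s) A u \<in> range (\<lambda>r. poly_op (cpoly r) A u)"
    by (rule range_eqI[of _ _ "r + s"]) (simp add: cpoly_add poly_op_add)
next
  fix c r
  show "c *\<^sub>R poly_op (cpoly r) A u \<in> range (\<lambda>r. poly_op (cpoly r) A u)"
    by (rule range_eqI[of _ _ "smult c r"]) (simp add: cpoly_smult poly_op_smult scaleR_hardy_def)
qed

lemma closed_real_cyclic: "closed (real_cyclic u)"
  by (simp add: real_cyclic_def)

lemma self_in_real_cyclic: "u \<in> real_cyclic u"
  unfolding real_cyclic_def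
  by (rule subsetD[OF closure_subset]) (rule range_eqI[of _ _ 1], simp)

lemma real_cyclic_invariant: "x \<in> real_cyclic u \<Longrightarrow> A x \<in> real_cyclic u"
  unfolding real_cyclic_def
proof (erule bounded_linear_image_closure[OF bounded_linear_A, rotated 2])
  fix x assume "x \<in> range (\<lambda>r. poly_op (cpoly r) A u)"
  then obtain r where "x = poly_op (cpoly r) A u" by blast
  then have "A x = poly_op (cpoly ([:0, 1:] * r)) A u"
    by (simp add: cpoly_mult poly_op_mult map_poly_pCons poly_op_pCons)
  then show "A x \<in> closure (range (\<lambda>r. poly_op (cpoly r) A u))"
    by (intro subsetD[OF closure_subset]) blast
qed simp

lemma poly_op_in_subspace:
  assumes R: "subspace R" "\<And>x. x \<in> R \<Longrightarrow> A x \<in> R" and u: "u \<in> R"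
  shows "poly_op (cpoly r) A u \<in> R"
proof (induction r)
  case 0
  then show ?case using subspace_0[OF R(1)] by simp
next
  case (pCons a r)
  have "poly_op (cpoly (pCons a r)) A u = a *\<^sub>R u + A (poly_op (cpoly r) A u)"
    by (simp add: map_poly_pCons poly_op_pCons scaleR_hardy_def)
  then show ?case using R u pCons.IH by (simp add: subspace_add subspace_scale)
qed

lemma real_cyclic_minimal:
  assumes R: "subspace R" "closed R" "\<And>x. x \<in> R \<Longrightarrow> A x \<in> R" and u: "u \<in> R"
  shows "real_cyclic u \<subseteq> R"
  unfolding real_cyclic_def
  by (rule closure_minimal[OF _ R(2)]) (use poly_op_in_subspace[OF R(1,3) u] in blast)

text \<open>Real polynomials in \<open>A\<close> are self-adjoint and commute, so the inner product
  of two such vectors equals its own conjugate; continuity in each variable extends this to the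
  closure.\<close>

lemma cinner_real_cyclic:
  assumes x: "x \<in> real_cyclic u" and y: "y \<in> real_cyclic u"
  shows "Im (cinner x y) = 0"
proof -
  let ?P = "range (\<lambda>r. poly_op (cpoly r) A u)"
  have base: "Im (cinner (poly_op (cpoly r) A u) (poly_op (cpoly s) A u)) = 0" for r s
  proof -
    have "cinner (poly_op (cpoly r) A u) (poly_op (cpoly s) A u) = cinner (poly_op (cpoly (s * r)) A u) u"
      by (simp add: cpoly_mult poly_op_mult poly_op_adjoint[of "cpoly s"])
    also have "\<dots> = cinner u (poly_op (cpoly (s * r)) A u)" by (simp add: poly_op_adjoint)
    also have "\<dots> = cnj (cinner (poly_op (cpoly (r * s)) A u) u)" by (subst cinner_commute) (simp add: mult.commute)
    also have "cinner (poly_op (cpoly (r * s)) A u) u = cinner (poly_op (cpoly s) A u) (poly_op (cpoly r) A u)"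
      by (simp add: cpoly_mult poly_op_mult poly_op_adjoint[of "cpoly r"])
    finally have "cinner (poly_op (cpoly r) A u) (poly_op (cpoly s) A u)
        = cnj (cinner (poly_op (cpoly s) A u) (poly_op (cpoly r) A u))" .
    moreover have "cinner (poly_op (cpoly s) A u) (poly_op (cpoly r) A u) = cinner (poly_op (cpoly r) A u) (poly_op (cpoly s) A u)"
      by (simp add: poly_op_adjoint poly_op_mult[symmetric] mult.commute flip: cpoly_mult)
    ultimately show ?thesis by (metis complex_cnj_cancel_iff Im_complex_of_real Reals_cases Reals_cnj_iff)
  qed
  have s1: "Im (cinner x (poly_op (cpoly s) A u)) = 0" for s
  proof -
    have "closed {x. Im (cinner x (poly_op (cpoly s) A u)) = 0}"
      by (intro closed_Collect_eq continuous_intros linear_continuous_on cinner.bounded_linear_left)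
    then have "closure ?P \<subseteq> {x. Im (cinner x (poly_op (cpoly s) A u)) = 0}"
      by (intro closure_minimal) (use base in auto)
    then show ?thesis using x by (auto simp: real_cyclic_def)
  qed
  have "closed {y. Im (cinner x y) = 0}"
    by (intro closed_Collect_eq continuous_intros linear_continuous_on cinner.bounded_linear_right)
  then have "closure ?P \<subseteq> {y. Im (cinner x y) = 0}"
    by (intro closure_minimal) (use s1 in auto)
  then show ?thesis using y by (auto simp: real_cyclic_def)
qed

end

section \<open>Anti-linear symmetric operators and their symbols\<close>

locale antilinear_symmetric =
  fixes T :: "hardy \<Rightarrow> hardy"
  assumes bounded_linear_T: "bounded_linear T"
    and antilinear: "T (c *\<^sub>C x) = cnj c *\<^sub>C T x"
    and symmetric: "cinner (T x) y = cinner (T y) x"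
begin

sublocale bounded_linear T by (rule bounded_linear_T)

text \<open>\<open>symmetric\<close> is the anti-linear form of self-adjointness: both of its sides
  are conjugate linear in x and in y. Used twice it makes the square self-adjoint, and it turns <T T
  x, x> into the squared norm of T x.\<close>

lemma positive_square: "positive_op (T \<circ> T)"
proof -
  have "bounded_linear (T \<circ> T)"
    using bounded_linear_compose[OF bounded_linear_T bounded_linear_T] by (simp add: comp_def)
  moreover have "cinner (T (T x)) y = cinner x (T (T y))" for x y
  proof -
    have "cinner (T (T x)) y = cinner (T y) (T x)" by (rule symmetric)
    also have "\<dots> = cnj (cinner (T x) (T y))" by (rule cinner_commute)
    also have "cinner (T x) (T y) = cinner (T (T y)) x" by (rule symmetric)
    finally show ?thesis by (subst cinner_commute) simp
  qed
  moreover have "0 \<le> Re (cinner (T (T x)) x)" for x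
    using cinner_self(2)[of "T x"] symmetric[of "T x" x] by simp
  ultimately show ?thesis
    by (auto simp: positive_op_def bounded_clinear_def selfadjoint_def antilinear)
qed

sublocale sq: positive_operator "T \<circ> T"
  by standard (rule positive_square)

sublocale abs: positive_operator "abs_op T"
  by standard (rule abs_op(1)[OF positive_square])

lemma abs_square: "abs_op T (abs_op T x) = T (T x)"
  by (rule abs_op(2)[OF positive_square])

lemma abs_op_in_subspace:
  assumes R: "subspace R" "closed R" "\<And>x. x \<in> R \<Longrightarrow> T (T x) \<in> R" and x: "x \<in> R"
  shows "abs_op T x \<in> R"
proof -
  obtain r where r: "\<And>x. (\<lambda>n. poly_op (cpoly (r n)) (T \<circ> T) x) \<longlonglongrightarrow> abs_op T x"
    using abs_op(3)[OF positive_square] by blast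
  show ?thesis
    by (rule closed_sequentially[OF R(2) _ r]) (use sq.poly_op_in_subspace[OF R(1) _ x] R(3) in simp)
qed

text \<open>The modulus is a limit of real polynomials in the square, and the square is the modulus
  applied twice. The description by the square permits the comparison of the two Hankel operators;
  the one by the modulus is where the symbol acts.\<close>

lemma real_cyclic_abs: "abs.real_cyclic u = sq.real_cyclic u"
proof
  show "abs.real_cyclic u \<subseteq> sq.real_cyclic u"
    by (rule abs.real_cyclic_minimal[OF sq.subspace_real_cyclic sq.closed_real_cyclic _ sq.self_in_real_cyclic])
      (use abs_op_in_subspace[OF sq.subspace_real_cyclic sq.closed_real_cyclic] sq.real_cyclic_invariant in auto)
  show "sq.real_cyclic u \<subseteq> abs.real_cyclic u"
    by (rule sq.real_cyclic_minimal[OF abs.subspace_real_cyclic abs.closed_real_cyclic _ abs.self_in_real_cyclic])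
      (use abs.real_cyclic_invariant in \<open>auto simp: abs_square[symmetric]\<close>)
qed

lemma kernel_abs: "abs_op T x = 0 \<Longrightarrow> T x = 0"
proof -
  assume "abs_op T x = 0"
  then have "T (T x) = 0" using abs_square[of x] by (simp add: abs.zero)
  then have "cinner (T x) (T x) = 0" using symmetric[of "T x" x] by simp
  then show ?thesis using cinner_self(3)[of "T x"] by simp
qed

text \<open>Both symbols are treated at once: \<open>\<Phi>\<close> is the conjugate of \<open>\<Psi>\<close> for
  \<open>T = H\<^sub>u\<close> and \<open>\<Psi>\<close> itself for the operator with the tilde.\<close>

context
  fixes u :: hardy and \<Phi> :: "real \<Rightarrow> complex" and C :: real
  assumes Phi: "\<Phi> \<in> borel_measurable borel" "AE t in spectral_measure (abs_op T) u. cmod (\<Phi> t) \<le> C"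
    and model: "\<And>f. L2_fun (spectral_measure (abs_op T) u) f \<Longrightarrow>
      T (borel_calc f (abs_op T) u) = abs_op T (borel_calc \<Phi> (abs_op T) (borel_calc (\<lambda>s. cnj (f s)) (abs_op T) u))"
begin

text \<open>For real \<open>r\<close> the conjugate in the model formula leaves the polynomial
  unchanged, so on these vectors \<open>T\<close> acts as \<Phi>(|T|) followed by |T|.\<close>

lemma model_poly: "T (poly_op (cpoly r) (abs_op T) u) = abs_op T (borel_calc \<Phi> (abs_op T) (poly_op (cpoly r) (abs_op T) u))"
proof -
  have "integrable (spectral_measure (abs_op T) u) (\<lambda>t. (cmod (poly (cpoly r) (of_real t)))\<^sup>2)"
    by (intro abs.integrable_continuous[OF abs.spectral_rep_spectral_measure] continuous_intros)
  then have "L2_fun (spectral_measure (abs_op T) u) (\<lambda>t. poly (cpoly r) (of_real t))"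
    using borel_measurable_poly(2)[of "cpoly r"] by (simp add: L2_fun_def)
  from model[OF this] show ?thesis
    using abs.borel_calc_poly[of "cpoly r" u] by simp
qed

lemma AE_Im_symbol_eq_0:
  assumes "\<And>r. Im (cinner (T (poly_op (cpoly r) (abs_op T) u)) u) = 0"
  shows "AE t in spectral_measure (abs_op T) u. t * Im (\<Phi> t) = 0"
  by (rule abs.AE_Im_eq_0_if_real[OF Phi]) (simp add: assms flip: model_poly)

lemma real_cyclic_invariant_T:
  assumes "AE t in spectral_measure (abs_op T) u. t * Im (\<Phi> t) = 0" and x: "x \<in> sq.real_cyclic u"
  shows "T x \<in> sq.real_cyclic u"
  using x unfolding real_cyclic_abs[symmetric] abs.real_cyclic_def
proof (rule bounded_linear_image_closure[OF bounded_linear_T, rotated 2])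
  fix x assume "x \<in> range (\<lambda>r. poly_op (cpoly r) (abs_op T) u)"
  then obtain r where "x = poly_op (cpoly r) (abs_op T) u" by blast
  then show "T x \<in> closure (range (\<lambda>r. poly_op (cpoly r) (abs_op T) u))"
    using abs.borel_calc_in_closure_real[OF Phi assms(1), of r] by (simp add: model_poly)
qed simp

end

end

section \<open>Cyclic vectors and Hankel operators\<close>

lemma closure_range_sequence:
  fixes f :: "'a \<Rightarrow> 'b::first_countable_topology"
  assumes "x \<in> closure (range f)"
  obtains p where "(\<lambda>n. f (p n)) \<longlonglongrightarrow> x"
proof -
  obtain X where X: "\<And>n. X n \<in> range f" "X \<longlonglongrightarrow> x"
    using assms by (auto simp: closure_sequential)
  from X(1) have "\<forall>n. \<exists>p. X n = f p" by blast
  then obtain p where "\<forall>n. X n = f (p n)" by (rule choice[THEN exE])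
  then have "X = (\<lambda>n. f (p n))" by blast
  then show thesis using that X(2) by blast
qed

lemma norm_le_norm_diff_orthogonal:
  fixes x y :: "'a::real_inner"
  assumes "inner x y = 0"
  shows "norm x \<le> norm (x - y)" "norm y \<le> norm (x - y)"
proof -
  have "(norm (x - y))\<^sup>2 = (norm x)\<^sup>2 + (norm y)\<^sup>2"
    using assms by (simp add: power2_norm_eq_inner inner_diff_left inner_diff_right inner_commute)
  then show "norm x \<le> norm (x - y)" "norm y \<le> norm (x - y)"
    using power2_le_imp_le[of "norm x" "norm (x - y)"] power2_le_imp_le[of "norm y" "norm (x - y)"] by simp_all
qed

lemma hardy_subspace_orthogonal: "hardy.subspace {x \<in> M. \<forall>z\<in>N. cinner x z = 0}" if "hardy.subspace M"
  using that by (auto simp: hardy.subspace_def cinner_add_left cinner_scaleC_left)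

lemma closed_orthogonal:
  assumes "closed M"
  shows "closed {x \<in> M. \<forall>z\<in>N. cinner x z = 0}"
proof -
  have "{x \<in> M. \<forall>z\<in>N. cinner x z = 0} = M \<inter> (\<Inter>z\<in>N. {x. cinner x z = 0})" by auto
  then show ?thesis
    using assms by (auto intro!: closed_Int closed_INT closed_Collect_eq continuous_intros
        linear_continuous_on cinner.bounded_linear_left)
qed

context positive_operator
begin

lemma subspace_range_poly_op: "hardy.subspace (range (\<lambda>p. poly_op p A v))"
  unfolding hardy.subspace_def
proof safe
  show "0 \<in> range (\<lambda>p. poly_op p A v)" by (rule range_eqI[of _ _ 0]) simp
next
  fix p q
  show "poly_op p A v + poly_op q A v \<in> range (\<lambda>p. poly_op p A v)"
    by (rule range_eqI[of _ _ "p + q"]) (simp add: poly_op_add)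
next
  fix c p
  show "c *\<^sub>C poly_op p A v \<in> range (\<lambda>p. poly_op p A v)"
    by (rule range_eqI[of _ _ "smult c p"]) (simp add: poly_op_smult)
qed

lemma span_powers_subset: "hardy.span (range (\<lambda>n. (A ^^ n) v)) \<subseteq> range (\<lambda>p. poly_op p A v)"
  by (rule hardy.span_minimal[OF _ subspace_range_poly_op]) (auto simp: funpow_poly_op)

lemma poly_op_in_hardy_subspace:
  assumes N: "hardy.subspace N" "\<And>x. x \<in> N \<Longrightarrow> A x \<in> N" and v: "v \<in> N"
  shows "poly_op p A v \<in> N"
proof (induction p)
  case 0
  then show ?case using N(1) by (simp add: hardy.subspace_0)
next
  case (pCons a p)
  then show ?case using N v by (simp add: poly_op_pCons hardy.subspace_add hardy.subspace_scale)
qed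

lemma poly_op_real_imag:
  "\<exists>r s. poly_op p A v = poly_op (cpoly r) A v + \<i> *\<^sub>C poly_op (cpoly s) A v"
proof (intro exI)
  have "p = cpoly (map_poly Re p) + smult \<i> (cpoly (map_poly Im p))"
    by (rule poly_eqI) (simp add: coeff_map_poly complex_eq_iff)
  then show "poly_op p A v = poly_op (cpoly (map_poly Re p)) A v + \<i> *\<^sub>C poly_op (cpoly (map_poly Im p)) A v"
    using poly_op_add[of "cpoly (map_poly Re p)" "smult \<i> (cpoly (map_poly Im p))" A v]
    by (simp only: poly_op_smult)
qed

end

context antilinear_symmetric
begin

text \<open>\<open>T\<close> commutes with its own square and conjugates scalars.\<close>

lemma poly_op_square_apply: "T (poly_op p (T \<circ> T) x) = poly_op (map_poly cnj p) (T \<circ> T) (T x)"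
proof (induction p)
  case (pCons a p)
  have "T (poly_op (pCons a p) (T \<circ> T) x) = cnj a *\<^sub>C T x + (T \<circ> T) (T (poly_op p (T \<circ> T) x))"
    by (subst sq.poly_op_pCons) (simp only: add antilinear o_apply)
  also have "\<dots> = poly_op (pCons (cnj a) (map_poly cnj p)) (T \<circ> T) (T x)"
    by (simp only: pCons.IH sq.poly_op_pCons)
  finally show ?case by (simp only: map_poly_pCons complex_cnj_zero)
qed (simp add: zero)

text \<open>Simplicity of the spectrum forces the orthogonal complement of a subspace reducing \<open>T\<^sup>2\<close> to
  be invariant under \<open>T\<close> itself: with \<open>v = a + b\<close> split along \<open>N\<close>, polynomials in \<open>T\<^sup>2\<close> that
  send \<open>v\<close> close to \<open>y \<in> N\<close> send \<open>b\<close> close to \<open>0\<close>.\<close>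

lemma orthogonal_complement_invariant:
  assumes N: "hardy.subspace N" "closed N" "\<And>x. x \<in> N \<Longrightarrow> T (T x) \<in> N"
    and x: "x \<in> closure (range (\<lambda>p. poly_op p (T \<circ> T) v))" "\<And>z. z \<in> N \<Longrightarrow> cinner x z = 0"
    and y: "y \<in> closure (range (\<lambda>p. poly_op p (T \<circ> T) v))" "y \<in> N"
  shows "cinner (T x) y = 0"
proof -
  let ?B = "T \<circ> T"
  obtain a where a: "a \<in> N" "\<And>z. z \<in> N \<Longrightarrow> cinner (v - a) z = 0"
    by (rule hardy_orthogonal_projection[OF N(1,2)]) (rule that)
  define b where "b = v - a"
  have pv: "poly_op p ?B v = poly_op p ?B a + poly_op p ?B b" for p
    by (simp add: b_def sq.poly_op_diff_arg)
  have pa: "poly_op p ?B z \<in> N" if "z \<in> N" for p z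
    using sq.poly_op_in_hardy_subspace[OF N(1) _ that] N(3) by simp
  have pb: "cinner (poly_op p ?B b) z = 0" if "z \<in> N" for p z
    using a(2)[OF pa[OF that]] by (simp add: sq.poly_op_adjoint b_def)
  obtain p where p: "(\<lambda>n. poly_op (p n) ?B v) \<longlonglongrightarrow> x"
    by (rule closure_range_sequence[OF x(1)])
  obtain q where q: "(\<lambda>n. poly_op (q n) ?B v) \<longlonglongrightarrow> y"
    by (rule closure_range_sequence[OF y(1)])
  have pl: "(\<lambda>n. poly_op (p n) ?B b) \<longlonglongrightarrow> x"
  proof -
    have "norm (x - poly_op (p n) ?B b) \<le> norm (x - poly_op (p n) ?B v)" for n
      using norm_le_norm_diff_orthogonal(1)[of "x - poly_op (p n) ?B b" "poly_op (p n) ?B a"] x(2) pb pa a(1)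
      by (simp add: inner_hardy_def cinner.diff_left pv algebra_simps)
    moreover have "(\<lambda>n. norm (x - poly_op (p n) ?B v)) \<longlonglongrightarrow> norm (x - x)" by (intro tendsto_intros p)
    ultimately have "(\<lambda>n. x - poly_op (p n) ?B b) \<longlonglongrightarrow> 0"
      by (intro Lim_null_comparison[of "\<lambda>n. x - poly_op (p n) ?B b" "\<lambda>n. norm (x - poly_op (p n) ?B v)"]) auto
    from tendsto_diff[OF tendsto_const this, of x] show ?thesis by simp
  qed
  have ql: "(\<lambda>n. poly_op (q n) ?B a) \<longlonglongrightarrow> y" "(\<lambda>n. poly_op (q n) ?B b) \<longlonglongrightarrow> 0"
  proof -
    have orth: "inner (y - poly_op (q n) ?B a) (poly_op (q n) ?B b) = 0" for n
      using pb[OF hardy.subspace_diff[OF N(1) y(2) pa[OF a(1)]]]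
      by (subst inner_commute) (simp add: inner_hardy_def)
    have eq: "y - poly_op (q n) ?B v = y - poly_op (q n) ?B a - poly_op (q n) ?B b" for n
      by (simp add: pv)
    have z: "(\<lambda>n. norm (y - poly_op (q n) ?B v)) \<longlonglongrightarrow> 0"
      using tendsto_norm[OF tendsto_diff[OF tendsto_const q, of y]] by simp
    have "(\<lambda>n. y - poly_op (q n) ?B a) \<longlonglongrightarrow> 0"
      by (intro Lim_null_comparison[OF _ z] always_eventually allI)
        (unfold eq, rule norm_le_norm_diff_orthogonal(1)[OF orth])
    from tendsto_diff[OF tendsto_const this, of y] show "(\<lambda>n. poly_op (q n) ?B a) \<longlonglongrightarrow> y" by simp
    show "(\<lambda>n. poly_op (q n) ?B b) \<longlonglongrightarrow> 0"
      by (intro Lim_null_comparison[OF _ z] always_eventually allI)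
        (unfold eq, rule norm_le_norm_diff_orthogonal(2)[OF orth])
  qed
  have "cinner (T (poly_op r ?B b)) y = 0" for r
  proof (rule LIMSEQ_unique)
    show "(\<lambda>n. cinner (T (poly_op r ?B b)) (poly_op (q n) ?B a)) \<longlonglongrightarrow> cinner (T (poly_op r ?B b)) y"
      by (intro cinner.tendsto tendsto_const ql)
    have cc: "map_poly cnj (map_poly cnj p) = p" for p by (rule poly_eqI) (simp add: coeff_map_poly)
    \<comment> \<open>Polynomials in the square commute, and both sides equal <T b, (r q)(B) a>. The
      exchange moves \<open>q n\<close> onto \<open>b\<close>, where it tends to 0.\<close>
    have "cinner (T (poly_op r ?B b)) (poly_op (q n) ?B a) = cinner (T (poly_op (q n) ?B b)) (poly_op r ?B a)" for n
    proof -
      have "cinner (T (poly_op r ?B b)) (poly_op (q n) ?B a) = cinner (T b) (poly_op (r * q n) ?B a)"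
        by (simp only: poly_op_square_apply sq.poly_op_adjoint cc sq.poly_op_mult)
      also have "\<dots> = cinner (T b) (poly_op (q n * r) ?B a)" by (simp only: mult.commute)
      also have "\<dots> = cinner (T (poly_op (q n) ?B b)) (poly_op r ?B a)"
        by (simp only: poly_op_square_apply sq.poly_op_adjoint cc sq.poly_op_mult)
      finally show ?thesis .
    qed
    moreover have "(\<lambda>n. cinner (T (poly_op (q n) ?B b)) (poly_op r ?B a)) \<longlonglongrightarrow> cinner (T 0) (poly_op r ?B a)"
      by (intro cinner.tendsto tendsto_const tendsto ql)
    ultimately show "(\<lambda>n. cinner (T (poly_op r ?B b)) (poly_op (q n) ?B a)) \<longlonglongrightarrow> 0"
      by (simp add: zero)
  qed
  moreover have "(\<lambda>n. cinner (T (poly_op (p n) ?B b)) y) \<longlonglongrightarrow> cinner (T x) y"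
    by (intro cinner.tendsto tendsto_const tendsto pl)
  ultimately show ?thesis by (simp add: LIMSEQ_const_iff)
qed

end

section \<open>Algebra of the Hankel operators\<close>

lemma is_hankel_unique:
  assumes "is_hankel u G" "is_hankel u G'"
  shows "G = G'"
proof
  fix x
  have m: "G (monomial k) = G' (monomial k)" for k
    by (rule hardy_eqI_monomials) (use assms in \<open>simp add: is_hankel_def\<close>)
  show "G x = G' x"
    by (rule hardy_bounded_linear_eqI) (use assms m in \<open>auto simp: is_hankel_def bounded_clinear_def\<close>)
qed

lemma hankel_eq: "is_hankel u G \<Longrightarrow> hankel u = G"
  unfolding hankel_def by (rule the_equality) (auto intro: is_hankel_unique)

text \<open>With a bounded operator \<open>G\<close> realising the matrix at hand, uniqueness
  identifies \<open>hankel u\<close> with it and makes \<open>anti_hankel\<close>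
  computable.\<close>

locale hankel_operator =
  fixes u :: hardy and G :: "hardy \<Rightarrow> hardy"
  assumes is_hankel: "is_hankel u G"
begin

abbreviation H :: "hardy \<Rightarrow> hardy" where "H \<equiv> anti_hankel u"
abbreviation Ht :: "hardy \<Rightarrow> hardy" where "Ht \<equiv> anti_hankel_tilde u"

lemma bounded_linear_G: "bounded_linear G"
  using is_hankel by (simp add: is_hankel_def bounded_clinear_def)

lemma G_scaleC: "G (c *\<^sub>C x) = c *\<^sub>C G x"
  using is_hankel by (simp add: is_hankel_def bounded_clinear_def)

lemma G_matrix: "cinner (G (monomial k)) (monomial j) = cinner u (monomial (j + k))"
  using is_hankel by (simp add: is_hankel_def fourier_eq_cinner)

lemma H_eq: "H x = G (cconj x)"
  by (simp add: anti_hankel_def hankel_eq[OF is_hankel])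

lemma Ht_eq: "Ht x = bshift (H x)"
  by (simp add: anti_hankel_tilde_def adjoint_shift)

text \<open>The matrix depends on j + k only, so it is symmetric. For the sesquilinear
  \<open>cinner\<close> a transpose is an adjoint conjugated by \<open>cconj\<close>, which accounts
  for the two conjugations.\<close>

lemma G_symmetric: "cinner (G x) y = cinner (G (cconj y)) (cconj x)"
proof -
  have 1: "cinner (G x) (d *\<^sub>C monomial j) = cinner (G (cconj (d *\<^sub>C monomial j))) (cconj x)" for x d j
  proof (rule hardy_bounded_linear_eqI[where f="\<lambda>x. cinner (G x) (d *\<^sub>C monomial j)"])
    show "bounded_linear (\<lambda>x. cinner (G x) (d *\<^sub>C monomial j))"
      by (rule bounded_linear_compose[OF cinner.bounded_linear_left bounded_linear_G])
    show "bounded_linear (\<lambda>x. cinner (G (cconj (d *\<^sub>C monomial j))) (cconj x))"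
      by (rule bounded_linear_compose[OF cinner.bounded_linear_right bounded_linear_cconj])
  qed (simp add: G_scaleC cconj_scaleC cinner_scaleC_left cinner_scaleC_right G_matrix add.commute)
  show ?thesis
  proof (rule hardy_bounded_linear_eqI[where f="\<lambda>y. cinner (G x) y"])
    show "bounded_linear (cinner (G x))" by (rule cinner.bounded_linear_right)
    show "bounded_linear (\<lambda>y. cinner (G (cconj y)) (cconj x))"
      by (intro bounded_linear_compose[OF cinner.bounded_linear_left] bounded_linear_compose[OF bounded_linear_G]
          bounded_linear_cconj)
  qed (rule 1)
qed

sublocale H: antilinear_symmetric H
proof (rule antilinear_symmetric.intro)
  have "H = (\<lambda>x. G (cconj x))" by (simp add: fun_eq_iff H_eq)
  then show "bounded_linear H"
    using bounded_linear_compose[OF bounded_linear_G bounded_linear_cconj] by simp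
  show "H (c *\<^sub>C x) = cnj c *\<^sub>C H x" for c x by (simp add: H_eq cconj_scaleC G_scaleC)
  show "cinner (H x) y = cinner (H y) x" for x y
    using G_symmetric[of "cconj x" y] by (simp add: H_eq)
qed

lemma H_1: "H (monomial 0) = u"
  by (rule hardy_eqI_monomials) (simp add: H_eq G_matrix)

text \<open>Raising the row index of a Hankel matrix has the same effect as raising its column
  index.\<close>

lemma bshift_G: "bshift (G x) = G (shift x)"
proof (rule hardy_bounded_linear_eqI[where f="\<lambda>x. bshift (G x)"])
  show "bounded_linear (\<lambda>x. bshift (G x))"
    by (rule bounded_linear_compose[OF bounded_linear_bshift bounded_linear_G])
  show "bounded_linear (\<lambda>x. G (shift x))"
    by (rule bounded_linear_compose[OF bounded_linear_G bounded_linear_shift])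
  show "bshift (G (c *\<^sub>C monomial k)) = G (shift (c *\<^sub>C monomial k))" for c k
    by (rule hardy_eqI_monomials)
      (simp add: cinner_bshift_left shift_scaleC G_scaleC cinner_scaleC_left shift_monomial G_matrix)
qed

lemma Ht_eq_shift: "Ht x = H (shift x)"
  by (simp add: Ht_eq H_eq bshift_G shift_cconj)

sublocale Ht: antilinear_symmetric Ht
proof (rule antilinear_symmetric.intro)
  have "Ht = (\<lambda>x. bshift (H x))" by (simp add: fun_eq_iff Ht_eq)
  then show "bounded_linear Ht"
    using bounded_linear_compose[OF bounded_linear_bshift H.bounded_linear_T] by simp
  show "Ht (c *\<^sub>C x) = cnj c *\<^sub>C Ht x" for c x
    by (simp add: Ht_eq_shift shift_scaleC H.antilinear)
  show "cinner (Ht x) y = cinner (Ht y) x" for x y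
    using H.symmetric[of x "shift y"] by (metis Ht_eq Ht_eq_shift cinner_bshift_left)
qed

lemma cinner_H_1: "cinner (H x) (monomial 0) = cinner u x"
  using H.symmetric[of x "monomial 0"] by (simp add: H_1)

text \<open>The square is \<open>H\<close>, then the backward shift, then the shift, then
  \<open>H\<close>. The two middle maps together remove the constant term <H x, 1> = <u, x>, and the
  outer \<open>H\<close> sends this term to the conjugate multiple of H 1 = u.\<close>

lemma Ht_square: "Ht (Ht x) = H (H x) - cinner x u *\<^sub>C u"
proof -
  have "Ht (Ht x) = H (H x - cinner u x *\<^sub>C monomial 0)"
    by (simp add: Ht_eq_shift[of "Ht x"]) (simp add: Ht_eq shift_bshift cinner_H_1)
  also have "\<dots> = H (H x) - cnj (cinner u x) *\<^sub>C u"
    by (simp add: H.diff H.antilinear H_1)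
  finally show ?thesis by (metis cinner_commute)
qed

lemma kernel_orthogonal_u: "H x = 0 \<Longrightarrow> cinner x u = 0"
  using cinner_H_1[of x] by (subst cinner_commute) simp

lemma cconj_G:
  assumes r: "\<forall>k. Im (cinner u (monomial k)) = 0"
  shows "cconj (G x) = G (cconj x)"
proof (rule hardy_bounded_linear_eqI[where f="\<lambda>x. cconj (G x)"])
  show "bounded_linear (\<lambda>x. cconj (G x))"
    by (rule bounded_linear_compose[OF bounded_linear_cconj bounded_linear_G])
  show "bounded_linear (\<lambda>x. G (cconj x))"
    by (rule bounded_linear_compose[OF bounded_linear_G bounded_linear_cconj])
  have "cconj (G (monomial k)) = G (monomial k)" for k
  proof (rule hardy_eqI_monomials)
    fix j
    have "cinner (cconj (G (monomial k))) (monomial j) = cnj (cinner (G (monomial k)) (monomial j))"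
      using cinner_cconj_cconj[of "G (monomial k)" "monomial j"] by simp
    then show "cinner (cconj (G (monomial k))) (monomial j) = cinner (G (monomial k)) (monomial j)"
      using r by (simp add: G_matrix complex_eq_iff)
  qed
  then show "cconj (G (c *\<^sub>C monomial k)) = G (cconj (c *\<^sub>C monomial k))" for c k
    by (simp add: G_scaleC cconj_scaleC)
qed

text \<open>A symmetric matrix is Hermitian exactly when its entries are real, and the entries are
  the Fourier coefficients of \<open>u\<close>. Conversely, real entries make \<open>G\<close>
  commute with \<open>cconj\<close>, which reduces the claim to \<open>G_symmetric\<close>.\<close>

lemma selfadjoint_iff: "selfadjoint G \<longleftrightarrow> (\<forall>k. Im (cinner u (monomial k)) = 0)"
proof
  assume s: "selfadjoint G"
  show "\<forall>k. Im (cinner u (monomial k)) = 0"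
  proof
    fix k
    have "cinner u (monomial k) = cinner (G (monomial k)) (monomial 0)" by (simp add: G_matrix)
    also have "\<dots> = cinner (monomial k) (G (monomial 0))" using s by (simp add: selfadjoint_def)
    also have "\<dots> = cnj (cinner (G (monomial 0)) (monomial k))" by (rule cinner_commute)
    also have "\<dots> = cnj (cinner u (monomial k))" by (simp add: G_matrix)
    finally show "Im (cinner u (monomial k)) = 0" by (simp add: complex_eq_iff)
  qed
next
  assume r: "\<forall>k. Im (cinner u (monomial k)) = 0"
  have "cinner (G x) y = cinner x (G y)" for x y
  proof -
    have "cinner (G x) y = cinner (G (cconj y)) (cconj x)" by (rule G_symmetric)
    also have "\<dots> = cinner (cconj (G y)) (cconj x)" using cconj_G[OF r] by simp
    also have "\<dots> = cnj (cinner (G y) x)" by (rule cinner_cconj_cconj)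
    also have "\<dots> = cinner x (G y)" by (rule cinner_commute[symmetric])
    finally show ?thesis .
  qed
  then show "selfadjoint G" by (simp add: selfadjoint_def)
qed

end

context positive_operator
begin

lemma closure_range_poly_op_invariant:
  assumes "x \<in> closure (range (\<lambda>p. poly_op p A v))"
  shows "A x \<in> closure (range (\<lambda>p. poly_op p A v))"
proof (rule bounded_linear_image_closure[OF bounded_linear_A _ closed_closure assms])
  fix x assume "x \<in> range (\<lambda>p. poly_op p A v)"
  then obtain p where "x = poly_op p A v" by blast
  then have "A x = poly_op ([:0, 1:] * p) A v" by (simp only: poly_op_mult poly_op_X)
  then show "A x \<in> closure (range (\<lambda>p. poly_op p A v))"
    by (intro subsetD[OF closure_subset]) blast
qed

lemma simple_spectrum_on_imp_closure_range:
  assumes "simple_spectrum_on M A"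
  obtains v where "M \<subseteq> closure (range (\<lambda>p. poly_op p A v))"
  using assms closure_mono[OF span_powers_subset] unfolding simple_spectrum_on_def by blast

end

section \<open>The closed range and the cyclicity of u\<close>

context hankel_operator
begin

lemma ran_subspace: "hardy.subspace (ran u)"
  unfolding ran_def
proof (rule hardy_subspace_closure, unfold hardy.subspace_def, safe)
  show "0 \<in> range H" by (rule range_eqI[of _ _ 0]) (simp add: H.zero)
next
  fix x y show "H x + H y \<in> range H" by (rule range_eqI[of _ _ "x + y"]) (simp add: H.add)
next
  fix c x show "c *\<^sub>C H x \<in> range H" by (rule range_eqI[of _ _ "cnj c *\<^sub>C x"]) (simp add: H.antilinear)
qed

lemma closed_ran: "closed (ran u)"
  by (simp add: ran_def)

lemma H_in_ran: "H x \<in> ran u"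
  unfolding ran_def by (rule subsetD[OF closure_subset]) simp

lemma Ht_in_ran: "Ht x \<in> ran u"
  by (simp add: Ht_eq_shift H_in_ran)

lemma u_in_ran: "u \<in> ran u"
  using H_in_ran[of "monomial 0"] by (simp add: H_1)

lemma H_eq_0_if_orthogonal:
  assumes "\<And>z. z \<in> ran u \<Longrightarrow> cinner x z = 0"
  shows "H x = 0"
proof (rule cinner_eq_0_all)
  fix y
  have "cinner x (H y) = 0" by (rule assms[OF H_in_ran])
  then have "cinner (H y) x = 0" by (subst cinner_commute) simp
  then show "cinner (H x) y = 0" by (simp add: H.symmetric)
qed

text \<open>By symmetry a kernel vector is orthogonal to the range; lying in its closure, it is
  orthogonal to itself.\<close>

lemma H_injective_on_ran:
  assumes x: "x \<in> ran u" and Hx: "H x = 0"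
  shows "x = 0"
proof -
  have "closed {y. cinner y x = 0}"
    by (intro closed_Collect_eq continuous_intros linear_continuous_on cinner.bounded_linear_left)
  moreover have "range H \<subseteq> {y. cinner y x = 0}"
    using Hx by (auto simp: H.symmetric[of _ x])
  ultimately have "cinner x x = 0"
    using closure_minimal x unfolding ran_def by blast
  then show ?thesis using cinner_self(3)[of x] by simp
qed

text \<open>On vectors orthogonal to \<open>u\<close> the squares of the two operators agree, so the backward shift acts
  isometrically on the orthogonal complement of the cyclic subspace of \<open>u\<close>; an invariant subspace
  on which it is isometric consists of functions with vanishing Fourier coefficients.\<close>

lemma ran_subset_cyclic:
  assumes v: "ran u \<subseteq> closure (range (\<lambda>p. poly_op p (H \<circ> H) v))"
    and w: "ran u \<subseteq> closure (range (\<lambda>p. poly_op p (Ht \<circ> Ht) w))"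
  shows "ran u \<subseteq> closure (range (\<lambda>p. poly_op p (H \<circ> H) u))"
proof -
  define N where "N = closure (range (\<lambda>p. poly_op p (H \<circ> H) u))"
  have N: "hardy.subspace N" "closed N"
    unfolding N_def by (rule hardy_subspace_closure[OF H.sq.subspace_range_poly_op]) simp
  have uN: "u \<in> N"
    unfolding N_def by (rule subsetD[OF closure_subset]) (rule range_eqI[of _ _ 1], simp)
  have HN: "H (H x) \<in> N" if "x \<in> N" for x
    using H.sq.closure_range_poly_op_invariant that unfolding N_def by simp
  have HtN: "Ht (Ht x) \<in> N" if "x \<in> N" for x
    unfolding Ht_square by (intro hardy.subspace_diff[OF N(1)] hardy.subspace_scale[OF N(1)] HN that uN)
  have N_ran: "N \<subseteq> ran u"
    unfolding N_def
  proof (rule closure_minimal[OF _ closed_ran])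
    show "range (\<lambda>p. poly_op p (H \<circ> H) u) \<subseteq> ran u"
      using H.sq.poly_op_in_hardy_subspace[OF ran_subspace _ u_in_ran] by (auto simp: H_in_ran)
  qed
  define N' where "N' = {x \<in> ran u. \<forall>z\<in>N. cinner x z = 0}"
  have N': "hardy.subspace N'" "closed N'"
    unfolding N'_def by (rule hardy_subspace_orthogonal[OF ran_subspace], rule closed_orthogonal[OF closed_ran])
  \<comment> \<open>The simple spectra enter here: that \<open>N\<close> reduces the squares does
    not by itself make the complement invariant under \<open>H\<close> or \<open>Ht\<close>; the
    cyclic vectors \<open>v\<close> and \<open>w\<close> supply this.\<close>
  have HN': "H x \<in> N'" if "x \<in> N'" for x
  proof -
    have "cinner (H x) z = 0" if "z \<in> N" for z
      by (rule H.orthogonal_complement_invariant[OF N HN]) (use \<open>x \<in> N'\<close> that v N_ran in \<open>auto simp: N'_def\<close>)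
    then show ?thesis by (simp add: N'_def H_in_ran)
  qed
  have HtN': "Ht x \<in> N'" if "x \<in> N'" for x
  proof -
    have "cinner (Ht x) z = 0" if "z \<in> N" for z
      by (rule Ht.orthogonal_complement_invariant[OF N HtN]) (use \<open>x \<in> N'\<close> that w N_ran in \<open>auto simp: N'_def\<close>)
    then show ?thesis by (simp add: N'_def Ht_in_ran)
  qed
  define W where "W = closure (H ` N')"
  have "hardy.subspace (H ` N')"
    unfolding hardy.subspace_def
  proof safe
    show "0 \<in> H ` N'" by (rule image_eqI[of _ _ 0]) (simp_all add: H.zero hardy.subspace_0[OF N'(1)])
  next
    fix x y assume "x \<in> N'" "y \<in> N'"
    then show "H x + H y \<in> H ` N'"
      by (intro image_eqI[of _ _ "x + y"]) (simp_all add: H.add hardy.subspace_add[OF N'(1)])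
  next
    fix c x assume "x \<in> N'"
    then show "c *\<^sub>C H x \<in> H ` N'"
      by (intro image_eqI[of _ _ "cnj c *\<^sub>C x"]) (simp_all add: H.antilinear hardy.subspace_scale[OF N'(1)])
  qed
  then have W: "hardy.subspace W" "closed W"
    unfolding W_def by (simp_all add: hardy_subspace_closure)
  have "W \<subseteq> N'"
    unfolding W_def by (rule closure_minimal[OF _ N'(2)]) (use HN' in blast)
  \<comment> \<open>A vector of \<open>N'\<close> orthogonal to H N' is annihilated by
    \<open>H\<close>, since applying \<open>H\<close> twice to it lands in \<open>W\<close>;
    injectivity leaves only 0. Hence statements about the backward shift on \<open>N'\<close> can be
    checked on the vectors H x, where it is Ht x.\<close>
  have N'W: "N' \<subseteq> W"
  proof
    fix z assume z: "z \<in> N'"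
    obtain y where y: "y \<in> W" "\<And>x. x \<in> W \<Longrightarrow> cinner (z - y) x = 0"
      by (rule hardy_orthogonal_projection[OF W]) (rule that)
    have zy: "z - y \<in> N'" using z y(1) \<open>W \<subseteq> N'\<close> by (intro hardy.subspace_diff[OF N'(1)]) auto
    have "cinner (H (z - y)) (H (z - y)) = 0"
    proof -
      have "H (H (z - y)) \<in> W"
        unfolding W_def by (intro subsetD[OF closure_subset] imageI HN' zy)
      from y(2)[OF this] have "cinner (H (H (z - y))) (z - y) = 0" by (subst cinner_commute) simp
      then show ?thesis by (simp add: H.symmetric[of "H (z - y)"])
    qed
    then have Hzy: "H (z - y) = 0" using cinner_self(3)[of "H (z - y)"] by simp
    have "z - y \<in> ran u" using zy unfolding N'_def by blast
    from H_injective_on_ran[OF this Hzy] have "z - y = 0" .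
    then show "z \<in> W" using y(1) by simp
  qed
  have bs: "bshift z \<in> N'" if "z \<in> N'" for z
  proof (rule bounded_linear_image_closure[OF bounded_linear_bshift _ N'(2)])
    show "z \<in> closure (H ` N')" using N'W that by (auto simp: W_def)
    fix y assume "y \<in> H ` N'"
    then obtain x where "x \<in> N'" "y = H x" by blast
    then show "bshift y \<in> N'" using HtN' by (simp add: Ht_eq)
  qed
  \<comment> \<open>The constant coefficient of H x is <u, x>, and \<open>u\<close> lies in
    \<open>N\<close>. Iterating the backward shift inside \<open>N'\<close> then kills every
    coefficient.\<close>
  have z0: "cinner z (monomial 0) = 0" if "z \<in> N'" for z
  proof -
    have "closed {y. cinner y (monomial 0) = 0}"
      by (intro closed_Collect_eq continuous_intros linear_continuous_on cinner.bounded_linear_left)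
    moreover have "H ` N' \<subseteq> {y. cinner y (monomial 0) = 0}"
    proof safe
      fix x assume "x \<in> N'"
      then have "cinner x u = 0" using uN by (simp add: N'_def)
      then show "cinner (H x) (monomial 0) = 0"
        unfolding cinner_H_1 by (subst cinner_commute) simp
    qed
    ultimately show ?thesis
      using closure_minimal[of "H ` N'"] N'W that unfolding W_def by blast
  qed
  have "cinner z (monomial k) = 0" if "z \<in> N'" for z k
    using that
  proof (induction k arbitrary: z)
    case (Suc k)
    then show ?case using Suc.IH[OF bs[OF Suc.prems]] by (simp add: cinner_bshift_left shift_monomial)
  qed (rule z0)
  then have N'0: "z = 0" if "z \<in> N'" for z
    using hardy_eq_0_if_monomials that by blast
  show ?thesis
    unfolding N_def[symmetric]
  proof
    fix x assume x: "x \<in> ran u"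
    obtain y where y: "y \<in> N" "\<And>z. z \<in> N \<Longrightarrow> cinner (x - y) z = 0"
      by (rule hardy_orthogonal_projection[OF N]) (rule that)
    have "x - y \<in> N'"
      using x y N_ran by (auto simp: N'_def intro: hardy.subspace_diff[OF ran_subspace])
    then have "x - y = 0" by (rule N'0)
    then show "x \<in> N" using y(1) by simp
  qed
qed

text \<open>The rank one correction <x, u> u does not leave the real subspace, because <x, u> is
  real there by \<open>cinner_real_cyclic\<close>; minimality then gives both inclusions.\<close>

lemma real_cyclic_tilde: "Ht.sq.real_cyclic u = H.sq.real_cyclic u"
proof
  have real: "cinner x u *\<^sub>C u = Re (cinner x u) *\<^sub>R u" if "Im (cinner x u) = 0" for x
    using that by (simp add: scaleR_hardy_def complex_eq_iff complex_is_Real_iff flip: of_real_Re)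
  show "Ht.sq.real_cyclic u \<subseteq> H.sq.real_cyclic u"
  proof (rule Ht.sq.real_cyclic_minimal[OF H.sq.subspace_real_cyclic H.sq.closed_real_cyclic _ H.sq.self_in_real_cyclic])
    fix x assume x: "x \<in> H.sq.real_cyclic u"
    have Im0: "Im (cinner x u) = 0" by (rule H.sq.cinner_real_cyclic[OF x H.sq.self_in_real_cyclic])
    have "(Ht \<circ> Ht) x = (H \<circ> H) x - cinner x u *\<^sub>C u" by (simp add: Ht_square)
    then show "(Ht \<circ> Ht) x \<in> H.sq.real_cyclic u"
      unfolding real[OF Im0]
      by (simp only: H.sq.real_cyclic_invariant[OF x] subspace_diff[OF H.sq.subspace_real_cyclic]
          subspace_scale[OF H.sq.subspace_real_cyclic] H.sq.self_in_real_cyclic)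
  qed
  show "H.sq.real_cyclic u \<subseteq> Ht.sq.real_cyclic u"
  proof (rule H.sq.real_cyclic_minimal[OF Ht.sq.subspace_real_cyclic Ht.sq.closed_real_cyclic _ Ht.sq.self_in_real_cyclic])
    fix x assume x: "x \<in> Ht.sq.real_cyclic u"
    have "Im (cinner x u) = 0" by (rule Ht.sq.cinner_real_cyclic[OF x Ht.sq.self_in_real_cyclic])
    moreover have "(H \<circ> H) x = (Ht \<circ> Ht) x + cinner x u *\<^sub>C u" by (simp add: Ht_square)
    ultimately show "(H \<circ> H) x \<in> Ht.sq.real_cyclic u"
      using Ht.sq.real_cyclic_invariant[OF x]
      by (simp only: real subspace_add[OF Ht.sq.subspace_real_cyclic] subspace_scale[OF Ht.sq.subspace_real_cyclic]
          Ht.sq.self_in_real_cyclic)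
  qed
qed

lemma real_fourier_if_invariant:
  assumes cyc: "ran u \<subseteq> closure (range (\<lambda>p. poly_op p (H \<circ> H) u))"
    and HR: "\<And>x. x \<in> H.sq.real_cyclic u \<Longrightarrow> H x \<in> H.sq.real_cyclic u"
    and HtR: "\<And>x. x \<in> H.sq.real_cyclic u \<Longrightarrow> Ht x \<in> H.sq.real_cyclic u"
  shows "Im (cinner u (monomial k)) = 0"
proof -
  define R where "R = H.sq.real_cyclic u"
  have R: "subspace R" "closed R" "u \<in> R" "\<And>x y. x \<in> R \<Longrightarrow> y \<in> R \<Longrightarrow> Im (cinner x y) = 0"
    unfolding R_def
    by (rule H.sq.subspace_real_cyclic H.sq.closed_real_cyclic H.sq.self_in_real_cyclic H.sq.cinner_real_cyclic; assumption)+
  have R_ran: "R \<subseteq> ran u"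
    unfolding R_def
    by (rule H.sq.real_cyclic_minimal[OF hardy_subspace_imp_subspace[OF ran_subspace] closed_ran _ u_in_ran])
      (simp add: H_in_ran)
  obtain K where K: "K > 0" "\<And>x. norm (H x) \<le> norm x * K" using H.pos_bounded by blast
  \<comment> \<open>The approximation starts from an arbitrary f with H f close to y. Projecting f
    to the closed range leaves H f unchanged, cyclicity replaces the projection by x + i y' with x
    and y' in \<open>R\<close>, and finally y' is dropped.\<close>
  have dense: "y \<in> closure (H ` R)" if y: "y \<in> R" for y
    unfolding closure_approachable
  proof (intro allI impI)
    fix e :: real assume e: "e > 0"
    obtain f where f: "dist (H f) y < e / 2"
      using y R_ran e closure_approachable[of y "range H"] unfolding ran_def by (auto dest!: spec[of _ "e/2"])
    obtain m where m: "m \<in> ran u" "\<And>z. z \<in> ran u \<Longrightarrow> cinner (f - m) z = 0"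
      by (rule hardy_orthogonal_projection[OF ran_subspace closed_ran]) (rule that)
    have Hf: "H f = H m" using H_eq_0_if_orthogonal[OF m(2)] by (simp add: H.diff)
    have "m \<in> closure (range (\<lambda>p. poly_op p (H \<circ> H) u))" using m(1) cyc by blast
    moreover have "e / (2 * K) > 0" using e K(1) by simp
    ultimately obtain p where p: "dist (poly_op p (H \<circ> H) u) m < e / (2 * K)"
      unfolding closure_approachable by blast
    obtain r s where rs: "poly_op p (H \<circ> H) u = poly_op (cpoly r) (H \<circ> H) u + \<i> *\<^sub>C poly_op (cpoly s) (H \<circ> H) u"
      using H.sq.poly_op_real_imag by blast
    define x y' where "x = poly_op (cpoly r) (H \<circ> H) u" and "y' = poly_op (cpoly s) (H \<circ> H) u"
    have xR: "x \<in> R" "y' \<in> R"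
      unfolding R_def H.sq.real_cyclic_def x_def y'_def by (rule subsetD[OF closure_subset], blast)+
    have "norm (H (x + \<i> *\<^sub>C y' - m)) \<le> norm (x + \<i> *\<^sub>C y' - m) * K" by (rule K(2))
    also have "\<dots> < e / (2 * K) * K"
      using p K(1) by (intro mult_strict_right_mono) (simp_all add: dist_norm rs x_def y'_def)
    also have "\<dots> = e / 2" using K(1) by simp
    finally have "norm (H (x + \<i> *\<^sub>C y') - H m) < e / 2" by (simp add: H.diff)
    then have "dist y (H (x + \<i> *\<^sub>C y')) < e"
      using f dist_triangle_half_r[of "H m" y e "H (x + \<i> *\<^sub>C y')"] by (simp add: Hf dist_norm norm_minus_commute)
    \<comment> \<open>Anti-linearity gives H x - i H y', and \<open>R\<close> is orthogonal to i R
      for the real inner product; by Pythagoras, dropping the second term only brings H x closer to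
      y.\<close>
    moreover have "y - H (x + \<i> *\<^sub>C y') = (y - H x) - (- \<i>) *\<^sub>C H y'"
      by (simp add: H.add H.antilinear)
    moreover have "inner (y - H x) ((- \<i>) *\<^sub>C H y') = 0"
    proof -
      have "Im (cinner (y - H x) (H y')) = 0"
        by (intro R(4) subspace_diff[OF R(1)] y) (use HR xR in \<open>auto simp: R_def\<close>)
      then show ?thesis by (simp add: inner_hardy_def cinner_scaleC_right cinner.minus_right)
    qed
    ultimately have "norm (y - H x) < e"
      using norm_le_norm_diff_orthogonal(1)[of "y - H x" "(- \<i>) *\<^sub>C H y'"] by (simp add: dist_norm)
    then show "\<exists>z\<in>H ` R. dist z y < e"
      using xR(1) by (auto simp: dist_norm norm_minus_commute)
  qed
  have bs: "bshift z \<in> R" if "z \<in> R" for z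
  proof (rule bounded_linear_image_closure[OF bounded_linear_bshift _ R(2) dense[OF that]])
    fix y assume "y \<in> H ` R"
    then obtain x where "x \<in> R" "y = H x" by blast
    then show "bshift y \<in> R" using HtR by (simp add: R_def Ht_eq)
  qed
  \<comment> \<open>The constant coefficient of H x is <u, x>, the inner product of two vectors of
    \<open>R\<close> when x lies in \<open>R\<close>.\<close>
  have z0: "Im (cinner z (monomial 0)) = 0" if "z \<in> R" for z
  proof -
    have "closed {y. Im (cinner y (monomial 0)) = 0}"
      by (intro closed_Collect_eq continuous_intros linear_continuous_on cinner.bounded_linear_left)
    moreover have "H ` R \<subseteq> {y. Im (cinner y (monomial 0)) = 0}"
      using R(3,4) by (auto simp: cinner_H_1)
    ultimately show ?thesis
      using closure_minimal[of "H ` R"] dense[OF that] by blast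
  qed
  have "Im (cinner z (monomial k)) = 0" if "z \<in> R" for z k
    using that
  proof (induction k arbitrary: z)
    case (Suc k)
    then show ?case using Suc.IH[OF bs[OF Suc.prems]] by (simp add: cinner_bshift_left shift_monomial)
  qed (rule z0)
  then show ?thesis using R(3) by blast
qed

section \<open>From real coefficients to real symbols\<close>

lemma fixed_by_cconj:
  assumes r: "\<And>k. Im (cinner u (monomial k)) = 0"
  defines "F \<equiv> {x. cconj x = x}"
  shows "subspace F" "closed F" "u \<in> F" "\<And>x. x \<in> F \<Longrightarrow> H x \<in> F" "\<And>x. x \<in> F \<Longrightarrow> Ht x \<in> F"
    "\<And>x y. x \<in> F \<Longrightarrow> y \<in> F \<Longrightarrow> Im (cinner x y) = 0"
proof -
  interpret c: bounded_linear cconj by (rule bounded_linear_cconj)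
  have r': "\<forall>k. Im (cinner u (monomial k)) = 0" using r by blast
  show "subspace F" by (auto simp: F_def subspace_def c.zero c.add c.scaleR)
  show "closed F"
    unfolding F_def by (intro closed_Collect_eq linear_continuous_on bounded_linear_cconj continuous_intros)
  show HF: "H x \<in> F" if "x \<in> F" for x
    using that cconj_G[OF r', of x] by (simp add: F_def H_eq)
  show "u \<in> F" using HF[of "monomial 0"] by (simp add: F_def H_1)
  show "Ht x \<in> F" if "x \<in> F" for x
  proof -
    have "shift x \<in> F" using that shift_cconj[of x] by (simp add: F_def)
    then show ?thesis unfolding Ht_eq_shift by (rule HF)
  qed
  show "Im (cinner x y) = 0" if "x \<in> F" "y \<in> F" for x y
    using that cinner_cconj_cconj[of x y] by (simp add: F_def complex_eq_iff)
qed

end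

text \<open>Invariance under \<open>T\<close> passes to its square and so to the modulus. All
  vectors r(|T|) u and their images under \<open>T\<close> therefore stay in \<open>F\<close>, where
  inner products are real.\<close>

lemma (in antilinear_symmetric) symbol_real_if_invariant:
  assumes Phi: "\<Phi> \<in> borel_measurable borel" "AE t in spectral_measure (abs_op T) u. cmod (\<Phi> t) \<le> C"
    and model: "\<And>f. L2_fun (spectral_measure (abs_op T) u) f \<Longrightarrow>
      T (borel_calc f (abs_op T) u) = abs_op T (borel_calc \<Phi> (abs_op T) (borel_calc (\<lambda>s. cnj (f s)) (abs_op T) u))"
    and F: "subspace F" "closed F" "u \<in> F" "\<And>x. x \<in> F \<Longrightarrow> T x \<in> F"
      "\<And>x y. x \<in> F \<Longrightarrow> y \<in> F \<Longrightarrow> Im (cinner x y) = 0"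
  shows "AE t in spectral_measure (abs_op T) u. t * Im (\<Phi> t) = 0"
proof (rule AE_Im_symbol_eq_0[OF Phi model])
  fix r
  have "abs_op T x \<in> F" if "x \<in> F" for x
    using abs_op_in_subspace[OF F(1,2) _ that] F(4) by blast
  then have "poly_op (cpoly r) (abs_op T) u \<in> F"
    by (intro abs.poly_op_in_subspace[OF F(1) _ F(3)])
  then show "Im (cinner (T (poly_op (cpoly r) (abs_op T) u)) u) = 0" by (intro F)
qed

lemma unimodular_real_iff: "z \<in> {1, -1} \<longleftrightarrow> Im z = 0" if "cmod z = 1"
proof
  assume "Im z = 0"
  then have "\<bar>Re z\<bar> = 1" using that by (simp add: cmod_eq_Re)
  then show "z \<in> {1, -1}" using \<open>Im z = 0\<close> by (auto simp: complex_eq_iff abs_if split: if_splits)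
qed auto

theorem theorem1p6:
  fixes u :: hardy and \<Gamma> :: "hardy \<Rightarrow> hardy" and \<Psi> \<Psi>t :: "real \<Rightarrow> complex"
  assumes "u \<in> BMOA_simp"
    and "is_hankel u \<Gamma>"
    and "is_Psi u \<Psi>"
    and "is_Psi_tilde u \<Psi>t"
  shows "selfadjoint \<Gamma> \<longleftrightarrow>
    (AE s in rho u. \<Psi> s \<in> {1, -1}) \<and> (AE s in rho_tilde0 u. \<Psi>t s \<in> {1, -1})"
proof -
  interpret hankel_operator u \<Gamma> by standard (rule assms(2))
  obtain v where v: "ran u \<subseteq> closure (range (\<lambda>p. poly_op p (H \<circ> H) v))"
    using assms(1) by (auto simp: BMOA_simp_def elim: H.sq.simple_spectrum_on_imp_closure_range)
  obtain w where w: "ran u \<subseteq> closure (range (\<lambda>p. poly_op p (Ht \<circ> Ht) w))"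
    using assms(1) by (auto simp: BMOA_simp_def elim: Ht.sq.simple_spectrum_on_imp_closure_range)
  note cyc = ran_subset_cyclic[OF v w]
  have Psi: "\<Psi> \<in> borel_measurable borel" "AE s in rho u. cmod (\<Psi> s) = 1"
    "\<And>f. L2_fun (rho u) f \<Longrightarrow> H (borel_calc f (absH u) u) =
        absH u (borel_calc (\<lambda>s. cnj (\<Psi> s)) (absH u) (borel_calc (\<lambda>s. cnj (f s)) (absH u) u))"
    using assms(3) by (auto simp: is_Psi_def)
  have Psit: "\<Psi>t \<in> borel_measurable borel" "AE s in rho_tilde0 u. cmod (\<Psi>t s) = 1"
    "\<And>f. L2_fun (rho_tilde u) f \<Longrightarrow> Ht (borel_calc f (absHt u) u) =
        absHt u (borel_calc \<Psi>t (absHt u) (borel_calc (\<lambda>s. cnj (f s)) (absHt u) u))"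
    using assms(4) by (auto simp: is_Psi_tilde_def)
  have "{0<..} \<inter> space (rho_tilde u) \<in> sets (rho_tilde u)"
    using Ht.abs.spectral_sets[of u] sets_eq_imp_space_eq[OF Ht.abs.spectral_sets[of u]] by (simp add: rho_tilde_def)
  then have AE0: "(AE s in rho_tilde0 u. P s) \<longleftrightarrow> (AE s in rho_tilde u. 0 < s \<longrightarrow> P s)" for P
    unfolding rho_tilde0_def by (subst AE_restrict_space_iff) auto
  have bd: "AE s in rho u. cmod (cnj (\<Psi> s)) \<le> 1"
    using Psi(2) by eventually_elim simp
  \<comment> \<open>Unimodularity is known on (0, \<infinity>) only. \<open>rho_tilde\<close> may
    have an atom at 0, where the symbol is arbitrary, so its value there enters the bound.\<close>
  have bdt: "AE s in rho_tilde u. cmod (\<Psi>t s) \<le> max 1 (cmod (\<Psi>t 0))"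
    using Psit(2)[unfolded AE0] Ht.abs.spectral_support[of u, folded rho_tilde_def]
  proof eventually_elim
    case (elim s)
    then show ?case by (cases "s = 0") auto
  qed
  have m: "(\<lambda>s. cnj (\<Psi> s)) \<in> borel_measurable borel" using Psi(1) by measurable
  \<comment> \<open>A vector killed by the modulus is killed by \<open>H\<close> and hence
    orthogonal to \<open>u\<close>; so \<open>rho\<close> has no atom at 0 and the factor s can be
    cancelled.\<close>
  have "AE s in rho u. s \<noteq> 0"
    unfolding rho_def by (rule H.abs.spectral_atom_0) (rule kernel_orthogonal_u[OF H.kernel_abs])
  then have iff: "(AE s in rho u. \<Psi> s \<in> {1, -1}) \<longleftrightarrow> (AE s in rho u. s * Im (cnj (\<Psi> s)) = 0)"
  proof -
    have "AE s in rho u. \<Psi> s \<in> {1, -1} \<longleftrightarrow> s * Im (cnj (\<Psi> s)) = 0"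
      using \<open>AE s in rho u. s \<noteq> 0\<close> Psi(2)
    proof eventually_elim
      case (elim s)
      then show ?case unfolding unimodular_real_iff[OF elim(2)] by simp
    qed
    then show ?thesis by (rule eventually_subst)
  qed
  \<comment> \<open>Here 0 is excluded by the restriction on the left and neutralised by the factor
    s on the right.\<close>
  have ifft: "(AE s in rho_tilde0 u. \<Psi>t s \<in> {1, -1}) \<longleftrightarrow> (AE s in rho_tilde u. s * Im (\<Psi>t s) = 0)"
  proof -
    have "AE s in rho_tilde u. (0 < s \<longrightarrow> \<Psi>t s \<in> {1, -1}) \<longleftrightarrow> s * Im (\<Psi>t s) = 0"
      using Psit(2)[unfolded AE0] Ht.abs.spectral_support[of u, folded rho_tilde_def]
    proof eventually_elim
      case (elim s)
      show ?case
      proof (cases "s = 0")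
        case False
        then have s: "0 < s" using elim(2) by simp
        then have "\<Psi>t s \<in> {1, -1} \<longleftrightarrow> Im (\<Psi>t s) = 0"
          using elim(1) by (intro unimodular_real_iff) blast
        then show ?thesis using s by auto
      qed simp
    qed
    then show ?thesis unfolding AE0 by (rule eventually_subst)
  qed
  show ?thesis
    unfolding iff ifft selfadjoint_iff
  proof safe
    assume "\<forall>k. Im (cinner u (monomial k)) = 0"
    then have r: "\<And>k. Im (cinner u (monomial k)) = 0" by blast
    note F = fixed_by_cconj[OF r]
    show "AE s in rho u. s * Im (cnj (\<Psi> s)) = 0"
      unfolding rho_def
      by (rule H.symbol_real_if_invariant[OF m bd[unfolded rho_def] Psi(3)[unfolded rho_def] F(1-4,6)])
    show "AE s in rho_tilde u. s * Im (\<Psi>t s) = 0"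
      unfolding rho_tilde_def
      by (rule Ht.symbol_real_if_invariant[OF Psit(1) bdt[unfolded rho_tilde_def] Psit(3)[unfolded rho_tilde_def] F(1-3,5,6)])
  next
    fix k
    assume a: "AE s in rho u. s * Im (cnj (\<Psi> s)) = 0" "AE s in rho_tilde u. s * Im (\<Psi>t s) = 0"
    show "Im (cinner u (monomial k)) = 0"
    proof (rule real_fourier_if_invariant[OF cyc])
      show "H x \<in> H.sq.real_cyclic u" if "x \<in> H.sq.real_cyclic u" for x
        by (rule H.real_cyclic_invariant_T[OF m bd[unfolded rho_def] Psi(3)[unfolded rho_def] a(1)[unfolded rho_def] that])
      show "Ht x \<in> H.sq.real_cyclic u" if "x \<in> H.sq.real_cyclic u" for x
        using Ht.real_cyclic_invariant_T[OF Psit(1) bdt[unfolded rho_tilde_def] Psit(3)[unfolded rho_tilde_def] a(2)[unfolded rho_tilde_def]]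
          that by (simp add: real_cyclic_tilde)
    qed
  qed
qed

end
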